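(* Let $\mathcal{L}=\{L_1,\dots,L_k\}$ be a set of lines in $\mathbb{R}^d$ in general position, and let $G=(\mathcal{V},\mathcal{E})$, $\mathcal{V}=\bigcup_{i=1}^k V_i$, be a crossing partitioned graph. If $G$ is generically globally $\mathcal{L}$-rigid, then $G$ is P-connected and redundantly $\mathcal{L}$-rigid.
   Context: Every line in $\mathbb{R}^d$ has a unique standard equation $Ax=b$ with $(A,b)$ a $(d-1)\times(d+1)$ matrix in reduced row echelon form; $A_i x=b_i$ is that of $L_i$. $\mathbb{Q}(\mathcal{L})$ is the smallest subfield of $\mathbb{R}$ containing all entries of all $(A_i,b_i)$. Three pairwise non-parallel lines $L_1,L_2,L_3$ are weakly concurrent if the closest point in $L_1$ to $L_2$ coincides with the closest point in $L_1$ to $L_3$. $\mathcal{L}$ is in general position if no two lines in $\mathcal{L}$ are parallel, no two are perpendicular, and no three (in any order) are weakly concurrent. A partitioned graph is a finite (simple, undirected) graph $G=(\mathcal{V},\mathcal{E})$ with a partition $\mathcal{V}=\bigcup_{i=1}^k V_i$ (some $V_i$ may be empty; edges inside a part are allowed). $G$ is crossing if at least two of the $V_i$ are non-empty. For a subgraph $H$ of $G$, $\mathcal{L}[H]=\{L_i: V_i\cap V(H)\neq\emptyset\}$. $\mathcal{L}^{\mathcal{V}}$ is the set of $p:\mathcal{V}\to\mathbb{R}^d$ with $p(V_i)\subset L_i$ for all $i$. $\mathbb{Q}(\mathcal{L},p)$ is the smallest subfield of $\mathbb{R}$ containing $\mathbb{Q}(\mathcal{L})$ and all coordinates of all $p(v)$;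 $p$ is $\mathcal{L}$-generic if the transcendence degree of $\mathbb{Q}(\mathcal{L},p)$ over $\mathbb{Q}(\mathcal{L})$ is $|\mathcal{V}|$. $M_G(p)=(\|p(u)-p(v)\|^2)_{uv\in\mathcal{E}}$. For a set of lines $\mathcal{M}$, $\mathrm{Isom}(\mathcal{M})$ is the group of maps $\theta:\bigcup_{L\in\mathcal{M}}L\to\bigcup_{L\in\mathcal{M}}L$ preserving Euclidean distances and satisfying $\theta(L)=L$ for all $L\in\mathcal{M}$. $(G,p)$ is globally $\mathcal{L}$-rigid if for $q\in\mathcal{L}^{\mathcal{V}}$, $M_G(q)=M_G(p)$ implies $q=\theta\circ p$ for some $\theta\in\mathrm{Isom}(\mathcal{L}[G])$. $G$ is generically globally $\mathcal{L}$-rigid if $(G,p)$ is globally $\mathcal{L}$-rigid for every $\mathcal{L}$-generic $p\in\mathcal{L}^{\mathcal{V}}$. An infinitesimal flex of $(G,p)$ is $f:\mathcal{V}\to\mathbb{R}^d$ with $(p(u)-p(v))\cdot(f(u)-f(v))=0$ for all $uv\in\mathcal{E}$ and $A_i f(v)=0$ for all $i$, $v\in V_i$. $(G,p)$ is infinitesimally $\mathcal{L}$-rigid if the space of infinitesimal flexes has dimension $1$ when all lines in $\mathcal{L}[G]$ are parallel, and $0$ otherwise. $G$ is $\mathcal{L}$-rigid if $(G,p)$ is infinitesimally $\mathcal{L}$-rigid for all $\mathcal{L}$-generic $p\in\mathcal{L}^{\mathcal{V}}$. $G$ is redundantly $\mathcal{L}$-rigid if $G-e$ is $\mathcal{L}$-rigid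 for all $e\in\mathcal{E}$. $G$ is P-connected if every connected component $H$ of $G$ that is a proper subgraph of $G$ satisfies $|\mathcal{L}[H]|\ge 3$, and for every $v\in\mathcal{V}$ every connected component $H'$ of $G-v$ satisfies $|\mathcal{L}[H']|\ge 2$. (A P-connected graph need not be connected.) *)

theory Defs
  imports
    "HOL-Analysis.Analysis"
    "HOL-Library.Poly_Mapping"
    "HOL-Algebra.Generated_Fields"
    "HOL-Algebra.Algebraic_Closure_Type"
    "Jordan_Normal_Form.Gauss_Jordan_Elimination"
begin

no_notation Matrix.vec_index (infixl "$" 100)
no_notation Matrix.scalar_prod (infix "\<bullet>" 70)

type_synonym 'n euclid = "(real, 'n) Finite_Cartesian_Product.vec"  (* real ^ 'n *)

section \<open>Lines and their standard equations\<close>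

definition is_line :: "'a::euclidean_space set \<Rightarrow> bool" where
  "is_line S \<longleftrightarrow> affine S \<and> aff_dim S = 1"

text \<open>
  Reduced row echelon form depends on an ordering of the coordinates; this is the order of the
  index type. \<open>coord x j\<close> is the \<open>j\<close>-th coordinate of \<open>x\<close>, counted from \<open>0\<close>.
\<close>

definition coord :: "('n::{finite,linorder}) euclid \<Rightarrow> nat \<Rightarrow> real" where
  "coord x j = x $ (sorted_list_of_set (UNIV :: 'n set) ! j)"

text \<open>
  In the augmented matrix \<open>M = (A, b)\<close>, columns \<open>0, \<dots>, d - 1\<close> form \<open>A\<close> and column \<open>d\<close> is \<open>b\<close>.
  The library's \<open>row_echelon_form\<close> is the reduced form: pivots equal \<open>1\<close> and are the only
  non-zero entries of their columns.
\<close>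

definition is_standard_equation ::
    "('n::{finite,linorder}) euclid set \<Rightarrow> real mat \<Rightarrow> bool" where
  "is_standard_equation S M \<longleftrightarrow>
     M \<in> carrier_mat (CARD('n) - 1) (CARD('n) + 1) \<and> row_echelon_form M \<and>
     S = {x. \<forall>r < CARD('n) - 1. (\<Sum>j < CARD('n). M $$ (r, j) * coord x j) = M $$ (r, CARD('n))}"

text \<open>For a line the matrix exists and is unique, so the choice below is immaterial.\<close>

definition standard_equation :: "('n::{finite,linorder}) euclid set \<Rightarrow> real mat" where
  "standard_equation S = (SOME M. is_standard_equation S M)"

definition line_kernel :: "('n::{finite,linorder}) euclid set \<Rightarrow> 'n euclid set" where
  \<comment> \<open>the solutions of \<open>A y = 0\<close>, where \<open>A x = b\<close> is the standard equation of the line\<close>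
  "line_kernel S = {y. \<forall>r < CARD('n) - 1.
     (\<Sum>j < CARD('n). standard_equation S $$ (r, j) * coord y j) = 0}"

section \<open>General position\<close>

text \<open>Lines need not meet in order to be perpendicular: only their directions matter.\<close>

definition perpendicular :: "'a::euclidean_space set \<Rightarrow> 'a set \<Rightarrow> bool" where
  "perpendicular S T \<longleftrightarrow> (\<forall>x\<in>S. \<forall>y\<in>S. \<forall>z\<in>T. \<forall>w\<in>T. (x - y) \<bullet> (z - w) = 0)"

definition closest_in :: "'a::euclidean_space set \<Rightarrow> 'a set \<Rightarrow> 'a \<Rightarrow> bool" where
  "closest_in S T x \<longleftrightarrow> is_arg_min (\<lambda>y. infdist y T) (\<lambda>y. y \<in> S) x"

definition weakly_concurrent ::
    "'a::euclidean_space set \<Rightarrow> 'a set \<Rightarrow> 'a set \<Rightarrow> bool" where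
  "weakly_concurrent L1 L2 L3 \<longleftrightarrow>
     \<not> affine_parallel L1 L2 \<and> \<not> affine_parallel L1 L3 \<and> \<not> affine_parallel L2 L3 \<and>
     (\<exists>x. closest_in L1 L2 x \<and> closest_in L1 L3 x)"

definition general_position :: "'a::euclidean_space set set \<Rightarrow> bool" where
  "general_position \<L> \<longleftrightarrow>
     (\<forall>S\<in>\<L>. \<forall>T\<in>\<L>. S \<noteq> T \<longrightarrow> \<not> affine_parallel S T \<and> \<not> perpendicular S T) \<and>
     (\<forall>S\<in>\<L>. \<forall>T\<in>\<L>. \<forall>U\<in>\<L>. S \<noteq> T \<and> S \<noteq> U \<and> T \<noteq> U \<longrightarrow> \<not> weakly_concurrent S T U)"

section \<open>Subfields of the reals and transcendence degree\<close>

definition real_subfield :: "real set \<Rightarrow> real set" where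
  \<comment> \<open>the smallest subfield of the reals containing the given set\<close>
  "real_subfield S = generate_field ring_of_type_algebra S"

text \<open>
  Polynomials in indeterminates indexed by real numbers: a monomial is a finitely supported
  exponent function. The indeterminate with index \<open>x\<close> is evaluated at \<open>x\<close> itself.
\<close>

definition poly_value :: "((real \<Rightarrow>\<^sub>0 nat) \<Rightarrow>\<^sub>0 real) \<Rightarrow> real" where
  "poly_value P = (\<Sum>m\<in>Poly_Mapping.keys P.
     Poly_Mapping.lookup P m * (\<Prod>x\<in>Poly_Mapping.keys m. x ^ Poly_Mapping.lookup m x))"

definition algebraically_independent :: "real set \<Rightarrow> real set \<Rightarrow> bool" where
  "algebraically_independent K B \<longleftrightarrow>
     (\<forall>P. (\<forall>m. Poly_Mapping.lookup P m \<in> K) \<and>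
          (\<forall>m\<in>Poly_Mapping.keys P. Poly_Mapping.keys m \<subseteq> B) \<and> poly_value P = 0 \<longrightarrow> P = 0)"

definition transcendence_basis :: "real set \<Rightarrow> real set \<Rightarrow> real set \<Rightarrow> bool" where
  "transcendence_basis K F B \<longleftrightarrow>
     B \<subseteq> F \<and> algebraically_independent K B \<and>
     (\<forall>B'. B \<subseteq> B' \<and> B' \<subseteq> F \<and> algebraically_independent K B' \<longrightarrow> B' = B)"

text \<open>
  A relation rather than a function, so that an infinite degree is not confused with \<open>0\<close>.
\<close>

definition has_transcendence_degree :: "real set \<Rightarrow> real set \<Rightarrow> nat \<Rightarrow> bool" where
  "has_transcendence_degree K F n \<longleftrightarrow> (\<exists>B. transcendence_basis K F B \<and> finite B \<and> card B = n)"

definition lines_field :: "('n::{finite,linorder}) euclid set set \<Rightarrow> real set" where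
  "lines_field \<L> = real_subfield (\<Union>S\<in>\<L>. elements_mat (standard_equation S))"

section \<open>Partitioned graphs\<close>

text \<open>
  The vertex set of the graph is the whole finite type \<open>'v\<close>, edges are two-element sets, and the
  parts are \<open>V 1, \<dots>, V k\<close>. The lines are \<open>L 1, \<dots>, L k\<close>.
\<close>

definition simple_graph :: "'v::finite set set \<Rightarrow> bool" where
  "simple_graph E \<longleftrightarrow> (\<forall>e\<in>E. card e = 2)"

definition partition_of_vertices :: "nat \<Rightarrow> (nat \<Rightarrow> 'v::finite set) \<Rightarrow> bool" where
  "partition_of_vertices k V \<longleftrightarrow> (\<Union>i\<in>{1..k}. V i) = UNIV \<and> disjoint_family_on V {1..k}"

definition crossing :: "nat \<Rightarrow> (nat \<Rightarrow> 'v::finite set) \<Rightarrow> bool" where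
  "crossing k V \<longleftrightarrow> card {i \<in> {1..k}. V i \<noteq> {}} \<ge> 2"

text \<open>\<open>\<L>[H]\<close> depends only on the vertex set \<open>W\<close> of the subgraph \<open>H\<close>.\<close>

definition lines_met ::
    "nat \<Rightarrow> (nat \<Rightarrow> 'a set) \<Rightarrow> (nat \<Rightarrow> 'v::finite set) \<Rightarrow> 'v set \<Rightarrow> 'a set set" where
  "lines_met k L V W = {L i | i. i \<in> {1..k} \<and> V i \<inter> W \<noteq> {}}"

definition components :: "'v::finite set \<Rightarrow> 'v set set \<Rightarrow> 'v set set" where
  \<comment> \<open>vertex sets of the connected components of the subgraph induced by \<open>W\<close>\<close>
  "components W E =
     W // {(u, v) \<in> W \<times> W. (u, v) \<in> {(x, y). x \<in> W \<and> y \<in> W \<and> {x, y} \<in> E}\<^sup>*}"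

definition P_connected ::
    "nat \<Rightarrow> (nat \<Rightarrow> 'a set) \<Rightarrow> (nat \<Rightarrow> 'v::finite set) \<Rightarrow> 'v set set \<Rightarrow> bool" where
  "P_connected k L V E \<longleftrightarrow>
     (\<forall>H \<in> components UNIV E. H \<noteq> UNIV \<longrightarrow> card (lines_met k L V H) \<ge> 3) \<and>
     (\<forall>v. \<forall>H \<in> components (UNIV - {v}) E. card (lines_met k L V H) \<ge> 2)"

section \<open>Rigidity on lines\<close>

definition configurations ::
    "nat \<Rightarrow> (nat \<Rightarrow> 'a set) \<Rightarrow> (nat \<Rightarrow> 'v::finite set) \<Rightarrow> ('v \<Rightarrow> 'a) set" where
  "configurations k L V = {p. \<forall>i\<in>{1..k}. p ` V i \<subseteq> L i}"

definition line_generic ::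
    "nat \<Rightarrow> (nat \<Rightarrow> ('n::{finite,linorder}) euclid set) \<Rightarrow> ('v::finite \<Rightarrow> 'n euclid) \<Rightarrow> bool" where
  "line_generic k L p \<longleftrightarrow>
     (let K = lines_field (L ` {1..k})
      in has_transcendence_degree K (real_subfield (K \<union> {p v $ i | v i. True})) CARD('v))"

definition rigidity_map ::
    "'v set set \<Rightarrow> ('v \<Rightarrow> 'a::euclidean_space) \<Rightarrow> 'v \<times> 'v \<Rightarrow> real" where
  \<comment> \<open>each edge is listed in both orientations\<close>
  "rigidity_map E p = (\<lambda>(u, v) \<in> {(u, v). {u, v} \<in> E}. (norm (p u - p v))\<^sup>2)"

definition Isom :: "'a::euclidean_space set set \<Rightarrow> ('a \<Rightarrow> 'a) set" where
  "Isom \<M> = {\<theta> \<in> \<Union>\<M> \<rightarrow>\<^sub>E \<Union>\<M>.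
     (\<forall>x\<in>\<Union>\<M>. \<forall>y\<in>\<Union>\<M>. dist (\<theta> x) (\<theta> y) = dist x y) \<and> (\<forall>S\<in>\<M>. \<theta> ` S = S)}"

definition globally_rigid ::
    "nat \<Rightarrow> (nat \<Rightarrow> 'a::euclidean_space set) \<Rightarrow> (nat \<Rightarrow> 'v::finite set) \<Rightarrow> 'v set set \<Rightarrow>
     ('v \<Rightarrow> 'a) \<Rightarrow> bool" where
  "globally_rigid k L V E p \<longleftrightarrow>
     (\<forall>q \<in> configurations k L V. rigidity_map E q = rigidity_map E p \<longrightarrow>
        (\<exists>\<theta> \<in> Isom (lines_met k L V UNIV). q = \<theta> \<circ> p))"

definition generically_globally_rigid ::
    "nat \<Rightarrow> (nat \<Rightarrow> ('n::{finite,linorder}) euclid set) \<Rightarrow> (nat \<Rightarrow> 'v::finite set) \<Rightarrow>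
     'v set set \<Rightarrow> bool" where
  "generically_globally_rigid k L V E \<longleftrightarrow>
     (\<forall>p \<in> configurations k L V. line_generic k L p \<longrightarrow> globally_rigid k L V E p)"

definition infinitesimal_flexes ::
    "nat \<Rightarrow> (nat \<Rightarrow> ('n::{finite,linorder}) euclid set) \<Rightarrow> (nat \<Rightarrow> 'v::finite set) \<Rightarrow>
     'v set set \<Rightarrow> ('v \<Rightarrow> 'n euclid) \<Rightarrow> ('n euclid ^ 'v) set" where
  "infinitesimal_flexes k L V E p =
     {f. (\<forall>u v. {u, v} \<in> E \<longrightarrow> (p u - p v) \<bullet> (f $ u - f $ v) = 0) \<and>
         (\<forall>i\<in>{1..k}. \<forall>v\<in>V i. f $ v \<in> line_kernel (L i))}"

definition infinitesimally_rigid ::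
    "nat \<Rightarrow> (nat \<Rightarrow> ('n::{finite,linorder}) euclid set) \<Rightarrow> (nat \<Rightarrow> 'v::finite set) \<Rightarrow>
     'v set set \<Rightarrow> ('v \<Rightarrow> 'n euclid) \<Rightarrow> bool" where
  "infinitesimally_rigid k L V E p \<longleftrightarrow>
     dim (infinitesimal_flexes k L V E p) =
       (if \<forall>S \<in> lines_met k L V UNIV. \<forall>T \<in> lines_met k L V UNIV. affine_parallel S T
        then 1 else 0)"

definition line_rigid ::
    "nat \<Rightarrow> (nat \<Rightarrow> ('n::{finite,linorder}) euclid set) \<Rightarrow> (nat \<Rightarrow> 'v::finite set) \<Rightarrow>
     'v set set \<Rightarrow> bool" where
  "line_rigid k L V E \<longleftrightarrow>
     (\<forall>p \<in> configurations k L V. line_generic k L p \<longrightarrow> infinitesimally_rigid k L V E p)"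

definition redundantly_rigid ::
    "nat \<Rightarrow> (nat \<Rightarrow> ('n::{finite,linorder}) euclid set) \<Rightarrow> (nat \<Rightarrow> 'v::finite set) \<Rightarrow>
     'v set set \<Rightarrow> bool" where
  "redundantly_rigid k L V E \<longleftrightarrow> (\<forall>e\<in>E. line_rigid k L V (E - {e}))"

end

theory Submission
  imports Defs
begin

text \<open>
  Parametrize each line over the field \<open>K\<close> generated by the standard equations; the squared length of
  an edge is then a quadratic polynomial over \<open>K\<close> in the parameters of its endpoints. An isometry of
  the lines is the identity or, if there are only two lines, the simultaneous reflection in the two
  closest points. P-connectedness fails only if a component can be translated or reflected without
  moving the rest.

  If \<open>G - e\<close> is flexible at one generic point, then the relevant minors vanish identically, so
  \<open>G - e\<close> is flexible everywhere. In Hendrickson's argument one would follow the compact curve of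
  configurations of \<open>G - e\<close> until the length of \<open>e\<close> returns to its initial value. Here the curve is
  replaced by an integral: the vector of cofactors tangent to these curves is divergence free, so a
  bump function of the edge lengths integrates to zero against the Jacobian, which is impossible if
  the bump sits at a configuration that is determined by its edge lengths. P-connectedness gives
  the compactness.
\<close>

no_notation fps_nth (infixl "$" 75)

section \<open>Fibres of quadratic maps\<close>

text \<open>What general position provides: without parallel lines the form \<open>qf\<close> is
  definite, so an edge between two lines bounds both of its ends; without perpendicular lines the
  mixed term of \<open>qf\<close> is nonzero, so an isometry cannot reflect only one of two lines;
  without weak concurrency two further lines have different closest points on a given line, so with
  three lines only the identity remains. Genericity is used in the form that no nonzero polynomial
  over \<open>K\<close> vanishes at the parameter vector. Both directions of the equivalence with
  the transcendence degree matter, since flexibility is given at one generic point while the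
  contradiction may be drawn at another, found by Baire category near a special configuration. The
  fibre lemma alone is no contradiction: it only says that a degenerate family stays degenerate when
  one more function isolates the point in its fibre. The length of \<open>e\<close> is added first,
  then coordinates one at a time. Degeneracy at a generic point spreads to all points, so the lemma
  applies again after each addition, until all coordinates are present and degeneracy is
  absurd.\<close>

lemma has_derivative_det:
  fixes R :: "'a::real_normed_vector \<Rightarrow> real^'v^'v"
  assumes "\<And>k i. ((\<lambda>x. R x $ k $ i) has_derivative (\<lambda>h. R' h $ k $ i)) (at x)"
  shows "((\<lambda>x. det (R x)) has_derivative
    (\<lambda>h. \<Sum>k\<in>UNIV. det (\<chi> l. if l = k then R' h $ k else R x $ l))) (at x)"
proof -
  have *: "(\<Sum>p | p permutes (UNIV::'v set). of_int (sign p) *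
        (\<Sum>k\<in>UNIV. R' h $ k $ p k * (\<Prod>l\<in>UNIV - {k}. R x $ l $ p l))) =
      (\<Sum>k\<in>UNIV. det (\<chi> l. if l = k then R' h $ k else R x $ l))" for h
  proof -
    have "(\<Prod>l\<in>UNIV. (\<chi> l. if l = k then R' h $ k else R x $ l) $ l $ p l) =
        R' h $ k $ p k * (\<Prod>l\<in>UNIV - {k}. R x $ l $ p l)" for k p
      by (subst prod.remove[of _ k]) (auto intro!: prod.cong)
    then show ?thesis
      unfolding det_def sum_distrib_left by (subst sum.swap) simp
  qed
  show ?thesis
    unfolding *[symmetric] unfolding det_def
    by (intro has_derivative_sum has_derivative_mult_right has_derivative_prod assms)
qed

text \<open>Polarization: the determinant with \<open>y + z\<close> in both rows vanishes and is
  additive in each of them.\<close>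

lemma det_two_rows_antisym:
  fixes c :: "'v \<Rightarrow> real^'v"
  assumes "k \<noteq> k0"
  shows "det (\<chi> l. if l = k then y else if l = k0 then z else c l) =
    - det (\<chi> l. if l = k then z else if l = k0 then y else c l)"
proof -
  define D where "D y z = det (\<chi> l. if l = k then y else if l = k0 then z else c l)" for y z
  have same: "D y y = 0" for y
    unfolding D_def using assms by (rule det_identical_rows[of k k0]) (auto simp: Finite_Cartesian_Product.row_def)
  have add1: "D (y + y') z = D y z + D y' z" for y y' z
    unfolding D_def by (rule det_row_add)
  have D': "D y z = det (\<chi> l. if l = k0 then z else if l = k then y else c l)" for y z
    unfolding D_def using assms by (intro arg_cong[where f=det]) (auto simp: Finite_Cartesian_Product.vec_eq_iff)
  have add2: "D y (z + z') = D y z + D y z'" for y z z'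
    unfolding D' by (rule det_row_add)
  have "0 = D (y + z) (y + z)" by (rule same[symmetric])
  also have "\<dots> = D y z + D z y" by (simp only: add1 add2) (simp add: same)
  finally have "D y z + D z y = 0" ..
  then show ?thesis
    by (simp add: D_def eq_neg_iff_add_eq_0)
qed

text \<open>A symmetric form contracted with an alternating one vanishes: the coefficients
  \<open>A $ j $ i\<close> are symmetric, while \<open>D (axis j 1) (axis i 1)\<close> changes sign
  when \<open>i\<close> and \<open>j\<close> are exchanged. With Hessians for \<open>A\<close> this
  is why the cofactors of a Jacobian are divergence free.\<close>

lemma sum_det_hessian_zero:
  fixes c :: "'v \<Rightarrow> real^'v" and A :: "real^'v^'v"
  assumes "k \<noteq> k0" and sym: "transpose A = A"
  shows "(\<Sum>i\<in>UNIV. det (\<chi> l. if l = k then A *v axis i 1 else if l = k0 then axis i 1 else c l)) = 0"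
proof -
  define D where "D y z = det (\<chi> l. if l = k then y else if l = k0 then z else c l)" for y z
  have exp: "A *v axis i 1 = (\<Sum>j\<in>UNIV. A $ j $ i *s axis j 1)" for i
  proof -
    have "A *v axis i 1 = column i A" by (rule matrix_vector_mult_basis)
    then show ?thesis
      by (simp add: Finite_Cartesian_Product.vec_eq_iff Finite_Cartesian_Product.column_def axis_def
          if_distrib[of "\<lambda>t. _ * t"] cong: if_cong)
  qed
  have "D (A *v axis i 1) z = (\<Sum>j\<in>UNIV. A $ j $ i * D (axis j 1) z)" for i z
    unfolding exp D_def by (simp add: det_linear_row_sum det_row_mul)
  then have S: "(\<Sum>i\<in>UNIV. D (A *v axis i 1) (axis i 1)) =
      (\<Sum>i\<in>UNIV. \<Sum>j\<in>UNIV. A $ j $ i * D (axis j 1) (axis i 1))" by simp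
  also have "\<dots> = (\<Sum>i\<in>UNIV. \<Sum>j\<in>UNIV. A $ i $ j * D (axis i 1) (axis j 1))"
    by (rule sum.swap)
  also have "\<dots> = (\<Sum>i\<in>UNIV. \<Sum>j\<in>UNIV. - (A $ j $ i * D (axis j 1) (axis i 1)))"
  proof (intro sum.cong refl)
    fix i j
    have "A $ i $ j = A $ j $ i" using sym by (metis transpose_def vec_lambda_beta)
    moreover have "D (axis i 1) (axis j 1) = - D (axis j 1) (axis i 1)"
      unfolding D_def by (rule det_two_rows_antisym[OF assms(1)])
    ultimately show "A $ i $ j * D (axis i 1) (axis j 1) = - (A $ j $ i * D (axis j 1) (axis i 1))"
      by simp
  qed
  also have "\<dots> = - (\<Sum>i\<in>UNIV. D (A *v axis i 1) (axis i 1))"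
    unfolding S by (simp add: sum_negf)
  finally show ?thesis unfolding D_def by simp
qed

text \<open>Translating a compactly supported function does not change its integral, so
  differentiating under the integral sign in the shift along \<open>e\<close> gives zero. The margin
  \<open>norm e\<close> keeps the support inside the box for all shifts in
  \<open>{-1..1}\<close>.\<close>

lemma integral_partial_derivative_zero:
  fixes g :: "'a::euclidean_space \<Rightarrow> real"
  assumes der: "\<And>x. (g has_derivative g' x) (at x)"
    and cont: "continuous_on UNIV (\<lambda>x. g' x e)"
    and supp: "\<And>x. r \<le> norm x \<Longrightarrow> g x = 0"
    and box: "cball 0 (r + norm e) \<subseteq> cbox a b"
  shows "integral (cbox a b) (\<lambda>x. g' x e) = 0"
proof -
  have gc: "continuous_on S g" for S
    using der by (meson continuous_at_imp_continuous_on has_derivative_continuous)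
  define I where "I = integral (cbox a b) g"
  have gIb: "(g has_integral I) (cbox a b)"
    unfolding I_def by (intro integrable_integral integrable_continuous gc)
  have off: "g x = 0" if "x \<notin> cbox a b" for x
  proof (rule supp)
    have "norm x > r + norm e" using that box by (auto simp: subset_iff not_le[symmetric])
    then show "r \<le> norm x" using norm_ge_zero[of e] by linarith
  qed
  have shift: "integral (cbox a b) (\<lambda>x. g (x + t *\<^sub>R e)) = I" if "t \<in> {-1..1}" for t
  proof -
    have c: "continuous_on S (\<lambda>x. g (x + t *\<^sub>R e))" for S
      by (intro continuous_intros continuous_on_compose2[OF gc[of UNIV]]) auto
    then have "((\<lambda>x. g (x + t *\<^sub>R e)) has_integral integral (cbox a b) (\<lambda>x. g (x + t *\<^sub>R e))) (cbox a b)"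
      by (intro integrable_integral integrable_continuous)
    moreover have "g (x + t *\<^sub>R e) = 0" if "x \<notin> cbox a b" for x
    proof (rule supp)
      have "norm x > r + norm e" using that box by (auto simp: subset_iff not_le[symmetric])
      moreover have "norm x \<le> norm (x + t *\<^sub>R e) + norm (t *\<^sub>R e)"
        by (metis add_diff_cancel norm_triangle_ineq4)
      moreover have "norm (t *\<^sub>R e) \<le> norm e"
        using \<open>t \<in> {-1..1}\<close> by (simp add: mult_left_le_one_le abs_le_iff)
      ultimately show "r \<le> norm (x + t *\<^sub>R e)" by linarith
    qed
    ultimately have "((\<lambda>x. g (x + t *\<^sub>R e)) has_integral integral (cbox a b) (\<lambda>x. g (x + t *\<^sub>R e))) UNIV"
      by (rule has_integral_on_superset) auto
    moreover have "((\<lambda>x. g (x + t *\<^sub>R e)) has_integral I) UNIV"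
    proof (rule has_integral_on_superset)
      show "((\<lambda>x. g (x + t *\<^sub>R e)) has_integral I) (cbox (a - t *\<^sub>R e) (b - t *\<^sub>R e))"
        using has_integral_affinity_iff[of 1 g "t *\<^sub>R e" I a b] gIb by simp
      show "g (x + t *\<^sub>R e) = 0" if "x \<notin> cbox (a - t *\<^sub>R e) (b - t *\<^sub>R e)" for x
      proof (rule off, rule notI)
        assume "x + t *\<^sub>R e \<in> cbox a b"
        then have "x \<in> cbox (a - t *\<^sub>R e) (b - t *\<^sub>R e)"
          unfolding mem_box inner_diff_left inner_add_left by (simp add: diff_le_eq le_diff_eq)
        with that show False by simp
      qed
    qed auto
    ultimately show ?thesis by (rule has_integral_unique)
  qed
  have d: "((\<lambda>t. g (x + t *\<^sub>R e)) has_field_derivative g' (x + t *\<^sub>R e) e) (at t within {-1..1})" for x t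
  proof -
    have "((\<lambda>t. g (x + t *\<^sub>R e)) has_derivative (\<lambda>s. g' (x + t *\<^sub>R e) (s *\<^sub>R e))) (at t within {-1..1})"
      by (rule has_derivative_compose[OF _ der]) (auto intro!: derivative_eq_intros)
    moreover have "g' (x + t *\<^sub>R e) (s *\<^sub>R e) = g' (x + t *\<^sub>R e) e * s" for s
      using has_derivative_bounded_linear[OF der] by (simp add: bounded_linear.linear linear_cmul mult.commute)
    ultimately show ?thesis by (simp add: has_field_derivative_def)
  qed
  have "((\<lambda>t. integral (cbox a b) (\<lambda>x. g (x + t *\<^sub>R e))) has_field_derivative
     integral (cbox a b) (\<lambda>x. g' (x + 0 *\<^sub>R e) e)) (at 0 within {-1..1})"
  proof (rule leibniz_rule_field_derivative)
    show "continuous_on ({-1..1} \<times> cbox a b) (\<lambda>(t, x). g' (x + t *\<^sub>R e) e)"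
      unfolding case_prod_beta
      by (intro continuous_on_compose2[OF cont] continuous_intros) auto
    show "(\<lambda>x. g (x + t *\<^sub>R e)) integrable_on cbox a b" for t
      by (intro integrable_continuous continuous_intros continuous_on_compose2[OF gc[of UNIV]]) auto
  qed (use d in auto)
  moreover have "((\<lambda>t. integral (cbox a b) (\<lambda>x. g (x + t *\<^sub>R e))) has_field_derivative 0) (at 0 within {-1..1})"
    by (rule has_field_derivative_transform_within[OF DERIV_const[of I], of 1]) (auto simp: shift)
  moreover have "at 0 within {-1..1} = at (0::real)"
    by (rule at_within_Icc_at) auto
  ultimately show ?thesis
    using DERIV_unique[of _ _ 0] by simp
qed

lemma continuous_on_det:
  fixes R :: "'a::topological_space \<Rightarrow> real^'v^'v"
  assumes "\<And>k i. continuous_on S (\<lambda>x. R x $ k $ i)"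
  shows "continuous_on S (\<lambda>x. det (R x))"
  unfolding det_def by (intro continuous_intros assms)

lemma det_nz_iff_inj_mult:
  fixes R :: "real^'v^'v"
  shows "det R \<noteq> 0 \<longleftrightarrow> inj ((*v) R)"
  by (metis det_nz_iff_inj matrix_of_matrix_vector_mul matrix_vector_mul_linear)

lemma det_eq_0_if_rows_orthogonal:
  fixes R :: "real^'v^'v"
  assumes "s \<noteq> 0" "\<And>k. R $ k \<bullet> s = 0"
  shows "det R = 0"
proof (rule ccontr)
  assume "det R \<noteq> 0"
  then have "inj ((*v) R)" by (simp add: det_nz_iff_inj_mult)
  moreover have "R *v s = R *v 0"
    using assms(2) by (simp add: Finite_Cartesian_Product.vec_eq_iff matrix_vector_mul_component)
  ultimately show False using assms(1) by (blast dest: injD)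
qed

text \<open>Without a common orthogonal vector the \<open>g i\<close> span, so a basis can be chosen
  among them. It has \<open>CARD('v)\<close> members, and indexing it by \<open>'v\<close> makes the
  minor a square matrix.\<close>

lemma exists_nonzero_minor:
  fixes g :: "'i \<Rightarrow> real^'v"
  assumes "\<not> (\<exists>s. s \<noteq> 0 \<and> (\<forall>i\<in>I. g i \<bullet> s = 0))"
  obtains \<sigma> where "range \<sigma> \<subseteq> I" "det (\<chi> k. g (\<sigma> k)) \<noteq> 0"
proof -
  have sp: "span (g ` I) = UNIV"
  proof (rule ccontr)
    assume "span (g ` I) \<noteq> UNIV"
    then obtain s where "s \<noteq> 0" "\<forall>x\<in>span (g ` I). s \<bullet> x = 0"
      using span_not_UNIV_orthogonal by blast
    then have "\<forall>i\<in>I. g i \<bullet> s = 0" by (metis imageI inner_commute span_base)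
    with \<open>s \<noteq> 0\<close> show False using assms by blast
  qed
  obtain B where B: "B \<subseteq> g ` I" "independent B" "g ` I \<subseteq> span B" "card B = dim (g ` I)"
    using basis_exists by blast
  have "card B = CARD('v)" using B(4) sp by (metis dim_span dim_UNIV DIM_cart DIM_real mult_1_right)
  moreover have "finite B" using B(2) independent_bound by blast
  ultimately obtain h where h: "bij_betw h (UNIV :: 'v set) B"
    by (metis finite_same_card_bij finite_class.finite_UNIV)
  define \<sigma> where "\<sigma> k = (SOME i. i \<in> I \<and> g i = h k)" for k
  have \<sigma>: "\<sigma> k \<in> I \<and> g (\<sigma> k) = h k" for k
    unfolding \<sigma>_def by (rule someI_ex) (use h B(1) in \<open>auto simp: bij_betw_def image_iff dest!: subsetD[of _ _ "h k"]\<close>)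
  have "span B = UNIV" using B(3) sp
    by (metis span_minimal subspace_span top.extremum_uniqueI)
  have "det (\<chi> k. g (\<sigma> k)) \<noteq> 0"
  proof
    assume "det (\<chi> k. g (\<sigma> k)) = 0"
    then have "\<not> inj ((*v) (\<chi> k. g (\<sigma> k)))" using det_nz_iff_inj_mult by blast
    then obtain x y where xy: "(\<chi> k. g (\<sigma> k)) *v x = (\<chi> k. g (\<sigma> k)) *v y" "x \<noteq> y"
      by (auto simp: inj_def)
    have "h k \<bullet> (x - y) = 0" for k
      using arg_cong[OF xy(1), of "\<lambda>v. v $ k"] \<sigma>[of k]
      by (simp add: matrix_vector_mul_component inner_diff_right)
    then have "B \<subseteq> {z. z \<bullet> (x - y) = 0}"
      using h by (auto simp: bij_betw_def)
    moreover have "subspace {z. z \<bullet> (x - y) = 0}"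
      by (auto simp: subspace_def inner_add_left)
    ultimately have "span B \<subseteq> {z. z \<bullet> (x - y) = 0}" by (rule span_minimal)
    then have "(x - y) \<bullet> (x - y) = 0" using \<open>span B = UNIV\<close> by blast
    then show False using xy(2) by simp
  qed
  with \<sigma> that show ?thesis by blast
qed

text \<open>A continuously differentiable stand-in for a smooth cutoff; the bump functions of the
  fibre lemma are combinations of its translates and reflections.\<close>

lemma has_real_derivative_max_0_square:
  "((\<lambda>t::real. (max 0 t)\<^sup>2) has_real_derivative 2 * max 0 t) (at t)"
proof -
  consider "t > 0" | "t < 0" | "t = 0" by linarith
  then show ?thesis
  proof cases
    case 1
    then show ?thesis
      by (intro has_field_derivative_transform_within_open
            [where f = "\<lambda>t. t\<^sup>2" and g = "\<lambda>t. (max 0 t)\<^sup>2" and S = "{0<..}"])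
        (auto intro!: derivative_eq_intros simp: max_def)
  next
    case 2
    then show ?thesis
      by (intro has_field_derivative_transform_within_open
            [where f = "\<lambda>t. 0" and g = "\<lambda>t. (max 0 t)\<^sup>2" and S = "{..<0}"])
        (auto simp: max_def)
  next
    case 3
    have "(max 0 h)\<^sup>2 / h = max 0 h" for h :: real
      by (cases "h > 0") (simp_all add: max_def power2_eq_square)
    moreover have "((\<lambda>h. max 0 h) \<longlongrightarrow> max 0 0) (at (0::real))"
      by (intro tendsto_max tendsto_const tendsto_ident_at)
    ultimately show ?thesis using 3 unfolding DERIV_def by simp
  qed
qed

lemma has_real_derivative_max_0_square_comp:
  assumes "(u has_real_derivative u') (at x)"
  shows "((\<lambda>x. (max 0 (u x))\<^sup>2) has_real_derivative 2 * max 0 (u x) * u') (at x)"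
  using DERIV_chain[OF has_real_derivative_max_0_square[of "u x"] assms] by (simp add: o_def)

text \<open>
  If \<open>p\<close> were a point where the gradients span, pick a minor \<open>J\<close> that uses \<open>f j\<close> and does not
  vanish there. The vector of cofactors of the row of \<open>f j\<close> is divergence free and tangent to the
  fibres of the other functions, so by the divergence theorem a bump function localised near the
  fibre of \<open>p\<close> integrates to zero against \<open>J\<close>. As \<open>p\<close> is the only point of its fibre, the bump
  can be supported where \<open>J\<close> has constant sign.
\<close>

lemma gradients_degenerate_at_isolated_fibre:
  fixes f :: "'i \<Rightarrow> real^'v \<Rightarrow> real" and A :: "'i \<Rightarrow> real^'v^'v"
  assumes fin: "finite I" and jI: "j \<notin> I"
    and der: "\<And>i x. i \<in> insert j I \<Longrightarrow> (f i has_derivative (\<lambda>h. g i x \<bullet> h)) (at x)"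
    and grad: "\<And>i x. i \<in> insert j I \<Longrightarrow> g i x = A i *v x + b i"
    and sym: "\<And>i. i \<in> insert j I \<Longrightarrow> transpose (A i) = A i"
    and degen: "\<And>x. \<exists>s. s \<noteq> 0 \<and> (\<forall>i\<in>I. g i x \<bullet> s = 0)"
    and U: "open U" "bounded U" "p \<in> U"
    and front: "\<And>x. x \<in> frontier U \<Longrightarrow> \<exists>i\<in>I. f i x \<noteq> f i p"
    and uniq: "\<And>x. x \<in> U \<Longrightarrow> \<forall>i\<in>insert j I. f i x = f i p \<Longrightarrow> x = p"
  shows "\<exists>s. s \<noteq> 0 \<and> (\<forall>i\<in>insert j I. g i p \<bullet> s = 0)"
proof (rule ccontr)
  assume "\<not> ?thesis"
  then obtain \<sigma> where \<sigma>: "range \<sigma> \<subseteq> insert j I" and detp: "det (\<chi> k. g (\<sigma> k) p) \<noteq> 0"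
    using exists_nonzero_minor[of "insert j I" "\<lambda>i. g i p"] by blast
  have \<sigma>': "\<sigma> k \<in> insert j I" for k using \<sigma> by auto
  have "j \<in> range \<sigma>"
  proof (rule ccontr)
    assume "j \<notin> range \<sigma>"
    then have I: "\<sigma> k \<in> I" for k using \<sigma>' by (metis insertE rangeI)
    obtain s where "s \<noteq> 0" "\<forall>i\<in>I. g i p \<bullet> s = 0" using degen by blast
    then have "det (\<chi> k. g (\<sigma> k) p) = 0" using I by (intro det_eq_0_if_rows_orthogonal) auto
    with detp show False by simp
  qed
  then obtain k0 where k0: "\<sigma> k0 = j" by auto
  have k0_only: "\<sigma> k \<in> I" if "k \<noteq> k0" for k
  proof (rule ccontr)
    assume "\<sigma> k \<notin> I"
    with \<sigma> have "\<sigma> k = \<sigma> k0" using k0 by auto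
    then have "det (\<chi> k. g (\<sigma> k) p) = 0"
      by (intro det_identical_rows[OF that, of "\<chi> k. g (\<sigma> k) p"]) (simp add: Finite_Cartesian_Product.row_def)
    with detp show False by simp
  qed
  \<comment> \<open>\<open>w x\<close> pairs a vector with the cofactors of row \<open>k0\<close>;
    the \<open>i\<close>-th cofactor is \<open>w x (axis i 1)\<close>. As a linear functional it can
    be evaluated on gradients without expanding minors.\<close>
  define w where "w x y = det (\<chi> l. if l = k0 then y else g (\<sigma> l) x)" for x y
  define J where "J x = det (\<chi> k. g (\<sigma> k) x)" for x
  have wJ: "w x (g j x) = J x" for x
    unfolding w_def J_def using k0 by (intro arg_cong[where f = det]) (auto simp: Finite_Cartesian_Product.vec_eq_iff)
  \<comment> \<open>Row \<open>k0\<close> was the only one with an index outside \<open>I\<close>,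
    so now all rows belong to the degenerate family: the cofactor vector is tangent to the fibres of
    the functions in \<open>I\<close>.\<close>
  have w0: "w x (g i x) = 0" if "i \<in> I" for i x
  proof -
    obtain s where "s \<noteq> 0" "\<forall>i\<in>I. g i x \<bullet> s = 0" using degen by blast
    then show ?thesis
      unfolding w_def using k0_only that by (intro det_eq_0_if_rows_orthogonal) auto
  qed
  have w_sum: "w x (\<Sum>i\<in>S. c i *\<^sub>R y i) = (\<Sum>i\<in>S. c i * w x (y i))" if "finite S" for x c y S
    unfolding w_def scalar_mult_eq_scaleR[symmetric]
    by (simp add: det_linear_row_sum[OF that] det_row_mul)
  have w_expand: "(\<Sum>i\<in>UNIV. (y \<bullet> axis i 1) * w x (axis i 1)) = w x y" for x y
    unfolding w_sum[symmetric, OF finite_class.finite_UNIV]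
    by (intro arg_cong[where f = "w x"])
       (simp add: Finite_Cartesian_Product.vec_eq_iff inner_axis, simp add: axis_def if_distrib cong: if_cong)
  have gcont: "continuous_on S (g i)" if "i \<in> insert j I" for i S
    unfolding grad[OF that, abs_def] by (intro continuous_intros)
  have fcont: "continuous_on S (f i)" if "i \<in> insert j I" for i S
    using der[OF that] by (meson continuous_at_imp_continuous_on has_derivative_continuous)
  have Jcont: "continuous_on S J" for S
    unfolding J_def[abs_def] by (rule continuous_on_det) (auto intro!: continuous_intros gcont[OF \<sigma>'])
  define m where "m x = (\<Sum>i\<in>I. (f i x - f i p)\<^sup>2)" for x
  define m' where "m' x = (\<Sum>i\<in>I. (2 * (f i x - f i p)) *\<^sub>R g i x)" for x
  have mcont: "continuous_on S m" for S
    unfolding m_def[abs_def] by (intro continuous_intros fcont) auto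
  have m'cont: "continuous_on S m'" for S
    unfolding m'_def[abs_def] by (intro continuous_intros fcont gcont) auto
  have m0: "m x \<ge> 0" for x unfolding m_def by (intro sum_nonneg) auto
  have m_pos: "m x > 0" if "i \<in> I" "f i x \<noteq> f i p" for i x
    unfolding m_def using that fin by (intro sum_pos2[of _ i]) auto
  have mder: "(m has_derivative (\<lambda>h. m' x \<bullet> h)) (at x)" for x
    unfolding m_def[abs_def] m'_def
    by (rule derivative_eq_intros der | simp)+
       (auto simp: inner_sum_left mult.assoc intro!: sum.cong)

  define n where "n x = m x + (f j x - f j p)\<^sup>2" for x
  obtain N where N: "open N" "p \<in> N" "N \<subseteq> U" "\<And>x. x \<in> N \<Longrightarrow> J x * J p > 0"
  proof
    show "open (U \<inter> {x. J x * J p > 0})"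
      using U(1) by (intro open_Int open_Collect_less continuous_intros Jcont)
    show "p \<in> U \<inter> {x. J x * J p > 0}"
      using U(3) detp unfolding J_def by (auto simp: zero_less_mult_iff)
  qed auto
  have npos: "n x > 0" if "x \<in> closure U - N" for x
  proof (cases "x \<in> U")
    case True
    then have "x \<noteq> p" using that N(2) by auto
    then obtain i where i: "i \<in> insert j I" "f i x \<noteq> f i p" using uniq[OF True] by blast
    show ?thesis
    proof (cases "i \<in> I")
      case True
      then show ?thesis unfolding n_def using m_pos[OF True i(2)] by (simp add: add_pos_nonneg)
    next
      case False
      then show ?thesis unfolding n_def using i m0[of x] by (simp add: add_nonneg_pos)
    qed
  next
    case False
    then have "x \<in> frontier U" using that U(1) by (simp add: frontier_def interior_open)
    then show ?thesis unfolding n_def using front m_pos by (metis add_pos_nonneg zero_le_power2)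
  qed
  obtain d1 where d1: "d1 > 0" "\<And>x. x \<in> closure U - N \<Longrightarrow> d1 \<le> n x"
  proof (cases "closure U - N = {}")
    case True
    show ?thesis by (rule that[of 1]) (use True in auto)
  next
    case False
    have "compact (closure U - N)" using U(2) N(1) by (simp add: compact_diff)
    moreover have "continuous_on (closure U - N) n"
      unfolding n_def[abs_def] by (intro continuous_intros fcont mcont) simp
    ultimately obtain y where "y \<in> closure U - N" "\<forall>x\<in>closure U - N. n y \<le> n x"
      using continuous_attains_inf[OF _ False, of n] by blast
    then show ?thesis using that[of "n y"] npos by blast
  qed
  obtain d2 where d2: "d2 > 0" "\<And>x. x \<in> frontier U \<Longrightarrow> d2 \<le> m x"
  proof (cases "frontier U = {}")
    case True
    then show ?thesis using that[of 1] by simp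
  next
    case False
    have "compact (frontier U)" using U(2) by (simp add: compact_frontier_bounded)
    then obtain y where "y \<in> frontier U" "\<forall>x\<in>frontier U. m y \<le> m x"
      using continuous_attains_inf[OF _ False, of m] mcont by blast
    then show ?thesis using that[of "m y"] front m_pos by blast
  qed
  \<comment> \<open>If \<open>m\<close> and the squared deviation of \<open>f j\<close> are below
    \<open>\<epsilon>\<close>, then \<open>n\<close> is below
    \<open>2 * \<epsilon> \<le> d1\<close>, which forces the point into \<open>N\<close>; and
    \<open>\<epsilon> < d2\<close> keeps the set \<open>m \<le> \<epsilon>\<close> off the
    frontier.\<close>
  define \<epsilon> where "\<epsilon> = min d1 d2 / 2"
  have \<epsilon>: "\<epsilon> > 0" "\<epsilon> < d1" "\<epsilon> < d2" "2 * \<epsilon> \<le> d1"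
    unfolding \<epsilon>_def using d1(1) d2(1) by (auto simp: min_def)
  define \<eta> where "\<eta> = sqrt \<epsilon>"
  have \<eta>: "\<eta> > 0" "\<eta>\<^sup>2 = \<epsilon>" using \<epsilon>(1) by (auto simp: \<eta>_def)
  have inN: "x \<in> N" if "x \<in> U" "m x < \<epsilon>" "\<bar>f j x - f j p\<bar> < \<eta>" for x
  proof (rule ccontr)
    assume "x \<notin> N"
    then have "d1 \<le> n x" using d1(2) that(1) closure_subset by blast
    moreover have "(f j x - f j p)\<^sup>2 < \<epsilon>"
      using that(3) \<eta>(2) abs_le_square_iff[of \<eta> "f j x - f j p"] \<eta>(1) by (simp add: not_le[symmetric])
    ultimately show False unfolding n_def using that(2) \<epsilon>(4) by linarith
  qed

  define \<alpha> where "\<alpha> u = (max 0 (\<epsilon> - u))\<^sup>2" for u :: real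
  define \<alpha>' where "\<alpha>' u = - (2 * max 0 (\<epsilon> - u))" for u :: real
  \<comment> \<open>\<open>\<beta>\<close> is a tent on \<open>{-\<eta>..\<eta>}\<close> of height
    \<open>2 * \<eta>\<close>, a second difference of the positive part, and \<open>B\<close> is an
    antiderivative of it. To the right of the tent \<open>B\<close> is a nonzero constant, so
    compact support has to come from \<open>\<alpha>\<close>.\<close>
  define B where "B u = (max 0 (u + \<eta>))\<^sup>2 - 2 * (max 0 u)\<^sup>2 + (max 0 (u - \<eta>))\<^sup>2" for u :: real
  define \<beta> where "\<beta> u = 2 * max 0 (u + \<eta>) - 4 * max 0 u + 2 * max 0 (u - \<eta>)" for u :: real
  have \<alpha>_der: "(\<alpha> has_real_derivative \<alpha>' u) (at u)" for u
    unfolding \<alpha>_def[abs_def] \<alpha>'_def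
    by (auto intro!: derivative_eq_intros has_real_derivative_max_0_square_comp[THEN DERIV_cong])
  have B_der: "(B has_real_derivative \<beta> u) (at u)" for u
    unfolding B_def[abs_def] \<beta>_def
    by (auto intro!: derivative_eq_intros has_real_derivative_max_0_square_comp[THEN DERIV_cong])
  have \<beta>: "\<beta> u \<ge> 0" "\<beta> 0 > 0" "\<bar>u\<bar> \<ge> \<eta> \<Longrightarrow> \<beta> u = 0" for u
    unfolding \<beta>_def using \<eta>(1) by (auto simp: max_def)

  define R where "R i x = (\<chi> l. if l = k0 then axis i 1 else g (\<sigma> l) x)" for i x
  define R' where "R' h = (\<chi> l. if l = k0 then 0 else A (\<sigma> l) *v h)" for h
  define w' where "w' i x h = (\<Sum>k\<in>UNIV. det (\<chi> l. if l = k then R' h $ k else R i x $ l))" for i x h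
  have wR: "w x (axis i 1) = det (R i x)" for i x
    unfolding w_def R_def ..
  have w_der: "((\<lambda>x. w x (axis i 1)) has_derivative w' i x) (at x)" for i x
    unfolding wR w'_def[abs_def]
  proof (rule has_derivative_det)
    show "((\<lambda>x. R i x $ k $ l) has_derivative (\<lambda>h. R' h $ k $ l)) (at x)" for k l
    proof (cases "k = k0")
      case False
      have "((\<lambda>x. (A (\<sigma> k) *v x + b (\<sigma> k)) $ l) has_derivative (\<lambda>h. (A (\<sigma> k) *v h) $ l)) (at x)"
        by (auto intro!: derivative_eq_intros bounded_linear.has_derivative[OF bounded_linear_vec_nth]
            bounded_linear.has_derivative[OF matrix_vector_mul_bounded_linear])
      then show ?thesis using False grad[OF \<sigma>'] by (simp add: R_def R'_def)
    qed (simp add: R_def R'_def)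
  qed
  have w_cont: "continuous_on S (\<lambda>x. w x (axis i 1))" for i S
    using w_der by (meson continuous_at_imp_continuous_on has_derivative_continuous)
  have w'_cont: "continuous_on S (\<lambda>x. w' i x h)" for i h S
    unfolding w'_def
  proof (intro continuous_on_sum continuous_on_det)
    fix k k' l
    show "continuous_on S (\<lambda>x. (\<chi> l. if l = k then R' h $ k else R i x $ l) $ k' $ l)"
      by (cases "k' = k"; cases "k' = k0") (auto simp: R_def intro!: continuous_intros gcont[OF \<sigma>'])
  qed
  \<comment> \<open>Differentiating row by row: row \<open>k0\<close> is constant, and every other
    row contributes a Hessian contracted with an alternating form.\<close>
  have div_w: "(\<Sum>i\<in>UNIV. w' i x (axis i 1)) = 0" for x
  proof -
    have "(\<Sum>i\<in>UNIV. det (\<chi> l. if l = k then R' (axis i 1) $ k else R i x $ l)) = 0" for k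
    proof (cases "k = k0")
      case True
      then have "det (\<chi> l. if l = k then R' (axis i 1) $ k else R i x $ l) = 0" for i
        by (intro det_zero_row(2)[of k]) (simp add: Finite_Cartesian_Product.row_def R'_def
            Finite_Cartesian_Product.vec_eq_iff)
      then show ?thesis by simp
    next
      case False
      have "(\<chi> l. if l = k then R' (axis i 1) $ k else R i x $ l) =
          (\<chi> l. if l = k then A (\<sigma> k) *v axis i 1 else if l = k0 then axis i 1 else g (\<sigma> l) x)" for i
        using False by (simp add: R_def R'_def Finite_Cartesian_Product.vec_eq_iff)
      then show ?thesis using sum_det_hessian_zero[OF False sym[OF \<sigma>']] by simp
    qed
    then show ?thesis unfolding w'_def by (subst sum.swap) simp
  qed

  define \<phi> where "\<phi> x = f j x - f j p" for x
  \<comment> \<open>The divergence of this field: the derivative of \<open>\<alpha>\<close>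
    contributes a multiple of \<open>w x (m' x) = 0\<close>, the cofactors are divergence free, and
    the derivative of \<open>B\<close> leaves \<open>\<alpha> (m x) * \<beta> (\<phi> x)\<close>
    times \<open>w x (g j x) = J x\<close>.\<close>
  define G where "G i x = \<alpha> (m x) * B (\<phi> x) * w x (axis i 1)" for i x
  define G' where "G' i x h = \<alpha>' (m x) * (m' x \<bullet> h) * B (\<phi> x) * w x (axis i 1) +
      \<alpha> (m x) * (\<beta> (\<phi> x) * (g j x \<bullet> h)) * w x (axis i 1) + \<alpha> (m x) * B (\<phi> x) * w' i x h" for i x h
  have \<phi>_der: "(\<phi> has_derivative (\<lambda>h. g j x \<bullet> h)) (at x)" for x
    unfolding \<phi>_def[abs_def] by (auto intro!: derivative_eq_intros der)
  have G_der: "(G i has_derivative G' i x) (at x)" for i x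
  proof -
    have 1: "((\<lambda>x. \<alpha> (m x)) has_derivative (\<lambda>h. \<alpha>' (m x) * (m' x \<bullet> h))) (at x)"
      using has_derivative_compose[OF mder \<alpha>_der[unfolded has_field_derivative_def]] .
    have 2: "((\<lambda>x. B (\<phi> x)) has_derivative (\<lambda>h. \<beta> (\<phi> x) * (g j x \<bullet> h))) (at x)"
      using has_derivative_compose[OF \<phi>_der B_der[unfolded has_field_derivative_def]] .
    show ?thesis unfolding G_def[abs_def] G'_def[abs_def]
      by (rule has_derivative_eq_rhs[OF has_derivative_mult[OF has_derivative_mult[OF 1 2] w_der]])
        (simp add: algebra_simps fun_eq_iff)
  qed
  have cont: "continuous_on S \<alpha>" "continuous_on S B" "continuous_on S \<alpha>'" "continuous_on S \<beta>" for S
    unfolding \<alpha>_def[abs_def] B_def[abs_def] \<alpha>'_def[abs_def] \<beta>_def[abs_def] by (intro continuous_intros)+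
  have \<phi>_cont: "continuous_on S \<phi>" for S
    unfolding \<phi>_def[abs_def] by (intro continuous_intros fcont) simp
  have G'_cont: "continuous_on S (\<lambda>x. G' i x h)" for i h S
    unfolding G'_def
    by (intro continuous_intros m'cont gcont w_cont w'_cont
        continuous_on_compose2[OF cont(1) mcont] continuous_on_compose2[OF cont(3) mcont]
        continuous_on_compose2[OF cont(2) \<phi>_cont] continuous_on_compose2[OF cont(4) \<phi>_cont]) auto

  \<comment> \<open>On \<open>U\<close> the cutoff vanishes outside \<open>C\<close>, and
    \<open>C\<close> is a closed set inside the open \<open>U\<close>, so the field and its
    derivative extend by zero to the whole space.\<close>
  define C where "C = closure U \<inter> {x. m x \<le> \<epsilon>}"
  have C: "closed C" unfolding C_def
    by (intro closed_Int closed_Collect_le mcont continuous_intros) simp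
  have CU: "C \<subseteq> U"
  proof
    fix x assume "x \<in> C"
    then show "x \<in> U"
      using d2(2)[of x] \<epsilon>(3) U(1) unfolding C_def by (auto simp: frontier_def interior_open)
  qed
  have zero: "G i x = 0" "G' i x h = 0" if "x \<in> U" "x \<notin> C" for i x h
    using that closure_subset[of U] unfolding C_def G_def G'_def \<alpha>_def \<alpha>'_def by (auto simp: max_def)
  define Z where "Z i x = (if x \<in> U then G i x else 0)" for i x
  define Z' where "Z' i x h = (if x \<in> U then G' i x h else 0)" for i x h
  have Z_der: "(Z i has_derivative Z' i x) (at x)" for i x
  proof (cases "x \<in> U")
    case True
    then show ?thesis
      using has_derivative_transform_within_open[OF G_der U(1) True, of i "Z i"]
      by (auto simp: Z_def Z'_def[abs_def])
  next
    case False
    then have "x \<in> - C" using CU by auto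
    moreover have "open (- C)" using C by auto
    ultimately show ?thesis
      using has_derivative_transform_within_open[of "\<lambda>_. 0" "\<lambda>_. 0" x UNIV "- C" "Z i"] zero False
      by (auto simp: Z_def Z'_def[abs_def])
  qed
  have Z'_cont: "continuous_on UNIV (\<lambda>x. Z' i x h)" for i h
  proof -
    have "continuous_on U (\<lambda>x. Z' i x h)"
      using G'_cont[of U i h] by (simp add: Z'_def cong: continuous_on_cong_simp)
    moreover have "continuous_on (- C) (\<lambda>x. Z' i x h)"
    proof -
      have "Z' i x h = 0" if "x \<in> - C" for x using that zero(2) by (simp add: Z'_def)
      then show ?thesis by (simp cong: continuous_on_cong_simp)
    qed
    moreover have "U \<union> - C = UNIV" using CU by auto
    ultimately show ?thesis using continuous_on_open_Un[OF U(1), of "- C"] C by auto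
  qed
  obtain r where r: "r > 0" "\<And>x. x \<in> U \<Longrightarrow> norm x < r"
    using U(2) by (meson bounded_pos_less)
  obtain c where c: "cball 0 (r + 1) \<subseteq> cbox (- c) (c :: real^'v)"
    using bounded_subset_cbox_symmetric[of "cball 0 (r + 1)"] by auto
  have int0: "integral (cbox (- c) c) (\<lambda>x. Z' i x (axis i 1)) = 0" for i
  proof (rule integral_partial_derivative_zero[OF Z_der Z'_cont])
    show "Z i x = 0" if "r \<le> norm x" for x using r(2)[of x] that by (auto simp: Z_def)
    show "cball 0 (r + norm (axis i (1::real))) \<subseteq> cbox (- c) c" using c by simp
  qed
  define F where "F x = (if x \<in> U then \<alpha> (m x) * \<beta> (\<phi> x) * J x else 0)" for x
  have F: "F x = (\<Sum>i\<in>UNIV. Z' i x (axis i 1))" for x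
  proof (cases "x \<in> U")
    case True
    have "w x (m' x) = 0"
      unfolding m'_def w_sum[OF fin] using w0 by simp
    then have "(\<Sum>i\<in>UNIV. G' i x (axis i 1)) = \<alpha> (m x) * \<beta> (\<phi> x) * J x"
      using w_expand[of "m' x" x] w_expand[of "g j x" x] div_w[of x]
      unfolding G'_def sum.distrib wJ
      by (simp add: mult.assoc mult.left_commute[of _ "B (\<phi> x)"] flip: sum_distrib_left)
    with True show ?thesis by (simp add: F_def Z'_def)
  qed (simp add: F_def Z'_def)
  have F_cont: "continuous_on UNIV F"
    unfolding F[abs_def] by (intro continuous_on_sum Z'_cont)
  have "integral (cbox (- c) c) F = (\<Sum>i\<in>UNIV. integral (cbox (- c) c) (\<lambda>x. Z' i x (axis i 1)))"
    unfolding F[abs_def]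
    by (intro integral_sum integrable_continuous continuous_on_subset[OF Z'_cont]) auto
  then have "integral (cbox (- c) c) F = 0" using int0 by simp
  moreover have FJ_cont: "continuous_on (cbox (- c) c) (\<lambda>x. F x * J p)"
    by (intro continuous_intros continuous_on_subset[OF F_cont]) auto
  ultimately have "((\<lambda>x. F x * J p) has_integral 0) (cbox (- c) c)"
    using integrable_integral[OF integrable_continuous[OF FJ_cont]] by simp
  \<comment> \<open>Wherever \<open>F\<close> is nonzero the point lies in \<open>N\<close>, where
    \<open>J\<close> has the sign of \<open>J p\<close>. A continuous nonnegative function with
    integral zero vanishes, but this one is positive at \<open>p\<close>.\<close>
  moreover have "F x * J p \<ge> 0" for x
  proof (cases "x \<in> U \<and> m x < \<epsilon> \<and> \<bar>\<phi> x\<bar> < \<eta>")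
    case True
    then have "J x * J p > 0" using inN N(4) unfolding \<phi>_def by blast
    then show ?thesis unfolding F_def using \<beta>(1) by (auto simp: \<alpha>_def mult.assoc intro!: mult_nonneg_nonneg)
  next
    case False
    then have "F x = 0" unfolding F_def \<alpha>_def using \<beta>(3)[of "\<phi> x"] by (auto simp: not_less max_def)
    then show ?thesis by simp
  qed
  moreover have p: "p \<in> box (- c) c"
  proof -
    have "ball p 1 \<subseteq> cball 0 (r + 1)"
    proof
      fix y assume "y \<in> ball p 1"
      then show "y \<in> cball 0 (r + 1)"
        using r(2)[OF U(3)] norm_triangle_ineq4[of p "p - y"] by (auto simp: dist_norm)
    qed
    then have "ball p 1 \<subseteq> interior (cbox (- c) c)" using c by (intro interior_maximal) auto
    then show ?thesis by (simp add: interior_cbox subset_iff)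
  qed
  ultimately have "F p * J p = 0"
    using has_integral_0_cbox_imp_0[OF FJ_cont, of p] box_subset_cbox by blast
  moreover have "F p * J p > 0"
  proof -
    have "m p = 0" "\<phi> p = 0" by (auto simp: m_def \<phi>_def)
    moreover have "J p * J p > 0" using N by blast
    ultimately show ?thesis using U(3) \<epsilon>(1) \<beta>(2) by (simp add: F_def \<alpha>_def mult.assoc)
  qed
  ultimately show False by linarith
qed

section \<open>Subfields of the reals\<close>

text \<open>In the reals \<open>inverse 0 = 0\<close>, so closure under \<open>inverse\<close> needs
  no exception for zero.\<close>

definition is_subfield :: "real set \<Rightarrow> bool" where
  "is_subfield K \<longleftrightarrow> 0 \<in> K \<and> 1 \<in> K \<and> (\<forall>x\<in>K. - x \<in> K \<and> inverse x \<in> K) \<and>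
     (\<forall>x\<in>K. \<forall>y\<in>K. x + y \<in> K \<and> x * y \<in> K)"

lemma is_subfieldD:
  assumes "is_subfield K"
  shows "0 \<in> K" "1 \<in> K" "x \<in> K \<Longrightarrow> - x \<in> K" "x \<in> K \<Longrightarrow> inverse x \<in> K"
    "x \<in> K \<Longrightarrow> y \<in> K \<Longrightarrow> x + y \<in> K" "x \<in> K \<Longrightarrow> y \<in> K \<Longrightarrow> x * y \<in> K"
    "x \<in> K \<Longrightarrow> y \<in> K \<Longrightarrow> x - y \<in> K" "x \<in> K \<Longrightarrow> y \<in> K \<Longrightarrow> x / y \<in> K"
proof -
  have ops: "\<And>x. x \<in> K \<Longrightarrow> - x \<in> K" "\<And>x. x \<in> K \<Longrightarrow> inverse x \<in> K"
    "\<And>x y. x \<in> K \<Longrightarrow> y \<in> K \<Longrightarrow> x + y \<in> K" "\<And>x y. x \<in> K \<Longrightarrow> y \<in> K \<Longrightarrow> x * y \<in> K"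
    and "0 \<in> K" "1 \<in> K"
    using assms by (simp_all add: is_subfield_def)
  then show "0 \<in> K" "1 \<in> K" "x \<in> K \<Longrightarrow> - x \<in> K" "x \<in> K \<Longrightarrow> inverse x \<in> K"
    "x \<in> K \<Longrightarrow> y \<in> K \<Longrightarrow> x + y \<in> K" "x \<in> K \<Longrightarrow> y \<in> K \<Longrightarrow> x * y \<in> K" by simp_all
  show "x \<in> K \<Longrightarrow> y \<in> K \<Longrightarrow> x - y \<in> K" using ops(3)[of x "- y"] ops(1) by simp
  show "x \<in> K \<Longrightarrow> y \<in> K \<Longrightarrow> x / y \<in> K" using ops(4)[of x "inverse y"] ops(2) by (simp add: divide_inverse)
qed

lemma is_subfield_sum:
  assumes "is_subfield K" "\<And>i. i \<in> I \<Longrightarrow> f i \<in> K"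
  shows "sum f I \<in> K"
  using assms(2)
  by (induction I rule: infinite_finite_induct) (simp_all add: is_subfieldD[OF assms(1)])

lemma ring_of_type_algebra_real:
  "\<one>\<^bsub>ring_of_type_algebra\<^esub> = (1::real)" "\<zero>\<^bsub>ring_of_type_algebra\<^esub> = (0::real)"
  "x \<oplus>\<^bsub>ring_of_type_algebra\<^esub> y = x + (y::real)" "x \<otimes>\<^bsub>ring_of_type_algebra\<^esub> y = x * (y::real)"
  "\<ominus>\<^bsub>ring_of_type_algebra\<^esub> x = - (x::real)"
  "x \<noteq> 0 \<Longrightarrow> inv\<^bsub>ring_of_type_algebra\<^esub> x = inverse (x::real)"
proof -
  interpret R: Ring.field "ring_of_type_algebra :: real ring" by (rule field_from_type_algebra)
  show "\<one>\<^bsub>ring_of_type_algebra\<^esub> = (1::real)" "\<zero>\<^bsub>ring_of_type_algebra\<^esub> = (0::real)"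
    "x \<oplus>\<^bsub>ring_of_type_algebra\<^esub> y = x + (y::real)" "x \<otimes>\<^bsub>ring_of_type_algebra\<^esub> y = x * (y::real)" for x y
    by (simp_all add: ring_of_type_algebra_def)
  then show "\<ominus>\<^bsub>ring_of_type_algebra\<^esub> x = - (x::real)"
    by (intro R.minus_equality) (auto simp: ring_of_type_algebra_def)
  show "x \<noteq> 0 \<Longrightarrow> inv\<^bsub>ring_of_type_algebra\<^esub> x = inverse (x::real)"
    by (intro R.comm_inv_char) (auto simp: ring_of_type_algebra_def)
qed

lemma real_subfield_incl: "S \<subseteq> real_subfield S"
  unfolding real_subfield_def by (auto intro: generate_field.incl)

lemma is_subfield_real_subfield: "is_subfield (real_subfield S)"
proof -
  note gen = generate_field.one generate_field.eng_mult generate_field.eng_add generate_field.a_inv generate_field.m_inv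
  note gen' = gen[where R = "ring_of_type_algebra :: real ring" and H = S, folded real_subfield_def,
      unfolded ring_of_type_algebra_real]
  have 0: "0 \<in> real_subfield S" using gen'(3)[OF gen'(1) gen'(4)[OF gen'(1)]] by simp
  have inv: "inverse x \<in> real_subfield S" if "x \<in> real_subfield S" for x
  proof (cases "x = 0")
    case False
    from gen'(5)[OF that False] show ?thesis unfolding ring_of_type_algebra_real(6)[OF False] .
  qed (simp add: 0)
  show ?thesis
    unfolding is_subfield_def by (intro conjI ballI 0 gen'(1,4) gen'(2,3) inv) assumption+
qed

lemma real_subfield_least:
  assumes "S \<subseteq> T" "is_subfield T"
  shows "real_subfield S \<subseteq> T"
proof
  fix x assume "x \<in> real_subfield S"
  then show "x \<in> T" unfolding real_subfield_def
    by induction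
      (use assms(1) in \<open>auto simp: ring_of_type_algebra_real is_subfieldD[OF assms(2)]\<close>)
qed

section \<open>Countability of generated subfields\<close>

lemma countable_closure:
  fixes ops :: "('a \<Rightarrow> 'a \<Rightarrow> 'a) set"
  assumes "countable S" "countable ops"
  shows "\<exists>T. countable T \<and> S \<subseteq> T \<and> (\<forall>f\<in>ops. \<forall>x\<in>T. \<forall>y\<in>T. f x y \<in> T)"
proof -
  define Z where "Z = rec_nat S (\<lambda>_ Y. Y \<union> (\<lambda>(f, x, y). f x y) ` (ops \<times> Y \<times> Y))"
  have Suc_Z: "Z (Suc n) = Z n \<union> (\<lambda>(f, x, y). f x y) ` (ops \<times> Z n \<times> Z n)" for n
    by (simp add: Z_def)
  have cnt: "countable (Z n)" for n
  proof (induction n)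
    case 0
    show ?case using assms(1) by (simp add: Z_def)
  next
    case (Suc n)
    then show ?case unfolding Suc_Z using assms(2) by (intro countable_Un countable_image countable_SIGMA)
  qed
  have mono: "Z m \<subseteq> Z n" if "m \<le> n" for m n
    by (rule lift_Suc_mono_le[OF _ that]) (simp add: Suc_Z)
  show ?thesis
  proof (intro exI conjI ballI)
    show "countable (\<Union>n. Z n)" using cnt by simp
    have "Z 0 = S" by (simp add: Z_def)
    then show "S \<subseteq> (\<Union>n. Z n)" by (metis UN_upper UNIV_I)
    fix f x y assume f: "f \<in> ops" and "x \<in> (\<Union>n. Z n)" "y \<in> (\<Union>n. Z n)"
    then obtain m n where "x \<in> Z m" "y \<in> Z n" by (elim UN_E)
    then have "x \<in> Z (max m n)" "y \<in> Z (max m n)"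
      using mono[of m "max m n"] mono[of n "max m n"] by auto
    then have "(f, x, y) \<in> ops \<times> Z (max m n) \<times> Z (max m n)" using f by simp
    then have "f x y \<in> Z (Suc (max m n))" unfolding Suc_Z by (intro UnI2 image_eqI[of _ _ "(f, x, y)"]) simp
    then show "f x y \<in> (\<Union>n. Z n)" by (rule UN_I[OF UNIV_I])
  qed
qed

lemma countable_real_subfield:
  assumes "countable S"
  shows "countable (real_subfield S)"
proof -
  \<comment> \<open>The unary operations are passed as binary ones that ignore an argument.\<close>
  let ?ops = "{(+), (*), (\<lambda>x y. - x), (\<lambda>x y. inverse x)} :: (real \<Rightarrow> real \<Rightarrow> real) set"
  obtain T where T: "countable T" "S \<union> {0, 1} \<subseteq> T"
    and ops: "\<forall>f\<in>?ops. \<forall>x\<in>T. \<forall>y\<in>T. f x y \<in> T"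
  proof -
    have "countable (S \<union> {0, 1})" "countable ?ops" using assms by simp_all
    from countable_closure[OF this] show ?thesis using that by (elim exE conjE)
  qed
  have "is_subfield T" unfolding is_subfield_def
  proof (intro conjI ballI)
    show "- x \<in> T" if "x \<in> T" for x using bspec[OF ops, of "\<lambda>x y. - x"] that by blast
    show "inverse x \<in> T" if "x \<in> T" for x using bspec[OF ops, of "\<lambda>x y. inverse x"] that by blast
    show "x + y \<in> T" if "x \<in> T" "y \<in> T" for x y using bspec[OF ops, of "(+)"] that by simp
    show "x * y \<in> T" if "x \<in> T" "y \<in> T" for x y using bspec[OF ops, of "(*)"] that by simp
  qed (use T in auto)
  then have "real_subfield S \<subseteq> T" using T(2) by (intro real_subfield_least) auto
  then show ?thesis using T(1) countable_subset by blast
qed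

section \<open>Linear systems over a subfield\<close>

text \<open>Gaussian elimination, one equation at a time: solving an equation for an unknown with
  nonzero coefficient removes one equation and one unknown, and all operations stay inside
  \<open>K\<close>.\<close>

lemma homogeneous_system_nontrivial:
  assumes K: "is_subfield K" and "finite J" "finite I" "card J < card I"
    and "\<And>j i. j \<in> J \<Longrightarrow> i \<in> I \<Longrightarrow> a j i \<in> K"
  shows "\<exists>c. (\<forall>i\<in>I. c i \<in> K) \<and> (\<exists>i\<in>I. c i \<noteq> 0) \<and> (\<forall>j\<in>J. (\<Sum>i\<in>I. a j i * c i) = 0)"
  using assms(2-)
proof (induction J arbitrary: I a rule: finite_induct)
  case empty
  then have "I \<noteq> {}" by auto
  then show ?case using is_subfieldD(2)[OF K] by (intro exI[of _ "\<lambda>_. 1"]) auto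
next
  case (insert j J)
  show ?case
  proof (cases "\<forall>i\<in>I. a j i = 0")
    case True
    obtain c where "\<forall>i\<in>I. c i \<in> K" "\<exists>i\<in>I. c i \<noteq> 0" "\<forall>j\<in>J. (\<Sum>i\<in>I. a j i * c i) = 0"
      using insert.IH[of I a] insert.prems insert.hyps by auto
    then show ?thesis using True by (intro exI[of _ c]) auto
  next
    case False
    then obtain i0 where i0: "i0 \<in> I" "a j i0 \<noteq> 0" by blast
    define a' where "a' l i = a l i - a l i0 * a j i / a j i0" for l i
    have expand: "(\<Sum>i\<in>I - {i0}. a' l i * z i) =
        (\<Sum>i\<in>I - {i0}. a l i * z i) - a l i0 / a j i0 * (\<Sum>i\<in>I - {i0}. a j i * z i)" for l z
      unfolding a'_def by (simp add: left_diff_distrib sum_subtractf sum_distrib_left mult.assoc)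
    have "\<exists>c. (\<forall>i\<in>I - {i0}. c i \<in> K) \<and> (\<exists>i\<in>I - {i0}. c i \<noteq> 0) \<and>
        (\<forall>l\<in>J. (\<Sum>i\<in>I - {i0}. a' l i * c i) = 0)"
      using insert.prems insert.hyps i0
      by (intro insert.IH) (auto simp: a'_def intro!: is_subfieldD[OF K])
    then obtain c where c: "\<forall>i\<in>I - {i0}. c i \<in> K" "\<exists>i\<in>I - {i0}. c i \<noteq> 0"
        "\<And>l. l \<in> J \<Longrightarrow> (\<Sum>i\<in>I - {i0}. a' l i * c i) = 0" by blast
    define s where "s = - (\<Sum>i\<in>I - {i0}. a j i * c i) / a j i0"
    define c' where "c' = c(i0 := s)"
    have split: "(\<Sum>i\<in>I. a l i * c' i) = a l i0 * s + (\<Sum>i\<in>I - {i0}. a l i * c i)" for l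
      using insert.prems(1) i0(1) by (simp add: sum.remove c'_def)
    have "(\<Sum>i\<in>I. a l i * c' i) = 0" if "l \<in> insert j J" for l
    proof (cases "l = j")
      case True
      then show ?thesis unfolding split s_def using i0(2) by simp
    next
      case False
      then have "(\<Sum>i\<in>I - {i0}. a l i * c i) = a l i0 / a j i0 * (\<Sum>i\<in>I - {i0}. a j i * c i)"
        using c(3)[of l] that unfolding expand by simp
      then show ?thesis unfolding split s_def by simp
    qed
    moreover have "s \<in> K" unfolding s_def using c(1) i0 insert.prems
      by (auto intro!: is_subfieldD[OF K] is_subfield_sum[OF K])
    ultimately show ?thesis using c(1,2) i0(1) by (intro exI[of _ c']) (auto simp: c'_def)
  qed
qed

text \<open>The same elimination shows that solvability does not depend on the field. The real
  solution \<open>x\<close> is carried along to guarantee that a row with vanishing coefficients has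
  right-hand side zero.\<close>

lemma linear_system_descends:
  assumes K: "is_subfield K" and "finite J" "finite I"
    and "\<And>j i. j \<in> J \<Longrightarrow> i \<in> I \<Longrightarrow> a j i \<in> K" "\<And>j. j \<in> J \<Longrightarrow> b j \<in> K"
    and "\<And>j. j \<in> J \<Longrightarrow> (\<Sum>i\<in>I. a j i * x i) = b j"
  shows "\<exists>c. (\<forall>i\<in>I. c i \<in> K) \<and> (\<forall>j\<in>J. (\<Sum>i\<in>I. a j i * c i) = b j)"
  using assms(2-)
proof (induction J arbitrary: I a b rule: finite_induct)
  case empty
  then show ?case using is_subfieldD(1)[OF K] by (intro exI[of _ "\<lambda>_. 0"]) auto
next
  case (insert j J)
  show ?case
  proof (cases "\<forall>i\<in>I. a j i = 0")
    case True
    have "\<exists>c. (\<forall>i\<in>I. c i \<in> K) \<and> (\<forall>j\<in>J. (\<Sum>i\<in>I. a j i * c i) = b j)"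
      by (rule insert.IH) (use insert.prems in blast)+
    then obtain c where "\<forall>i\<in>I. c i \<in> K" "\<forall>j\<in>J. (\<Sum>i\<in>I. a j i * c i) = b j"
      by blast
    moreover have "b j = 0" using insert.prems(4)[of j] True by simp
    ultimately show ?thesis using True by (intro exI[of _ c]) auto
  next
    case False
    then obtain i0 where i0: "i0 \<in> I" "a j i0 \<noteq> 0" by blast
    define a' where "a' l i = a l i - a l i0 * a j i / a j i0" for l i
    define b' where "b' l = b l - a l i0 * b j / a j i0" for l
    have expand: "(\<Sum>i\<in>I - {i0}. a' l i * z i) =
        (\<Sum>i\<in>I - {i0}. a l i * z i) - a l i0 / a j i0 * (\<Sum>i\<in>I - {i0}. a j i * z i)" for l z
      unfolding a'_def by (simp add: left_diff_distrib sum_subtractf sum_distrib_left mult.assoc)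
    have sol: "(\<Sum>i\<in>I - {i0}. a' l i * x i) = b' l" if "l \<in> J" for l
    proof -
      have "(\<Sum>i\<in>I - {i0}. a m i * x i) = b m - a m i0 * x i0" if "m \<in> insert j J" for m
        using insert.prems(4)[OF that] insert.prems(1) i0(1) by (simp add: sum.remove)
      from this[of l] this[of j] show ?thesis unfolding expand b'_def using that i0(2)
        by (simp add: right_diff_distrib)
    qed
    have "\<exists>c. (\<forall>i\<in>I - {i0}. c i \<in> K) \<and> (\<forall>l\<in>J. (\<Sum>i\<in>I - {i0}. a' l i * c i) = b' l)"
    proof (rule insert.IH[OF _ _ _ sol])
      show "a' l i \<in> K" if "l \<in> J" "i \<in> I - {i0}" for l i
        unfolding a'_def using that i0 insert.prems(2) by (intro is_subfieldD[OF K]) auto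
      show "b' l \<in> K" if "l \<in> J" for l
        unfolding b'_def using that i0 insert.prems(2,3) by (intro is_subfieldD[OF K]) auto
    qed (use insert.prems in auto)
    then obtain c where c: "\<forall>i\<in>I - {i0}. c i \<in> K" "\<And>l. l \<in> J \<Longrightarrow> (\<Sum>i\<in>I - {i0}. a' l i * c i) = b' l"
      by blast
    define s where "s = (b j - (\<Sum>i\<in>I - {i0}. a j i * c i)) / a j i0"
    define c' where "c' = c(i0 := s)"
    have split: "(\<Sum>i\<in>I. a l i * c' i) = a l i0 * s + (\<Sum>i\<in>I - {i0}. a l i * c i)" for l
      using insert.prems(1) i0(1) by (simp add: sum.remove c'_def)
    have "(\<Sum>i\<in>I. a l i * c' i) = b l" if "l \<in> insert j J" for l
    proof (cases "l = j")
      case True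
      then show ?thesis unfolding split s_def using i0(2) by simp
    next
      case False
      then have "(\<Sum>i\<in>I - {i0}. a l i * c i) = b l - a l i0 * b j / a j i0 +
          a l i0 / a j i0 * (\<Sum>i\<in>I - {i0}. a j i * c i)"
        using c(2)[of l] that unfolding expand b'_def by simp
      then show ?thesis unfolding split s_def by (simp add: diff_divide_distrib right_diff_distrib)
    qed
    moreover have "s \<in> K" unfolding s_def using c(1) i0 insert.prems
      by (auto intro!: is_subfieldD[OF K] is_subfield_sum[OF K])
    ultimately show ?thesis using c(1) i0(1) by (intro exI[of _ c']) (auto simp: c'_def)
  qed
qed

section \<open>Polynomial functions and genericity\<close>

text \<open>Polynomials are represented by the functions they define, which loses nothing over the
  reals; \<open>W\<close> lists the variables that may occur.\<close>

inductive_set polyfun :: "real set \<Rightarrow> 'v set \<Rightarrow> (real^'v \<Rightarrow> real) set" for K W where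
  const: "c \<in> K \<Longrightarrow> (\<lambda>_. c) \<in> polyfun K W"
| coord: "v \<in> W \<Longrightarrow> (\<lambda>x. x $ v) \<in> polyfun K W"
| add: "f \<in> polyfun K W \<Longrightarrow> g \<in> polyfun K W \<Longrightarrow> (\<lambda>x. f x + g x) \<in> polyfun K W"
| mult: "f \<in> polyfun K W \<Longrightarrow> g \<in> polyfun K W \<Longrightarrow> (\<lambda>x. f x * g x) \<in> polyfun K W"

text \<open>Algebraic independence of the coordinates as a family: repeated coordinates are excluded
  as well, which a condition on the set of coordinates would miss.\<close>

definition generic_point :: "real set \<Rightarrow> real^'v \<Rightarrow> bool" where
  "generic_point K t \<longleftrightarrow> (\<forall>f\<in>polyfun K UNIV. f t = 0 \<longrightarrow> f = (\<lambda>_. 0))"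

lemma polyfun_sum:
  assumes "is_subfield K" "\<And>i. i \<in> I \<Longrightarrow> f i \<in> polyfun K W"
  shows "(\<lambda>x. \<Sum>i\<in>I. f i x) \<in> polyfun K W"
  using assms(2)
  by (induction I rule: infinite_finite_induct)
    (simp_all add: polyfun.const polyfun.add is_subfieldD(1)[OF assms(1)])

lemma polyfun_prod:
  assumes "is_subfield K" "\<And>i. i \<in> I \<Longrightarrow> f i \<in> polyfun K W"
  shows "(\<lambda>x. \<Prod>i\<in>I. f i x) \<in> polyfun K W"
  using assms(2)
  by (induction I rule: infinite_finite_induct)
    (simp_all add: polyfun.const polyfun.mult is_subfieldD(2)[OF assms(1)])

lemma polyfun_power:
  assumes "is_subfield K" "f \<in> polyfun K W"
  shows "(\<lambda>x. f x ^ n) \<in> polyfun K W"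
  using assms(2)
  by (induction n) (simp_all add: polyfun.const polyfun.mult is_subfieldD(2)[OF assms(1)])

lemma polyfun_minus:
  assumes "is_subfield K" "f \<in> polyfun K W"
  shows "(\<lambda>x. - f x) \<in> polyfun K W"
  using polyfun.mult[OF polyfun.const[of "-1"] assms(2)] is_subfieldD(2,3)[OF assms(1)] by simp

lemma polyfun_diff:
  assumes "is_subfield K" "f \<in> polyfun K W" "g \<in> polyfun K W"
  shows "(\<lambda>x. f x - g x) \<in> polyfun K W"
  using polyfun.add[OF assms(2) polyfun_minus[OF assms(1,3)]] by simp

lemma polyfun_mono:
  assumes "f \<in> polyfun K W" "W \<subseteq> W'" "K \<subseteq> K'"
  shows "f \<in> polyfun K' W'"
  using assms(1) by induction (use assms(2,3) in \<open>auto intro: polyfun.intros\<close>)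

lemma continuous_on_polyfun:
  assumes "f \<in> polyfun K W"
  shows "continuous_on S f"
  using assms by induction (auto intro!: continuous_intros)

lemma polyfun_line_restriction:
  assumes "f \<in> polyfun K W"
  shows "\<exists>q. \<forall>s. f (x + s *\<^sub>R y) = poly q s"
  using assms
proof induction
  case (const c)
  show ?case by (rule exI[of _ "[:c:]"]) simp
next
  case (coord v)
  show ?case by (rule exI[of _ "[:x $ v, y $ v:]"]) simp
next
  case (add f g)
  then obtain q r where "\<forall>s. f (x + s *\<^sub>R y) = poly q s" "\<forall>s. g (x + s *\<^sub>R y) = poly r s" by auto
  then show ?case by (intro exI[of _ "q + r"]) simp
next
  case (mult f g)
  then obtain q r where "\<forall>s. f (x + s *\<^sub>R y) = poly q s" "\<forall>s. g (x + s *\<^sub>R y) = poly r s" by auto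
  then show ?case by (intro exI[of _ "q * r"]) simp
qed

text \<open>On every line through \<open>x\<close> the function is a univariate polynomial with
  infinitely many zeros near \<open>x\<close>.\<close>

lemma polyfun_zero_on_open:
  assumes f: "f \<in> polyfun K W" and "open U" "x \<in> U" "\<And>y. y \<in> U \<Longrightarrow> f y = 0"
  shows "f = (\<lambda>_. 0)"
proof
  fix z
  obtain q where q: "\<And>s. f (x + s *\<^sub>R (z - x)) = poly q s"
    using polyfun_line_restriction[OF f] by blast
  have "\<forall>\<^sub>F s in at (0::real). x + s *\<^sub>R (z - x) \<in> U"
  proof (rule topological_tendstoD)
    show "((\<lambda>s. x + s *\<^sub>R (z - x)) \<longlongrightarrow> x + 0 *\<^sub>R (z - x)) (at (0::real))"
      by (intro tendsto_intros)
  qed (use assms in auto)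
  then obtain d where d: "d > 0" "\<And>s. s \<noteq> 0 \<Longrightarrow> dist s 0 < d \<Longrightarrow> x + s *\<^sub>R (z - x) \<in> U"
    unfolding eventually_at by blast
  have "{0<..<d} \<subseteq> {s. poly q s = 0}"
    using d(2) assms(4) by (auto simp: q[symmetric])
  moreover have "infinite {0<..<d}" using d(1) by simp
  ultimately have "infinite {s. poly q s = 0}" using finite_subset by blast
  then have "q = 0" using poly_roots_finite by blast
  then show "f z = 0" using q[of 1] by simp
qed

lemma countable_polyfun:
  assumes "countable K"
  shows "countable (polyfun K (W :: 'v::finite set))"
proof -
  let ?S = "(\<lambda>c _. c) ` K \<union> range (\<lambda>v x. x $ v) :: (real^'v \<Rightarrow> real) set"
  let ?ops = "{\<lambda>f g x. f x + g x, \<lambda>f g x. f x * g x} :: ((real^'v \<Rightarrow> real) \<Rightarrow> _ \<Rightarrow> _) set"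
  have S: "countable ?S"
    using assms by (intro countable_Un countable_image) (simp_all add: countable_finite)
  have "countable ?ops" by simp
  from countable_closure[OF S this] obtain T where
    T: "countable T" "?S \<subseteq> T" "\<forall>h\<in>?ops. \<forall>f\<in>T. \<forall>g\<in>T. h f g \<in> T" by (elim exE conjE)
  have "f \<in> T" if "f \<in> polyfun K W" for f
    using that
  proof induction
    case (add f g)
    have "\<forall>f\<in>T. \<forall>g\<in>T. (\<lambda>x. f x + g x) \<in> T"
      by (rule bspec[OF T(3), of "\<lambda>f g x. f x + g x"]) simp
    then show ?case using add by simp
  next
    case (mult f g)
    have "\<forall>f\<in>T. \<forall>g\<in>T. (\<lambda>x. f x * g x) \<in> T"
      by (rule bspec[OF T(3), of "\<lambda>f g x. f x * g x"]) simp
    then show ?case using mult by simp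
  next
    case (const c)
    then show ?case using T(2) by blast
  next
    case (coord v)
    then show ?case using T(2) by blast
  qed
  then have "polyfun K W \<subseteq> T" by (rule subsetI)
  then show ?thesis using T(1) by (rule countable_subset)
qed

text \<open>Baire category: the zero set of a nonzero polynomial is closed with empty interior, and
  over a countable \<open>K\<close> there are only countably many polynomials.\<close>

lemma exists_generic_point:
  fixes U :: "(real^'v) set"
  assumes "countable K" "is_subfield K" "open U" "U \<noteq> {}"
  obtains t where "t \<in> U" "generic_point K t"
proof -
  define \<G> where "\<G> = (\<lambda>f. {x. f x \<noteq> 0}) ` (polyfun K (UNIV :: 'v set) - {\<lambda>_. 0})"
  have "UNIV \<subseteq> closure (\<Inter>\<G>)"
  proof (rule Baire)
    show "countable \<G>" unfolding \<G>_def using countable_polyfun[OF assms(1)] by blast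
    fix T assume "T \<in> \<G>"
    then obtain f where f: "f \<in> polyfun K UNIV" "f \<noteq> (\<lambda>_. 0)" "T = {x. f x \<noteq> 0}"
      unfolding \<G>_def by auto
    have "open T" unfolding f(3)
      by (intro open_Collect_neq continuous_on_polyfun[OF f(1)] continuous_intros)
    moreover have "x \<in> closure T" for x
    proof (rule ccontr)
      assume "x \<notin> closure T"
      then have "f = (\<lambda>_. 0)"
        by (intro polyfun_zero_on_open[OF f(1), of "- closure T" x])
          (use closure_subset[of T] f(3) in auto)
      with f(2) show False by simp
    qed
    ultimately show "openin (top_of_set UNIV) T \<and> UNIV \<subseteq> closure T" by auto
  qed auto
  then have "U \<inter> closure (\<Inter>\<G>) \<noteq> {}" using assms(4) by auto
  then have "U \<inter> \<Inter>\<G> \<noteq> {}" using open_Int_closure_eq_empty[OF assms(3)] by blast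
  then obtain t where "t \<in> U" "t \<in> \<Inter>\<G>" by auto
  then show ?thesis using that unfolding generic_point_def \<G>_def by auto
qed

text \<open>Sorting by powers of \<open>x $ v\<close>. The coefficients are padded by zero functions
  beyond \<open>M\<close>, so that sums can use a common bound and products the Cauchy
  formula.\<close>

lemma polyfun_decompose:
  assumes K: "is_subfield K" and "f \<in> polyfun K W"
  shows "\<exists>M c. (\<forall>j. c j \<in> polyfun K (W - {v})) \<and> (\<forall>j>M. c j = (\<lambda>_. 0)) \<and>
           (\<forall>x. f x = (\<Sum>j\<le>M. c j x * (x $ v) ^ j))"
  using assms(2)
proof induction
  case (const a)
  define c where "c j = (\<lambda>_::real^'a. if j = 0 then a else 0)" for j :: nat
  show ?case
    by (rule exI[of _ 0], rule exI[of _ c])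
      (use const is_subfieldD(1)[OF K] in \<open>auto simp: c_def intro: polyfun.intros\<close>)
next
  case (coord w)
  show ?case
  proof (cases "w = v")
    case True
    define c where "c j = (\<lambda>_::real^'a. if j = 1 then 1::real else 0)" for j :: nat
    show ?thesis
      by (rule exI[of _ 1], rule exI[of _ c])
        (use True is_subfieldD(1,2)[OF K] in \<open>auto simp: c_def intro: polyfun.intros\<close>)
  next
    case False
    define c where "c j = (if j = 0 then (\<lambda>x::real^'a. x $ w) else (\<lambda>_. 0))" for j :: nat
    show ?thesis
      by (rule exI[of _ 0], rule exI[of _ c])
        (use False coord is_subfieldD(1)[OF K] in \<open>auto simp: c_def intro: polyfun.intros\<close>)
  qed
next
  case (add f g)
  then obtain M c N d where c: "\<forall>j. c j \<in> polyfun K (W - {v})" "\<forall>j>M. c j = (\<lambda>_. 0)"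
      "\<And>x. f x = (\<Sum>j\<le>M. c j x * (x $ v) ^ j)"
    and d: "\<forall>j. d j \<in> polyfun K (W - {v})" "\<forall>j>N. d j = (\<lambda>_. 0)"
      "\<And>x. g x = (\<Sum>j\<le>N. d j x * (x $ v) ^ j)" by auto
  have "f x = (\<Sum>j\<le>max M N. c j x * (x $ v) ^ j)" "g x = (\<Sum>j\<le>max M N. d j x * (x $ v) ^ j)" for x
    unfolding c(3) d(3) by (intro sum.mono_neutral_left; use c(2) d(2) in auto)+
  then show ?case using c(1,2) d(1,2)
    by (intro exI[of _ "max M N"] exI[of _ "\<lambda>j x. c j x + d j x"])
      (auto simp: sum.distrib distrib_right intro: polyfun.intros)
next
  case (mult f g)
  then obtain M c N d where c: "\<forall>j. c j \<in> polyfun K (W - {v})" "\<forall>j>M. c j = (\<lambda>_. 0)"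
      "\<And>x. f x = (\<Sum>j\<le>M. c j x * (x $ v) ^ j)"
    and d: "\<forall>j. d j \<in> polyfun K (W - {v})" "\<forall>j>N. d j = (\<lambda>_. 0)"
      "\<And>x. g x = (\<Sum>j\<le>N. d j x * (x $ v) ^ j)" by auto
  have "f x * g x = (\<Sum>r\<le>M + N. (\<Sum>k\<le>r. c k x * d (r - k) x) * (x $ v) ^ r)" for x
    unfolding c(3) d(3) by (rule polynomial_product) (use c(2) d(2) in auto)
  moreover have "(\<Sum>k\<le>r. c k x * d (r - k) x) = 0" if "r > M + N" for r x
  proof (intro sum.neutral ballI)
    fix k
    show "c k x * d (r - k) x = 0"
      by (cases "k > M") (use that c(2) d(2) in auto)
  qed
  ultimately show ?case using c(1) d(1)
    by (intro exI[of _ "M + N"] exI[of _ "\<lambda>r x. \<Sum>k\<le>r. c k x * d (r - k) x"])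
      (auto intro!: polyfun_sum[OF K] polyfun.mult)
qed

lemma polyfun_empty_const:
  assumes "f \<in> polyfun K {}"
  shows "f x = f y"
  using assms by induction simp_all

text \<open>Take a relation at \<open>t\<close> with as few variables as possible and sort it by
  powers of one of them. The leading coefficient is a nonzero polynomial in fewer variables, so by
  minimality it does not vanish at \<open>t\<close>.\<close>

lemma algebraic_over_remaining_coordinates:
  fixes t :: "real^'v"
  assumes K: "is_subfield K" and "\<not> generic_point K t"
  obtains v d c where "\<And>j. c j \<in> polyfun K (UNIV - {v})" "d \<ge> 1"
    "(\<Sum>j\<le>d. c j t * (t $ v) ^ j) = 0" "c d t \<noteq> 0"
proof -
  define P where "P W \<longleftrightarrow> (\<exists>f\<in>polyfun K W. f t = 0 \<and> f \<noteq> (\<lambda>_. 0))" for W :: "'v set"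
  have "P UNIV" using assms(2) unfolding generic_point_def P_def by simp
  from ex_has_least_nat[of P UNIV card, OF this]
  obtain W where W: "P W" "\<And>W'. P W' \<Longrightarrow> card W \<le> card W'" by (elim exE conjE) simp
  from W(1) obtain f where f: "f \<in> polyfun K W" "f t = 0" "f \<noteq> (\<lambda>_. 0)"
    unfolding P_def by (elim bexE conjE)
  have "W \<noteq> {}"
  proof
    assume "W = {}"
    then have "f x = 0" for x
      using f(1,2) polyfun_empty_const[of f K x t] by simp
    then show False using f(3) by auto
  qed
  then obtain v where v: "v \<in> W" by auto
  obtain M c where c: "\<forall>j. c j \<in> polyfun K (W - {v})" "\<forall>j>M. c j = (\<lambda>_. 0)"
      "\<And>x. f x = (\<Sum>j\<le>M. c j x * (x $ v) ^ j)"
    using polyfun_decompose[OF K f(1), of v] by blast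
  define d where "d = Max {j. c j \<noteq> (\<lambda>_. 0)}"
  have sub: "{j. c j \<noteq> (\<lambda>_. 0)} \<subseteq> {..M}"
  proof
    fix j assume "j \<in> {j. c j \<noteq> (\<lambda>_. 0)}"
    then have "\<not> j > M" using c(2) by blast
    then show "j \<in> {..M}" by simp
  qed
  then have fin: "finite {j. c j \<noteq> (\<lambda>_. 0)}" by (rule finite_subset) simp
  have "{j. c j \<noteq> (\<lambda>_. 0)} \<noteq> {}"
  proof
    assume "{j. c j \<noteq> (\<lambda>_. 0)} = {}"
    then have "c j = (\<lambda>_. 0)" for j by blast
    then have "f x = 0" for x using c(3)[of x] by simp
    then show False using f(3) by auto
  qed
  then have d: "c d \<noteq> (\<lambda>_. 0)"
    using Max_in[OF fin] unfolding d_def by blast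
  have d_max: "c j = (\<lambda>_. 0)" if "j > d" for j
  proof (rule ccontr)
    assume "c j \<noteq> (\<lambda>_. 0)"
    then have "j \<le> d" unfolding d_def by (intro Max_ge[OF fin]) simp
    with that show False by simp
  qed
  have "d \<le> M" using d sub by blast
  have "card (W - {v}) < card W" using v by (intro card_Diff1_less) auto
  then have "\<not> P (W - {v})" using W(2) by (metis not_le)
  then have cd: "c d t \<noteq> 0" using c(1) d unfolding P_def by blast
  have "f t = (\<Sum>j\<le>d. c j t * (t $ v) ^ j)"
    unfolding c(3) using \<open>d \<le> M\<close> d_max by (intro sum.mono_neutral_right) auto
  then have eq: "(\<Sum>j\<le>d. c j t * (t $ v) ^ j) = 0" using f(2) by simp
  have "d \<ge> 1"
  proof (rule ccontr)
    assume "\<not> d \<ge> 1"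
    then have "d = 0" by simp
    then show False using eq cd by simp
  qed
  moreover have "c j \<in> polyfun K (UNIV - {v})" for j
    by (rule polyfun_mono[OF c(1)[rule_format]]) auto
  ultimately show ?thesis using eq cd by (intro that[of c v d])
qed

section \<open>Transcendence degree\<close>

text \<open>The scalars are restricted to \<open>K\<close>; with real scalars any nonzero generator
  would span everything and there would be no dimension to count.\<close>

inductive_set kspan :: "real set \<Rightarrow> real set \<Rightarrow> real set" for K G where
  zero: "0 \<in> kspan K G"
| step: "c \<in> K \<Longrightarrow> g \<in> G \<Longrightarrow> x \<in> kspan K G \<Longrightarrow> c * g + x \<in> kspan K G"

lemma kspan_base:
  assumes "is_subfield K" "g \<in> G"
  shows "g \<in> kspan K G"
  using kspan.step[OF is_subfieldD(2)[OF assms(1)] assms(2) kspan.zero] by simp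

lemma kspan_add:
  assumes "x \<in> kspan K G" "y \<in> kspan K G"
  shows "x + y \<in> kspan K G"
  using assms(1)
proof induction
  case (step c g x)
  then show ?case using kspan.step[of c K g G "x + y"] by (simp add: add.assoc)
qed (simp add: assms(2))

lemma kspan_scale:
  assumes "is_subfield K" "c \<in> K" "x \<in> kspan K G"
  shows "c * x \<in> kspan K G"
  using assms(3)
proof induction
  case zero
  show ?case by (simp add: kspan.zero)
next
  case (step d g x)
  then show ?case
    using kspan.step[of "c * d" K g G "c * x"] is_subfieldD(6)[OF assms(1,2)]
    by (simp add: distrib_left mult.assoc)
qed

lemma kspan_uminus:
  assumes "is_subfield K" "x \<in> kspan K G"
  shows "- x \<in> kspan K G"
  using kspan_scale[OF assms(1) is_subfieldD(3)[OF assms(1) is_subfieldD(2)[OF assms(1)]] assms(2)] by simp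

lemma kspan_sum:
  assumes "\<And>i. i \<in> I \<Longrightarrow> f i \<in> kspan K G"
  shows "sum f I \<in> kspan K G"
  using assms
  by (induction I rule: infinite_finite_induct) (simp_all add: kspan.zero kspan_add)

text \<open>The factor \<open>r\<close> lets the rule serve twice: with \<open>r = 1\<close> as
  minimality of the span, and in general for multiplying two spans generator by generator.\<close>

lemma kspan_least:
  assumes "is_subfield K" "x \<in> kspan K G" "\<And>g. g \<in> G \<Longrightarrow> r * g \<in> kspan K H"
  shows "r * x \<in> kspan K H"
  using assms(2)
proof induction
  case zero
  show ?case by (simp add: kspan.zero)
next
  case (step c g x)
  have "c * (r * g) + r * x \<in> kspan K H"
    by (rule kspan_add[OF kspan_scale[OF assms(1) step(1) assms(3)[OF step(2)]] step(4)])
  then show ?case by (simp add: distrib_left mult.left_commute)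
qed

lemma kspan_mult:
  assumes "is_subfield K" "x \<in> kspan K G" "y \<in> kspan K H"
    and "\<And>g h. g \<in> G \<Longrightarrow> h \<in> H \<Longrightarrow> g * h \<in> kspan K M"
  shows "x * y \<in> kspan K M"
proof (rule kspan_least[OF assms(1,3)])
  fix h assume "h \<in> H"
  have "h * x \<in> kspan K M"
    by (rule kspan_least[OF assms(1,2)]) (use assms(4)[OF _ \<open>h \<in> H\<close>] in \<open>simp add: mult.commute\<close>)
  then show "x * h \<in> kspan K M" by (simp add: mult.commute)
qed

lemma kspan_mono:
  assumes "is_subfield K" "x \<in> kspan K G" "G \<subseteq> H"
  shows "x \<in> kspan K H"
  using kspan_least[OF assms(1,2), of 1 H] assms(3) kspan_base[OF assms(1)] by auto

lemma kspan_rep: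
  assumes "is_subfield K" "finite G" "x \<in> kspan K G"
  shows "\<exists>c. (\<forall>g\<in>G. c g \<in> K) \<and> x = (\<Sum>g\<in>G. c g * g)"
  using assms(3)
proof induction
  case zero
  show ?case using is_subfieldD(1)[OF assms(1)] by (intro exI[of _ "\<lambda>_. 0"]) simp
next
  case (step d h x)
  then obtain c where c: "\<forall>g\<in>G. c g \<in> K" "x = (\<Sum>g\<in>G. c g * g)" by blast
  have "(\<Sum>g\<in>G. (c g + (if g = h then d else 0)) * g) = x + d * h"
    using step(2) assms(2) unfolding c(2) by (simp add: distrib_right sum.distrib if_distrib[of "\<lambda>a. a * _"] cong: if_cong)
  then show ?case using c(1) step(1) is_subfieldD(5)[OF assms(1)]
    by (intro exI[of _ "\<lambda>g. c g + (if g = h then d else 0)"]) (auto simp: add.commute)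
qed

text \<open>More vectors than generators leave a homogeneous system with more unknowns than
  equations. The vectors are indexed by \<open>A\<close>, so that coinciding values of
  \<open>u\<close> also count as dependent.\<close>

lemma kspan_dependent:
  assumes K: "is_subfield K" and "finite A" "finite G" "card G < card A"
    and "\<And>\<alpha>. \<alpha> \<in> A \<Longrightarrow> u \<alpha> \<in> kspan K G"
  shows "\<exists>c. (\<forall>\<alpha>\<in>A. c \<alpha> \<in> K) \<and> (\<exists>\<alpha>\<in>A. c \<alpha> \<noteq> 0) \<and> (\<Sum>\<alpha>\<in>A. c \<alpha> * u \<alpha>) = 0"
proof -
  have "\<forall>\<alpha>\<in>A. \<exists>a. (\<forall>g\<in>G. a g \<in> K) \<and> u \<alpha> = (\<Sum>g\<in>G. a g * g)"
    using kspan_rep[OF K assms(3) assms(5)] by blast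
  then obtain a where a: "\<And>\<alpha> g. \<alpha> \<in> A \<Longrightarrow> g \<in> G \<Longrightarrow> a \<alpha> g \<in> K"
    "\<And>\<alpha>. \<alpha> \<in> A \<Longrightarrow> u \<alpha> = (\<Sum>g\<in>G. a \<alpha> g * g)" by metis
  obtain c where c: "\<forall>\<alpha>\<in>A. c \<alpha> \<in> K" "\<exists>\<alpha>\<in>A. c \<alpha> \<noteq> 0" "\<forall>g\<in>G. (\<Sum>\<alpha>\<in>A. a \<alpha> g * c \<alpha>) = 0"
    using homogeneous_system_nontrivial[OF K assms(3,2,4), of "\<lambda>g \<alpha>. a \<alpha> g"] a(1) by blast
  have "(\<Sum>\<alpha>\<in>A. c \<alpha> * u \<alpha>) = (\<Sum>\<alpha>\<in>A. \<Sum>g\<in>G. (a \<alpha> g * c \<alpha>) * g)"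
    by (intro sum.cong refl) (simp add: a(2) sum_distrib_left mult_ac)
  also have "\<dots> = (\<Sum>g\<in>G. (\<Sum>\<alpha>\<in>A. a \<alpha> g * c \<alpha>) * g)"
    by (subst sum.swap) (simp add: sum_distrib_right)
  also have "\<dots> = 0" using c(3) by simp
  finally show ?thesis using c(1,2) by blast
qed

text \<open>Each exponent is bounded separately, not the total degree: there are then at most
  \<open>(M + 1) ^ card T\<close> monomials, and the bounds add under multiplication.\<close>

definition monomials :: "real^'v \<Rightarrow> 'v set \<Rightarrow> nat \<Rightarrow> real set" where
  "monomials t T M = (\<lambda>\<alpha>. \<Prod>w\<in>T. (t $ w) ^ \<alpha> w) ` {\<alpha>. \<forall>w\<in>T. \<alpha> w \<le> M}"

lemma monomialsI: "(\<And>w. w \<in> T \<Longrightarrow> \<alpha> w \<le> M) \<Longrightarrow> (\<Prod>w\<in>T. (t $ w) ^ \<alpha> w) \<in> monomials t T M"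
  unfolding monomials_def by blast

lemma monomials_eq_PiE:
  "monomials t T M = (\<lambda>\<alpha>. \<Prod>w\<in>T. (t $ w) ^ \<alpha> w) ` (T \<rightarrow>\<^sub>E {..M})"
proof -
  have "(\<Prod>w\<in>T. (t $ w) ^ \<alpha> w) \<in> (\<lambda>\<alpha>. \<Prod>w\<in>T. (t $ w) ^ \<alpha> w) ` (T \<rightarrow>\<^sub>E {..M})"
    if "\<forall>w\<in>T. \<alpha> w \<le> M" for \<alpha>
  proof (rule image_eqI)
    show "(\<Prod>w\<in>T. (t $ w) ^ \<alpha> w) = (\<Prod>w\<in>T. (t $ w) ^ restrict \<alpha> T w)" by simp
    show "restrict \<alpha> T \<in> T \<rightarrow>\<^sub>E {..M}" using that by auto
  qed
  then show ?thesis unfolding monomials_def by (auto simp: PiE_iff)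
qed

lemma finite_monomials:
  fixes t :: "real^'v"
  shows "finite (monomials t T M)"
  unfolding monomials_eq_PiE by (intro finite_imageI finite_PiE) simp_all

lemma card_monomials:
  fixes t :: "real^'v"
  shows "card (monomials t T M) \<le> (M + 1) ^ card T"
proof -
  have "card (monomials t T M) \<le> card (T \<rightarrow>\<^sub>E {..M})"
    unfolding monomials_eq_PiE by (intro card_image_le finite_PiE) simp_all
  then show ?thesis by (simp add: card_PiE)
qed

lemma monomials_mult:
  fixes t :: "real^'v"
  assumes "x \<in> monomials t T M" "y \<in> monomials t T N"
  shows "x * y \<in> monomials t T (M + N)"
proof -
  obtain \<alpha> \<beta> where \<alpha>: "\<forall>w\<in>T. \<alpha> w \<le> M" "x = (\<Prod>w\<in>T. (t $ w) ^ \<alpha> w)"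
    and \<beta>: "\<forall>w\<in>T. \<beta> w \<le> N" "y = (\<Prod>w\<in>T. (t $ w) ^ \<beta> w)"
    using assms unfolding monomials_def by blast
  have "x * y = (\<Prod>w\<in>T. (t $ w) ^ (\<alpha> w + \<beta> w))"
    unfolding \<alpha>(2) \<beta>(2) by (simp add: power_add prod.distrib)
  then show ?thesis using \<alpha>(1) \<beta>(1) by (auto intro!: monomialsI add_mono)
qed

lemma monomials_mono: "M \<le> N \<Longrightarrow> monomials t T M \<subseteq> monomials t T N"
  unfolding monomials_def by (intro image_mono) (auto intro: le_trans)

lemma kspan_monomials_mult:
  assumes "is_subfield K" "x \<in> kspan K (monomials t T M)" "y \<in> kspan K (monomials t T N)"
  shows "x * y \<in> kspan K (monomials t T (M + N))"
  by (rule kspan_mult[OF assms]) (intro kspan_base[OF assms(1)] monomials_mult)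

lemma kspan_monomials_const:
  assumes "is_subfield K" "c \<in> K"
  shows "c \<in> kspan K (monomials t T M)"
proof -
  have "1 \<in> monomials t T M" using monomialsI[of T "\<lambda>_. 0" M t] by simp
  from kspan_scale[OF assms kspan_base[OF assms(1) this]] show ?thesis by simp
qed

lemma kspan_monomials_power:
  assumes "is_subfield K" "x \<in> kspan K (monomials t T M)"
  shows "x ^ n \<in> kspan K (monomials t T (n * M))"
proof (induction n)
  case 0
  show ?case using kspan_monomials_const[OF assms(1) is_subfieldD(2)[OF assms(1)]] by simp
next
  case (Suc n)
  show ?case using kspan_monomials_mult[OF assms Suc] by simp
qed

lemma kspan_monomials_prod:
  assumes "is_subfield K" "finite I" "\<And>i. i \<in> I \<Longrightarrow> x i \<in> kspan K (monomials t T M)"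
  shows "(\<Prod>i\<in>I. x i) \<in> kspan K (monomials t T (card I * M))"
  using assms(2,3)
proof (induction I rule: finite_induct)
  case empty
  show ?case using kspan_monomials_const[OF assms(1) is_subfieldD(2)[OF assms(1)]] by simp
next
  case (insert i I)
  have "x i * (\<Prod>i\<in>I. x i) \<in> kspan K (monomials t T (M + card I * M))"
    using insert by (intro kspan_monomials_mult[OF assms(1)]) auto
  then show ?case using insert by simp
qed

lemma kspan_monomials_mono:
  assumes "is_subfield K" "x \<in> kspan K (monomials t T M)" "M \<le> N"
  shows "x \<in> kspan K (monomials t T N)"
  using kspan_mono[OF assms(1,2) monomials_mono[OF assms(3)]] .

lemma polyfun_in_kspan:
  fixes t :: "real^'v"
  assumes K: "is_subfield K" and "f \<in> polyfun K T"
  shows "\<exists>D. f t \<in> kspan K (monomials t T D)"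
  using assms(2)
proof induction
  case (const c)
  then show ?case using kspan_monomials_const[OF K] by blast
next
  case (coord v)
  have "(\<Prod>w\<in>T. (t $ w) ^ (if w = v then 1 else 0)) = t $ v"
    using coord by (simp add: if_distrib[of "\<lambda>n. _ ^ n"] prod.delta cong: if_cong)
  then have "t $ v \<in> monomials t T 1"
    using monomialsI[of T "\<lambda>w. if w = v then 1 else 0" 1 t] by simp
  then show ?case using kspan_base[OF K] by blast
next
  case (add f g)
  then obtain D E where "f t \<in> kspan K (monomials t T D)" "g t \<in> kspan K (monomials t T E)" by blast
  then have "f t \<in> kspan K (monomials t T (max D E))" "g t \<in> kspan K (monomials t T (max D E))"
    using kspan_monomials_mono[OF K] by (meson max.cobounded1, meson max.cobounded2)
  then show ?case using kspan_add by blast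
next
  case (mult f g)
  then show ?case using kspan_monomials_mult[OF K] by blast
qed

lemma uniform_polyfun_in_kspan:
  fixes t :: "real^'v"
  assumes K: "is_subfield K" and "finite I" "\<And>i. i \<in> I \<Longrightarrow> f i \<in> polyfun K T"
  shows "\<exists>D. \<forall>i\<in>I. f i t \<in> kspan K (monomials t T D)"
proof -
  have "\<forall>i\<in>I. \<exists>D. f i t \<in> kspan K (monomials t T D)"
    using polyfun_in_kspan[OF K assms(3)] by blast
  then obtain D where D: "\<And>i. i \<in> I \<Longrightarrow> f i t \<in> kspan K (monomials t T (D i))" by metis
  have "D i \<le> Max (D ` I)" if "i \<in> I" for i using assms(2) that by simp
  then show ?thesis using D kspan_monomials_mono[OF K] by blast
qed

text \<open>Trades nested finitely supported mappings for a finite set \<open>A\<close> of exponent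
  functions supported on \<open>B\<close>, the form in which a dimension count delivers a
  relation.\<close>

lemma algebraically_independent_lincomb:
  assumes ind: "algebraically_independent K B" and K: "is_subfield K"
    and "finite A" "finite B" and supp: "\<And>\<alpha> x. \<alpha> \<in> A \<Longrightarrow> x \<notin> B \<Longrightarrow> \<alpha> x = 0"
    and "\<And>\<alpha>. \<alpha> \<in> A \<Longrightarrow> c \<alpha> \<in> K" and zero: "(\<Sum>\<alpha>\<in>A. c \<alpha> * (\<Prod>b\<in>B. b ^ \<alpha> b)) = 0"
    and "\<alpha> \<in> A"
  shows "c \<alpha> = 0"
proof -
  have fin_supp: "finite {x. \<beta> x \<noteq> 0}" if "\<beta> \<in> A" for \<beta>
  proof (rule finite_subset[OF _ assms(4)], rule subsetI, rule ccontr)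
    fix x assume "x \<in> {x. \<beta> x \<noteq> 0}" "x \<notin> B"
    then show False using supp[OF that] by simp
  qed
  have look: "Poly_Mapping.lookup (Poly_Mapping.Abs_poly_mapping \<beta>) = \<beta>" if "\<beta> \<in> A" for \<beta>
    by (rule Poly_Mapping.lookup_Abs_poly_mapping[OF fin_supp[OF that]])
  define S where "S = Poly_Mapping.Abs_poly_mapping ` A"
  have S: "m \<in> S \<longleftrightarrow> Poly_Mapping.lookup m \<in> A" for m
  proof
    assume "Poly_Mapping.lookup m \<in> A"
    then show "m \<in> S" unfolding S_def by (intro image_eqI[of _ _ "Poly_Mapping.lookup m"]) (simp_all add: Poly_Mapping.lookup_inverse)
  qed (auto simp: S_def look)
  define p where "p m = (if m \<in> S then c (Poly_Mapping.lookup m) else 0)" for m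
  define P where "P = Poly_Mapping.Abs_poly_mapping p"
  have "finite S" unfolding S_def using assms(3) by simp
  have "finite {m. p m \<noteq> 0}"
    by (rule finite_subset[OF _ \<open>finite S\<close>]) (auto simp: p_def)
  then have P: "Poly_Mapping.lookup P = p" unfolding P_def by (rule Poly_Mapping.lookup_Abs_poly_mapping)
  have keysP: "Poly_Mapping.keys P \<subseteq> S"
  proof
    fix m assume "m \<in> Poly_Mapping.keys P"
    then have "p m \<noteq> 0" by (simp add: in_keys_iff P)
    then show "m \<in> S" by (auto simp: p_def split: if_splits)
  qed
  have keys: "Poly_Mapping.keys m \<subseteq> B" if "m \<in> S" for m
  proof
    fix x assume "x \<in> Poly_Mapping.keys m"
    then have "Poly_Mapping.lookup m x \<noteq> 0" by (simp add: in_keys_iff)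
    moreover have "Poly_Mapping.lookup m \<in> A" using that S by simp
    ultimately show "x \<in> B" using supp[of "Poly_Mapping.lookup m" x] by (cases "x \<in> B") simp_all
  qed
  have "poly_value P = (\<Sum>m\<in>S. Poly_Mapping.lookup P m * (\<Prod>x\<in>Poly_Mapping.keys m. x ^ Poly_Mapping.lookup m x))"
    unfolding poly_value_def
    by (rule sum.mono_neutral_left[OF \<open>finite S\<close> keysP]) (simp add: in_keys_iff)
  also have "\<dots> = (\<Sum>m\<in>S. c (Poly_Mapping.lookup m) * (\<Prod>b\<in>B. b ^ Poly_Mapping.lookup m b))"
  proof (intro sum.cong refl arg_cong2[of _ _ _ _ "(*)"])
    fix m assume m: "m \<in> S"
    show "Poly_Mapping.lookup P m = c (Poly_Mapping.lookup m)" using m by (simp add: P p_def)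
    show "(\<Prod>x\<in>Poly_Mapping.keys m. x ^ Poly_Mapping.lookup m x) = (\<Prod>b\<in>B. b ^ Poly_Mapping.lookup m b)"
      by (rule prod.mono_neutral_left[OF assms(4) keys[OF m]]) (simp add: in_keys_iff)
  qed
  also have "\<dots> = (\<Sum>\<alpha>\<in>A. c \<alpha> * (\<Prod>b\<in>B. b ^ \<alpha> b))"
  proof (rule sum.reindex_bij_betw[of Poly_Mapping.lookup S A "\<lambda>\<alpha>. c \<alpha> * (\<Prod>b\<in>B. b ^ \<alpha> b)"])
    show "bij_betw Poly_Mapping.lookup S A"
      unfolding bij_betw_def
    proof
      show "inj_on Poly_Mapping.lookup S" by (simp add: inj_on_def Poly_Mapping.lookup_inject)
      show "Poly_Mapping.lookup ` S = A" unfolding S_def image_image using look by simp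
    qed
  qed
  finally have "poly_value P = 0" using zero by simp
  moreover have "Poly_Mapping.lookup P m \<in> K" for m
    using assms(6) is_subfieldD(1)[OF K] S by (simp add: P p_def)
  moreover have "\<forall>m\<in>Poly_Mapping.keys P. Poly_Mapping.keys m \<subseteq> B" using keysP keys by blast
  ultimately have "P = 0"
    by (intro ind[unfolded algebraically_independent_def, rule_format, of P]) simp
  have "p (Poly_Mapping.Abs_poly_mapping \<alpha>) = Poly_Mapping.lookup P (Poly_Mapping.Abs_poly_mapping \<alpha>)"
    unfolding P ..
  then have "p (Poly_Mapping.Abs_poly_mapping \<alpha>) = 0" unfolding \<open>P = 0\<close> by simp
  then show ?thesis using assms(8) look by (simp add: p_def S_def)
qed

text \<open>Conversely, every formal polynomial is such a finite sum; its exponent functions are the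
  \<open>lookup\<close>s of its monomials.\<close>

lemma algebraically_independentI:
  assumes "finite B"
    and "\<And>A c \<alpha>. finite A \<Longrightarrow> (\<And>\<alpha> x. \<alpha> \<in> A \<Longrightarrow> x \<notin> B \<Longrightarrow> \<alpha> x = 0) \<Longrightarrow> (\<And>\<alpha>. \<alpha> \<in> A \<Longrightarrow> c \<alpha> \<in> K) \<Longrightarrow>
        (\<Sum>\<alpha>\<in>A. c \<alpha> * (\<Prod>b\<in>B. b ^ \<alpha> b)) = 0 \<Longrightarrow> \<alpha> \<in> A \<Longrightarrow> c \<alpha> = 0"
  shows "algebraically_independent K B"
  unfolding algebraically_independent_def
proof (intro allI impI)
  fix P assume P: "(\<forall>m. Poly_Mapping.lookup P m \<in> K) \<and>
      (\<forall>m\<in>Poly_Mapping.keys P. Poly_Mapping.keys m \<subseteq> B) \<and> poly_value P = 0"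
  define A where "A = Poly_Mapping.lookup ` Poly_Mapping.keys P"
  define c where "c \<alpha> = Poly_Mapping.lookup P (Poly_Mapping.Abs_poly_mapping \<alpha>)" for \<alpha>
  have c: "c (Poly_Mapping.lookup m) = Poly_Mapping.lookup P m" for m
    by (simp add: c_def Poly_Mapping.lookup_inverse)
  have "(\<Sum>\<alpha>\<in>A. c \<alpha> * (\<Prod>b\<in>B. b ^ \<alpha> b)) =
      (\<Sum>m\<in>Poly_Mapping.keys P. c (Poly_Mapping.lookup m) * (\<Prod>b\<in>B. b ^ Poly_Mapping.lookup m b))"
    unfolding A_def
    by (subst sum.reindex) (simp_all add: inj_on_def Poly_Mapping.lookup_inject)
  also have "\<dots> = poly_value P"
    unfolding poly_value_def
  proof (intro sum.cong refl arg_cong2[of _ _ _ _ "(*)"] c)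
    fix m assume "m \<in> Poly_Mapping.keys P"
    then have "Poly_Mapping.keys m \<subseteq> B" using P by blast
    then show "(\<Prod>b\<in>B. b ^ Poly_Mapping.lookup m b) = (\<Prod>x\<in>Poly_Mapping.keys m. x ^ Poly_Mapping.lookup m x)"
      by (intro prod.mono_neutral_right[OF assms(1)]) (simp_all add: in_keys_iff)
  qed
  finally have zero: "(\<Sum>\<alpha>\<in>A. c \<alpha> * (\<Prod>b\<in>B. b ^ \<alpha> b)) = 0" using P by simp
  have "Poly_Mapping.lookup P m = 0" if "m \<in> Poly_Mapping.keys P" for m
  proof -
    have "c (Poly_Mapping.lookup m) = 0"
    proof (rule assms(2)[OF _ _ _ zero])
      show "finite A" by (simp add: A_def)
      show "\<alpha> x = 0" if "\<alpha> \<in> A" "x \<notin> B" for \<alpha> x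
      proof -
        obtain m where m: "m \<in> Poly_Mapping.keys P" "\<alpha> = Poly_Mapping.lookup m"
          using \<open>\<alpha> \<in> A\<close> unfolding A_def by blast
        then have "x \<notin> Poly_Mapping.keys m" using P \<open>x \<notin> B\<close> by blast
        then show ?thesis using m(2) by (simp add: in_keys_iff)
      qed
      show "c \<alpha> \<in> K" for \<alpha> using P by (simp add: c_def)
      show "Poly_Mapping.lookup m \<in> A" using that by (simp add: A_def)
    qed
    then show ?thesis by (simp add: c)
  qed
  then show "P = 0" by (intro poly_mapping_eqI) (metis in_keys_iff lookup_zero)
qed

lemma power_dominates:
  fixes C d n :: nat
  assumes "n \<ge> 1" "s \<ge> n"
  shows "\<exists>N. d * (C * (N + 1)) ^ (n - 1) < (N + 1) ^ s"
\<comment> \<open>With this \<open>N\<close> the left side equals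
  \<open>N * (N + 1) ^ (n - 1)\<close>, which is just below \<open>(N + 1) ^ n\<close>.\<close>
proof (rule exI[of _ "d * C ^ (n - 1)"])
  let ?N = "d * C ^ (n - 1)"
  have "d * (C * (?N + 1)) ^ (n - 1) = ?N * (?N + 1) ^ (n - 1)"
    by (simp only: power_mult_distrib mult.assoc)
  also have "\<dots> < (?N + 1) * (?N + 1) ^ (n - 1)"
    by (intro mult_strict_right_mono) simp_all
  also have "\<dots> = (?N + 1) ^ n"
    using assms(1) by (simp flip: power_Suc)
  also have "\<dots> \<le> (?N + 1) ^ s" using assms(2) by (intro power_increasing) simp_all
  finally show "d * (C * (?N + 1)) ^ (n - 1) < (?N + 1) ^ s" .
qed

text \<open>
  If \<open>t\<close> satisfies a polynomial relation, then after clearing denominators all monomials of box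
  degree \<open>N\<close> in the elements of \<open>B\<close> lie in a space of dimension \<open>O(N ^ (n - 1))\<close>, so that
  counting gives \<open>(N + 1) ^ card B = O(N ^ (n - 1))\<close>.
\<close>

lemma card_algebraically_independent_less:
  fixes t :: "real^'v"
  assumes K: "is_subfield K" and dep: "\<not> generic_point K t"
    and "finite B" and ind: "algebraically_independent K B"
    and rat: "\<And>b. b \<in> B \<Longrightarrow> \<exists>P\<in>polyfun K UNIV. \<exists>R\<in>polyfun K UNIV. R t \<noteq> 0 \<and> b = P t / R t"
  shows "card B < CARD('v)"
proof (rule ccontr)
  assume "\<not> card B < CARD('v)"
  then have card_B: "card B \<ge> CARD('v)" by simp
  obtain v d c where vdc: "\<And>j. c j \<in> polyfun K (UNIV - {v})" "d \<ge> 1"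
      "(\<Sum>j\<le>d. c j t * (t $ v) ^ j) = 0" "c d t \<noteq> 0"
    by (rule algebraic_over_remaining_coordinates[OF K dep], rule that; assumption)
  define T where "T = UNIV - {v}"
  define \<tau> where "\<tau> = t $ v"
  define \<gamma> where "\<gamma> = c d t"
  have \<gamma>: "\<gamma> \<noteq> 0" using vdc(4) by (simp add: \<gamma>_def)
  obtain D where D: "\<And>j. j \<le> d \<Longrightarrow> c j t \<in> kspan K (monomials t T D)"
  proof -
    have "\<exists>D. \<forall>j\<in>{..d}. c j t \<in> kspan K (monomials t T D)"
      by (rule uniform_polyfun_in_kspan[OF K]) (simp_all add: vdc(1) T_def)
    then obtain E where "\<forall>j\<in>{..d}. c j t \<in> kspan K (monomials t T E)" ..
    then show thesis by (intro that[of E]) simp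
  qed
  have \<gamma>D: "\<gamma> \<in> kspan K (monomials t T D)" using D[of d] by (simp add: \<gamma>_def)
  have top: "\<gamma> * \<tau> ^ d = - (\<Sum>i<d. c i t * \<tau> ^ i)"
    using vdc(3) unfolding \<gamma>_def \<tau>_def lessThan_Suc_atMost[symmetric] by simp
  \<comment> \<open>Generators that suffice after reduction by the relation of degree
    \<open>d\<close> in \<open>\<tau>\<close>. Their number grows with exponent
    \<open>CARD('v) - 1\<close>, because the variable \<open>v\<close> contributes only the constant
    factor \<open>d\<close>.\<close>
  define G where "G M = (\<lambda>(m, j). m * \<tau> ^ j) ` (monomials t T M \<times> {..<d})" for M
  have finG: "finite (G M)" for M unfolding G_def
    by (intro finite_imageI finite_cartesian_product finite_monomials) simp
  have cardG: "card (G M) \<le> (M + 1) ^ (CARD('v) - 1) * d" for M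
  proof -
    have "card (G M) \<le> card (monomials t T M \<times> {..<d})"
      unfolding G_def by (intro card_image_le) (simp add: finite_monomials)
    also have "\<dots> = card (monomials t T M) * d" by (simp add: card_cartesian_product)
    also have "\<dots> \<le> (M + 1) ^ card T * d" by (intro mult_right_mono card_monomials) simp
    finally show ?thesis by (simp add: T_def card_Diff_singleton)
  qed
  have inG: "z * \<tau> ^ j \<in> kspan K (G M)" if "z \<in> kspan K (monomials t T M)" "j < d" for z j M
  proof -
    have "\<tau> ^ j * z \<in> kspan K (G M)"
    proof (rule kspan_least[OF K that(1)])
      fix m assume "m \<in> monomials t T M"
      then have "\<tau> ^ j * m \<in> G M"
        using that(2) unfolding G_def by (intro image_eqI[of _ _ "(m, j)"]) (simp_all add: mult.commute)
      then show "\<tau> ^ j * m \<in> kspan K (G M)" by (rule kspan_base[OF K])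
    qed
    then show ?thesis by (simp add: mult.commute)
  qed
  have multG: "z * x \<in> kspan K (G (M + N))"
    if "z \<in> kspan K (monomials t T M)" "x \<in> kspan K (G N)" for z x M N
  proof (rule kspan_mult[OF K that])
    fix g h assume g: "g \<in> monomials t T M" and "h \<in> G N"
    then obtain m j where h: "m \<in> monomials t T N" "j < d" "h = m * \<tau> ^ j" unfolding G_def by auto
    have "(g * m) * \<tau> ^ j \<in> kspan K (G (M + N))"
      by (rule inG[OF kspan_base[OF K monomials_mult[OF g h(1)]] h(2)])
    then show "g * h \<in> kspan K (G (M + N))" using h(3) by (simp add: mult.assoc)
  qed
  \<comment> \<open>Multiplying by \<open>\<gamma> * \<tau>\<close> rather than
    \<open>\<tau>\<close> avoids division: at the top, \<open>\<gamma> * \<tau> ^ d\<close> is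
    replaced by lower powers of \<open>\<tau>\<close>. Each such multiplication costs
    \<open>D\<close> in the degree.\<close>
  have stepG: "(\<gamma> * \<tau>) * x \<in> kspan K (G (D + M))" if "x \<in> kspan K (G M)" for x M
  proof (rule kspan_least[OF K that])
    fix g assume "g \<in> G M"
    then obtain m j where g: "m \<in> monomials t T M" "j < d" "g = m * \<tau> ^ j" unfolding G_def by fastforce
    note m = kspan_base[OF K g(1)]
    show "(\<gamma> * \<tau>) * g \<in> kspan K (G (D + M))"
    proof (cases "Suc j < d")
      case True
      have "(\<gamma> * m) * \<tau> ^ Suc j \<in> kspan K (G (D + M))"
        by (rule inG[OF kspan_monomials_mult[OF K \<gamma>D m] True])
      then show ?thesis using g(3) by (simp add: mult_ac)
    next
      case False
      then have "d = Suc j" using g(2) by simp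
      then have "(\<gamma> * \<tau>) * g = (\<gamma> * \<tau> ^ d) * m" using g(3) by (simp add: mult_ac)
      also have "\<dots> = - (\<Sum>i<d. (c i t * m) * \<tau> ^ i)"
        unfolding top by (simp add: sum_distrib_left sum_distrib_right mult_ac)
      also have "\<dots> \<in> kspan K (G (D + M))"
        by (intro kspan_uminus[OF K] kspan_sum inG kspan_monomials_mult[OF K D m]) simp_all
      finally show ?thesis .
    qed
  qed
  have powG: "\<gamma> ^ k * \<tau> ^ k \<in> kspan K (G (k * D))" for k
  proof (induction k)
    case 0
    show ?case using inG[OF kspan_monomials_const[OF K is_subfieldD(2)[OF K]], of 0] vdc(2) by simp
  next
    case (Suc k)
    show ?case using stepG[OF Suc] by (simp add: mult_ac)
  qed
  \<comment> \<open>Different monomials need different powers of \<open>\<gamma>\<close>, one for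
    each factor \<open>\<tau>\<close>. The surplus is absorbed by the other factor, so that
    \<open>\<gamma> ^ M\<close> serves all of them.\<close>
  have monG: "\<gamma> ^ M * x \<in> kspan K (G (M * D + M))" if "x \<in> monomials t UNIV M" for x M
  proof -
    from \<open>x \<in> monomials t UNIV M\<close>[unfolded monomials_def]
    obtain \<alpha> where "\<alpha> \<in> {\<alpha>. \<forall>w\<in>UNIV. \<alpha> w \<le> M}" and x_eq: "x = (\<Prod>w\<in>UNIV. (t $ w) ^ \<alpha> w)"
      by (rule imageE)
    then have \<alpha>: "\<alpha> w \<le> M" for w by simp
    define m where "m = (\<Prod>w\<in>T. (t $ w) ^ \<alpha> w)"
    have x: "x = \<tau> ^ \<alpha> v * m"
      unfolding x_eq m_def T_def \<tau>_def by (rule prod.remove) simp_all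
    have m: "m \<in> kspan K (monomials t T M)"
      unfolding m_def by (intro kspan_base[OF K] monomialsI \<alpha>)
    have "(\<gamma> ^ (M - \<alpha> v) * m) * (\<gamma> ^ \<alpha> v * \<tau> ^ \<alpha> v) \<in> kspan K (G (((M - \<alpha> v) * D + M) + \<alpha> v * D))"
      by (intro multG kspan_monomials_mult[OF K] kspan_monomials_power[OF K] \<gamma>D m powG)
    moreover have "((M - \<alpha> v) * D + M) + \<alpha> v * D = M * D + M"
    proof -
      have "(M - \<alpha> v) * D + \<alpha> v * D = M * D" using \<alpha>[of v] by (simp flip: add_mult_distrib)
      then show ?thesis by linarith
    qed
    moreover have "(\<gamma> ^ (M - \<alpha> v) * m) * (\<gamma> ^ \<alpha> v * \<tau> ^ \<alpha> v) = (\<gamma> ^ (M - \<alpha> v) * \<gamma> ^ \<alpha> v) * x"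
      unfolding x by (simp only: mult_ac)
    moreover have "\<gamma> ^ (M - \<alpha> v) * \<gamma> ^ \<alpha> v = \<gamma> ^ M"
      using \<alpha>[of v] by (simp flip: power_add)
    ultimately show ?thesis by simp
  qed

  obtain P R where PR: "\<And>b. b \<in> B \<Longrightarrow> P b \<in> polyfun K UNIV" "\<And>b. b \<in> B \<Longrightarrow> R b \<in> polyfun K UNIV"
      "\<And>b. b \<in> B \<Longrightarrow> R b t \<noteq> 0" "\<And>b. b \<in> B \<Longrightarrow> b = P b t / R b t"
  proof -
    have "\<forall>b\<in>B. \<exists>q. fst q \<in> polyfun K UNIV \<and> snd q \<in> polyfun K UNIV \<and> snd q t \<noteq> 0 \<and> b = fst q t / snd q t"
    proof
      fix b assume "b \<in> B"
      from rat[OF this] obtain P R where "P \<in> polyfun K UNIV" "R \<in> polyfun K UNIV" "R t \<noteq> 0" "b = P t / R t"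
        by (elim bexE conjE)
      then show "\<exists>q. fst q \<in> polyfun K UNIV \<and> snd q \<in> polyfun K UNIV \<and> snd q t \<noteq> 0 \<and> b = fst q t / snd q t"
        by (intro exI[of _ "(P, R)"]) simp
    qed
    from bchoice[OF this] obtain q where "\<forall>b\<in>B. fst (q b) \<in> polyfun K UNIV \<and>
        snd (q b) \<in> polyfun K UNIV \<and> snd (q b) t \<noteq> 0 \<and> b = fst (q b) t / snd (q b) t" ..
    then show thesis by (intro that[of "\<lambda>b. fst (q b)" "\<lambda>b. snd (q b)"]) simp_all
  qed
  define \<rho> where "\<rho> = (\<Prod>b\<in>B. R b t)"
  have \<rho>: "\<rho> \<noteq> 0" unfolding \<rho>_def using PR(3) \<open>finite B\<close> by simp
  have "\<exists>D. \<forall>b\<in>B. b * \<rho> \<in> kspan K (monomials t UNIV D)"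
  proof -
    have "(\<lambda>x. P b x * (\<Prod>b'\<in>B - {b}. R b' x)) \<in> polyfun K UNIV" if "b \<in> B" for b
      using that PR(1,2) by (intro polyfun.mult polyfun_prod[OF K]) simp_all
    moreover have "b * \<rho> = P b t * (\<Prod>b'\<in>B - {b}. R b' t)" if "b \<in> B" for b
    proof -
      have "\<rho> = R b t * (\<Prod>b'\<in>B - {b}. R b' t)"
        unfolding \<rho>_def using \<open>finite B\<close> that by (rule prod.remove)
      then have "b * \<rho> = (b * R b t) * (\<Prod>b'\<in>B - {b}. R b' t)" by simp
      moreover have "b * R b t = P b t" using PR(3,4)[OF that] by (metis nonzero_eq_divide_eq)
      ultimately show ?thesis by simp
    qed
    ultimately show ?thesis
      using uniform_polyfun_in_kspan[OF K \<open>finite B\<close>, of "\<lambda>b x. P b x * (\<Prod>b'\<in>B - {b}. R b' x)" UNIV t]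
      by simp
  qed
  then obtain D1 where D1: "\<And>b. b \<in> B \<Longrightarrow> b * \<rho> \<in> kspan K (monomials t UNIV D1)" by blast
  have "(\<lambda>x. \<Prod>b\<in>B. R b x) \<in> polyfun K UNIV" by (intro polyfun_prod[OF K] PR(2))
  then obtain D2 where D2: "\<rho> \<in> kspan K (monomials t UNIV D2)"
    using polyfun_in_kspan[OF K, of "\<lambda>x. \<Prod>b\<in>B. R b x" UNIV t] unfolding \<rho>_def by blast
  define E where "E = max D1 D2"
  have E: "\<And>b. b \<in> B \<Longrightarrow> b * \<rho> \<in> kspan K (monomials t UNIV E)" "\<rho> \<in> kspan K (monomials t UNIV E)"
    unfolding E_def by (rule kspan_monomials_mono[OF K D1], assumption, simp)
      (rule kspan_monomials_mono[OF K D2], simp)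

  \<comment> \<open>Chosen so that \<open>M * D + M + 1 \<le> C * (N + 1)\<close> holds with
    \<open>M = card B * (N * E)\<close>, whatever \<open>N\<close> is.\<close>
  define C where "C = card B * E * (D + 1) + 1"
  obtain N where N: "d * (C * (N + 1)) ^ (CARD('v) - 1) < (N + 1) ^ card B"
    using power_dominates[OF _ card_B, of d C] by auto
  define A where "A = {\<alpha>. (\<forall>b\<in>B. \<alpha> b \<le> N) \<and> (\<forall>b. b \<notin> B \<longrightarrow> \<alpha> b = 0)}"
  have A: "bij_betw (\<lambda>\<alpha>. restrict \<alpha> B) A (B \<rightarrow>\<^sub>E {..N})"
  proof (rule bij_betwI[where g = "\<lambda>\<alpha> b. if b \<in> B then \<alpha> b else 0"])
    show "(\<lambda>\<alpha>. restrict \<alpha> B) \<in> A \<rightarrow> (B \<rightarrow>\<^sub>E {..N})" by (auto simp: A_def)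
    show "(\<lambda>\<alpha> b. if b \<in> B then \<alpha> b else 0) \<in> (B \<rightarrow>\<^sub>E {..N}) \<rightarrow> A"
      unfolding A_def by (rule Pi_I) (simp add: PiE_iff)
    show "(\<lambda>b. if b \<in> B then restrict \<alpha> B b else 0) = \<alpha>" if "\<alpha> \<in> A" for \<alpha>
      using that by (simp add: A_def fun_eq_iff)
    show "restrict (\<lambda>b. if b \<in> B then \<alpha> b else 0) B = \<alpha>" if "\<alpha> \<in> B \<rightarrow>\<^sub>E {..N}" for \<alpha>
      using that by (simp add: fun_eq_iff PiE_iff extensional_def restrict_def)
  qed
  have "finite (B \<rightarrow>\<^sub>E {..N})" using \<open>finite B\<close> by (intro finite_PiE) simp_all
  then have finA: "finite A" using bij_betw_finite[OF A] by simp
  have cardA: "card A = (N + 1) ^ card B"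
    using bij_betw_same_card[OF A] \<open>finite B\<close> by (simp add: card_PiE)
  define M where "M = card B * (N * E)"
  \<comment> \<open>One nonzero multiplier that brings all monomials in \<open>B\<close> with
    exponents up to \<open>N\<close> into the same span, so a relation between the multiples is a
    relation between the monomials.\<close>
  define \<Delta> where "\<Delta> = \<gamma> ^ M * \<rho> ^ (N * card B)"
  have "\<Delta> * (\<Prod>b\<in>B. b ^ \<alpha> b) \<in> kspan K (G (M * D + M))" if "\<alpha> \<in> A" for \<alpha>
  proof -
    have le: "\<alpha> b \<le> N" if "b \<in> B" for b using \<open>\<alpha> \<in> A\<close> that by (simp add: A_def)
    have "(b * \<rho>) ^ \<alpha> b * \<rho> ^ (N - \<alpha> b) \<in> kspan K (monomials t UNIV (N * E))" if "b \<in> B" for b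
    proof -
      have "(b * \<rho>) ^ \<alpha> b * \<rho> ^ (N - \<alpha> b) \<in> kspan K (monomials t UNIV (\<alpha> b * E + (N - \<alpha> b) * E))"
        by (intro kspan_monomials_mult[OF K] kspan_monomials_power[OF K] E that)
      moreover have "\<alpha> b * E + (N - \<alpha> b) * E = N * E"
        using le[OF that] by (simp flip: add_mult_distrib)
      ultimately show ?thesis by simp
    qed
    then have "(\<Prod>b\<in>B. (b * \<rho>) ^ \<alpha> b * \<rho> ^ (N - \<alpha> b)) \<in> kspan K (monomials t UNIV M)"
      unfolding M_def by (rule kspan_monomials_prod[OF K \<open>finite B\<close>])
    moreover have "(\<Prod>b\<in>B. (b * \<rho>) ^ \<alpha> b * \<rho> ^ (N - \<alpha> b)) = (\<Prod>b\<in>B. \<rho> ^ N * b ^ \<alpha> b)"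
    proof (intro prod.cong refl)
      fix b assume "b \<in> B"
      then have "\<rho> ^ \<alpha> b * \<rho> ^ (N - \<alpha> b) = \<rho> ^ N" using le by (simp flip: power_add)
      then show "(b * \<rho>) ^ \<alpha> b * \<rho> ^ (N - \<alpha> b) = \<rho> ^ N * b ^ \<alpha> b"
        by (simp add: power_mult_distrib mult_ac)
    qed
    moreover have "(\<Prod>b\<in>B. \<rho> ^ N * b ^ \<alpha> b) = \<rho> ^ (N * card B) * (\<Prod>b\<in>B. b ^ \<alpha> b)"
      by (simp add: prod.distrib power_mult)
    ultimately have "\<rho> ^ (N * card B) * (\<Prod>b\<in>B. b ^ \<alpha> b) \<in> kspan K (monomials t UNIV M)" by simp
    from kspan_least[OF K this monG] show ?thesis unfolding \<Delta>_def by (simp add: mult.assoc)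
  qed
  moreover have "card (G (M * D + M)) < card A"
  proof -
    have "M * D + M + 1 = card B * E * (D + 1) * N + 1" by (simp add: M_def algebra_simps)
    also have "\<dots> \<le> C * (N + 1)" by (simp add: C_def algebra_simps)
    finally have le: "(M * D + M + 1) ^ (CARD('v) - 1) * d \<le> (C * (N + 1)) ^ (CARD('v) - 1) * d"
      by (intro mult_right_mono power_mono) simp_all
    have "(C * (N + 1)) ^ (CARD('v) - 1) * d < (N + 1) ^ card B" using N by (simp only: mult.commute)
    from le_less_trans[OF order_trans[OF cardG le] this] show ?thesis unfolding cardA .
  qed
  ultimately obtain a where a: "\<forall>\<alpha>\<in>A. a \<alpha> \<in> K" "\<exists>\<alpha>\<in>A. a \<alpha> \<noteq> 0"
      "(\<Sum>\<alpha>\<in>A. a \<alpha> * (\<Delta> * (\<Prod>b\<in>B. b ^ \<alpha> b))) = 0"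
    using kspan_dependent[OF K finA finG, of "M * D + M" "\<lambda>\<alpha>. \<Delta> * (\<Prod>b\<in>B. b ^ \<alpha> b)"] by blast
  have "\<Delta> * (\<Sum>\<alpha>\<in>A. a \<alpha> * (\<Prod>b\<in>B. b ^ \<alpha> b)) = 0"
    using a(3) by (simp add: sum_distrib_left mult.left_commute)
  then have zero: "(\<Sum>\<alpha>\<in>A. a \<alpha> * (\<Prod>b\<in>B. b ^ \<alpha> b)) = 0"
    using \<gamma> \<rho> by (simp add: \<Delta>_def)
  have "a \<alpha> = 0" if "\<alpha> \<in> A" for \<alpha>
  proof (rule algebraically_independent_lincomb[OF ind K finA \<open>finite B\<close> _ _ zero that])
    show "\<beta> x = 0" if "\<beta> \<in> A" "x \<notin> B" for \<beta> x using that by (simp add: A_def)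
    show "a \<beta> \<in> K" if "\<beta> \<in> A" for \<beta> using that a(1) by simp
  qed
  with a(2) show False by blast
qed

text \<open>Induction on the variables: with the others held fixed, the terms with a given exponent
  of \<open>w\<close> form one coefficient of a univariate polynomial that vanishes
  everywhere.\<close>

lemma polynomial_coeffs_zero:
  fixes c :: "('v::finite \<Rightarrow> nat) \<Rightarrow> real"
  assumes "finite W" "finite A" "\<And>\<alpha> v. \<alpha> \<in> A \<Longrightarrow> v \<notin> W \<Longrightarrow> \<alpha> v = 0"
    and "\<And>x :: real^'v. (\<Sum>\<alpha>\<in>A. c \<alpha> * (\<Prod>v\<in>W. (x $ v) ^ \<alpha> v)) = 0" "\<alpha> \<in> A"
  shows "c \<alpha> = 0"
  using assms
proof (induction W arbitrary: A c \<alpha> rule: finite_induct)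
  case empty
  have "\<beta> = \<alpha>" if "\<beta> \<in> A" for \<beta>
    using empty.prems(2)[OF that] empty.prems(2)[OF empty.prems(4)] by (intro ext) simp
  then have "A = {\<alpha>}" using empty.prems(4) by blast
  then show ?case using empty.prems(3) by simp
next
  case (insert w W)
  define j where "j = \<alpha> w"
  define A' where "A' = {\<beta> \<in> A. \<beta> w = j}"
  have "(\<Sum>\<beta>\<in>A'. c \<beta> * (\<Prod>v\<in>W. (x $ v) ^ \<beta> v)) = 0" for x :: "real^'v"
  proof -
    define q where "q = (\<Sum>\<beta>\<in>A. Polynomial.monom (c \<beta> * (\<Prod>v\<in>W. (x $ v) ^ \<beta> v)) (\<beta> w))"
    have "poly q s = 0" for s
    proof -
      define y :: "real^'v" where "y = (\<chi> v. if v = w then s else x $ v)"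
      have "(\<Prod>v\<in>W. (y $ v) ^ \<beta> v) = (\<Prod>v\<in>W. (x $ v) ^ \<beta> v)" for \<beta>
        using insert.hyps(2) by (intro prod.cong refl) (auto simp: y_def)
      then have "(\<Prod>v\<in>insert w W. (y $ v) ^ \<beta> v) = s ^ \<beta> w * (\<Prod>v\<in>W. (x $ v) ^ \<beta> v)" for \<beta>
        using insert.hyps by (simp add: y_def)
      then have "poly q s = (\<Sum>\<beta>\<in>A. c \<beta> * (\<Prod>v\<in>insert w W. (y $ v) ^ \<beta> v))"
        unfolding q_def poly_sum poly_monom by (intro sum.cong refl) simp
      then show ?thesis using insert.prems(3) by simp
    qed
    then have "q = 0" using poly_all_0_iff_0[of q] by simp
    then have "0 = Polynomial.coeff q j" by simp
    also have "\<dots> = (\<Sum>\<beta>\<in>A. if \<beta> w = j then c \<beta> * (\<Prod>v\<in>W. (x $ v) ^ \<beta> v) else 0)"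
      unfolding q_def by (simp add: Polynomial.coeff_sum Polynomial.coeff_monom)
    also have "\<dots> = (\<Sum>\<beta>\<in>A'. c \<beta> * (\<Prod>v\<in>W. (x $ v) ^ \<beta> v))"
      unfolding A'_def using insert.prems(1) by (simp add: sum.inter_filter)
    finally show ?thesis by simp
  qed
  \<comment> \<open>The exponent of \<open>w\<close> is erased from the index, so that the induction
    hypothesis for \<open>W\<close> applies; setting it back to \<open>j\<close> recovers the
    term.\<close>
  moreover have "(\<Sum>\<beta>\<in>A'. c \<beta> * (\<Prod>v\<in>W. (x $ v) ^ \<beta> v)) =
      (\<Sum>\<beta>\<in>(\<lambda>\<beta>. \<beta>(w := 0)) ` A'. c (\<beta>(w := j)) * (\<Prod>v\<in>W. (x $ v) ^ \<beta> v))" for x :: "real^'v"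
  proof (subst sum.reindex)
    have restore: "(\<beta>(w := 0))(w := j) = \<beta>" if "\<beta> \<in> A'" for \<beta> using that by (auto simp: A'_def)
    show "inj_on (\<lambda>\<beta>. \<beta>(w := 0)) A'" 
      by (rule inj_on_inverseI[where g = "\<lambda>\<beta>. \<beta>(w := j)"]) (rule restore)
    have "(\<Prod>v\<in>W. (x $ v) ^ (\<beta>(w := 0)) v) = (\<Prod>v\<in>W. (x $ v) ^ \<beta> v)" for \<beta>
      using insert.hyps(2) by (intro prod.cong refl) auto
    then show "(\<Sum>\<beta>\<in>A'. c \<beta> * (\<Prod>v\<in>W. (x $ v) ^ \<beta> v)) =
        sum ((\<lambda>\<beta>. c (\<beta>(w := j)) * (\<Prod>v\<in>W. (x $ v) ^ \<beta> v)) \<circ> (\<lambda>\<beta>. \<beta>(w := 0))) A'"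
      using restore by (intro sum.cong refl) (simp del: fun_upd_upd)
  qed
  ultimately have zero: "(\<Sum>\<beta>\<in>(\<lambda>\<beta>. \<beta>(w := 0)) ` A'. c (\<beta>(w := j)) * (\<Prod>v\<in>W. (x $ v) ^ \<beta> v)) = 0"
    for x :: "real^'v" by simp
  have "c ((\<alpha>(w := 0))(w := j)) = 0"
  proof (rule insert.IH[OF _ _ zero])
    show "finite ((\<lambda>\<beta>. \<beta>(w := 0)) ` A')" using insert.prems(1) by (simp add: A'_def)
    show "\<beta> v = 0" if "\<beta> \<in> (\<lambda>\<beta>. \<beta>(w := 0)) ` A'" "v \<notin> W" for \<beta> v
      using that insert.prems(2) by (cases "v = w") (auto simp: A'_def)
    show "\<alpha>(w := 0) \<in> (\<lambda>\<beta>. \<beta>(w := 0)) ` A'"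
      using insert.prems(4) by (intro imageI) (simp add: A'_def j_def)
  qed
  then show ?case by (simp add: j_def)
qed

text \<open>Distinctness gives the set of coordinates \<open>CARD('v)\<close> elements, as a
  transcendence basis of that degree must have.\<close>

lemma generic_point_inj:
  fixes t :: "real^'v"
  assumes "is_subfield K" "generic_point K t"
  shows "inj (\<lambda>v. t $ v)"
proof (rule injI, rule ccontr)
  fix u v assume "t $ u = t $ v" "u \<noteq> v"
  have "(\<lambda>x. x $ u - x $ v) \<in> polyfun K UNIV"
    by (intro polyfun_diff[OF assms(1)] polyfun.coord) simp_all
  then have "(\<lambda>x::real^'v. x $ u - x $ v) = (\<lambda>_. 0)"
    using assms(2) \<open>t $ u = t $ v\<close> unfolding generic_point_def by simp
  from fun_cong[OF this, of "axis u 1"] show False using \<open>u \<noteq> v\<close> by (simp add: axis_def)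
qed

text \<open>Exponents indexed by the values \<open>t $ v\<close> are moved to the indices
  \<open>v\<close>, which loses nothing because the coordinates are distinct.\<close>

lemma algebraically_independent_coordinates:
  fixes t :: "real^'v"
  assumes K: "is_subfield K" and gen: "generic_point K t"
  shows "algebraically_independent K (range (\<lambda>v. t $ v))"
proof (rule algebraically_independentI)
  fix A c \<alpha>
  assume A: "finite A" and supp: "\<And>\<alpha> x. \<alpha> \<in> A \<Longrightarrow> x \<notin> range (($) t) \<Longrightarrow> \<alpha> x = 0"
    and c: "\<And>\<alpha>. \<alpha> \<in> A \<Longrightarrow> c \<alpha> \<in> K"
    and zero: "(\<Sum>\<alpha>\<in>A. c \<alpha> * (\<Prod>b\<in>range (($) t). b ^ \<alpha> b)) = 0" and "\<alpha> \<in> A"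
  note inj = generic_point_inj[OF K gen]
  define f where "f x = (\<Sum>\<alpha>\<in>A. c \<alpha> * (\<Prod>v\<in>UNIV. (x $ v) ^ \<alpha> (t $ v)))" for x :: "real^'v"
  have "f \<in> polyfun K UNIV"
    unfolding f_def[abs_def]
    by (intro polyfun_sum[OF K] polyfun.mult polyfun.const c polyfun_prod[OF K] polyfun_power[OF K] polyfun.coord) simp_all
  moreover have "f t = 0"
    unfolding f_def zero[symmetric] by (simp add: prod.reindex[OF inj])
  ultimately have "f = (\<lambda>_. 0)" using gen unfolding generic_point_def by blast
  define e where "e \<alpha> = (\<lambda>v. \<alpha> (t $ v))" for \<alpha> :: "real \<Rightarrow> nat"
  have e: "inj_on e A"
  proof (rule inj_onI, rule ext)
    fix \<alpha> \<beta> x assume "\<alpha> \<in> A" "\<beta> \<in> A" "e \<alpha> = e \<beta>"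
    have "\<alpha> (t $ v) = \<beta> (t $ v)" for v using fun_cong[OF \<open>e \<alpha> = e \<beta>\<close>, of v] by (simp add: e_def)
    then show "\<alpha> x = \<beta> x"
      using supp[OF \<open>\<alpha> \<in> A\<close>, of x] supp[OF \<open>\<beta> \<in> A\<close>, of x]
      by (cases "x \<in> range (($) t)") auto
  qed
  have "c (the_inv_into A e (e \<alpha>)) = 0"
  proof (rule polynomial_coeffs_zero[of UNIV "e ` A"])
    show "(\<Sum>\<beta>\<in>e ` A. c (the_inv_into A e \<beta>) * (\<Prod>v\<in>UNIV. (x $ v) ^ \<beta> v)) = 0" for x :: "real^'v"
      using fun_cong[OF \<open>f = (\<lambda>_. 0)\<close>, of x]
      by (simp add: sum.reindex[OF e] the_inv_into_f_f[OF e]) (simp add: f_def e_def)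
  qed (use A \<open>\<alpha> \<in> A\<close> in simp_all)
  then show "c \<alpha> = 0" using \<open>\<alpha> \<in> A\<close> by (simp add: the_inv_into_f_f[OF e])
qed simp

text \<open>The values at \<open>t\<close> of rational functions over \<open>K\<close>. The
  denominator is only required not to vanish at \<open>t\<close>, so these values form a field
  whether or not \<open>t\<close> is generic.\<close>

definition rational_in :: "real set \<Rightarrow> real^'v \<Rightarrow> real \<Rightarrow> bool" where
  "rational_in K t b \<longleftrightarrow> (\<exists>P\<in>polyfun K UNIV. \<exists>R\<in>polyfun K UNIV. R t \<noteq> 0 \<and> b = P t / R t)"

lemma rational_in_polyfun:
  assumes "is_subfield K" "f \<in> polyfun K UNIV"
  shows "rational_in K t (f t)"
  unfolding rational_in_def
  by (rule bexI[OF _ assms(2)], rule bexI[OF _ polyfun.const[OF is_subfieldD(2)[OF assms(1)]]]) simp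

lemma is_subfield_rational_in:
  assumes K: "is_subfield K"
  shows "is_subfield {b. rational_in K t b}"
proof -
  have const: "rational_in K t c" if "c \<in> K" for c
    using rational_in_polyfun[OF K polyfun.const[OF that]] .
  have "rational_in K t (x + y)" "rational_in K t (x * y)" if x: "rational_in K t x" and y: "rational_in K t y" for x y
  proof -
    from x y obtain P R P' R' where *: "P \<in> polyfun K UNIV" "R \<in> polyfun K UNIV" "R t \<noteq> 0" "x = P t / R t"
      "P' \<in> polyfun K UNIV" "R' \<in> polyfun K UNIV" "R' t \<noteq> 0" "y = P' t / R' t"
      unfolding rational_in_def by (elim bexE conjE)
    have R: "(\<lambda>x. R x * R' x) \<in> polyfun K UNIV" using * by (intro polyfun.mult)
    have "(\<lambda>x. P x * R' x + P' x * R x) \<in> polyfun K UNIV" using * by (intro polyfun.add polyfun.mult)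
    then show "rational_in K t (x + y)" unfolding rational_in_def
      by (rule bexI[rotated], intro bexI[OF _ R]) (use * in \<open>simp add: field_simps\<close>)
    have "(\<lambda>x. P x * P' x) \<in> polyfun K UNIV" using * by (intro polyfun.mult)
    then show "rational_in K t (x * y)" unfolding rational_in_def
      by (rule bexI[rotated], intro bexI[OF _ R]) (use * in simp)
  qed
  moreover have "rational_in K t (- x)" "rational_in K t (inverse x)" if x: "rational_in K t x" for x
  proof -
    from x obtain P R where *: "P \<in> polyfun K UNIV" "R \<in> polyfun K UNIV" "R t \<noteq> 0" "x = P t / R t"
      unfolding rational_in_def by (elim bexE conjE)
    show "rational_in K t (- x)" unfolding rational_in_def
      by (rule bexI[OF _ polyfun_minus[OF K *(1)]], rule bexI[OF _ *(2)]) (use * in simp)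
    show "rational_in K t (inverse x)"
    proof (cases "P t = 0")
      case True
      then show ?thesis using * const[OF is_subfieldD(1)[OF K]] by simp
    next
      case False
      then show ?thesis unfolding rational_in_def
        by (intro bexI[OF _ *(2)] bexI[OF _ *(1)]) (use * in simp)
    qed
  qed
  ultimately show ?thesis
    using const[OF is_subfieldD(1)[OF K]] const[OF is_subfieldD(2)[OF K]] unfolding is_subfield_def by simp
qed

text \<open>Otherwise \<open>F\<close> would consist of rational expressions in a point with a
  polynomial relation, where the counting bound forbids \<open>CARD('v)\<close> independent
  elements.\<close>

lemma generic_point_if_transcendence_degree:
  fixes t :: "real^'v"
  assumes K: "is_subfield K" and "has_transcendence_degree K F CARD('v)"
    and rat: "\<And>b. b \<in> F \<Longrightarrow> rational_in K t b"
  shows "generic_point K t"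
proof (rule ccontr)
  assume not_gen: "\<not> generic_point K t"
  obtain B where "transcendence_basis K F B" and B: "finite B" "card B = CARD('v)"
    using assms(2) unfolding has_transcendence_degree_def by blast
  then have BF: "B \<subseteq> F" and ind: "algebraically_independent K B" unfolding transcendence_basis_def by simp_all
  have "card B < CARD('v)"
    by (rule card_algebraically_independent_less[OF K not_gen B(1) ind])
      (use rat BF in \<open>auto simp: rational_in_def\<close>)
  then show False using B(2) by simp
qed

lemma polyfun_extend_option:
  fixes f :: "real^'v \<Rightarrow> real"
  assumes "f \<in> polyfun K UNIV"
  shows "(\<lambda>x::real^('v option). f (\<chi> v. x $ Some v)) \<in> polyfun K UNIV"
  using assms
proof induction
  case (coord v)
  show ?case by (simp add: polyfun.coord)
qed (simp_all add: polyfun.const polyfun.add polyfun.mult)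

text \<open>The coordinates themselves are a transcendence basis. For maximality, append
  \<open>y = P t / R t\<close> as a further coordinate: the longer point satisfies
  \<open>R t * y = P t\<close>, and the counting bound with one more variable forbids
  independence.\<close>

lemma transcendence_degree_if_generic_point:
  fixes t :: "real^'v"
  assumes K: "is_subfield K" and gen: "generic_point K t"
    and coords: "\<And>v. t $ v \<in> F" and rat: "\<And>b. b \<in> F \<Longrightarrow> rational_in K t b"
  shows "has_transcendence_degree K F CARD('v)"
proof -
  define B where "B = range (\<lambda>v. t $ v)"
  have ind: "algebraically_independent K B"
    unfolding B_def by (rule algebraically_independent_coordinates[OF K gen])
  have cardB: "card B = CARD('v)" unfolding B_def by (rule card_image[OF generic_point_inj[OF K gen]])
  have "B' = B" if B': "B \<subseteq> B'" "B' \<subseteq> F" "algebraically_independent K B'" for B'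
  proof (rule ccontr)
    assume "B' \<noteq> B"
    then obtain y where y: "y \<in> B'" "y \<notin> B" using B'(1) by blast
    have ind': "algebraically_independent K (insert y B)"
      unfolding algebraically_independent_def
    proof (intro allI impI)
      fix P assume P: "(\<forall>m. Poly_Mapping.lookup P m \<in> K) \<and>
        (\<forall>m\<in>Poly_Mapping.keys P. Poly_Mapping.keys m \<subseteq> insert y B) \<and> poly_value P = 0"
      then have "\<forall>m\<in>Poly_Mapping.keys P. Poly_Mapping.keys m \<subseteq> B'" using y(1) B'(1) by blast
      with P B'(3) show "P = 0" unfolding algebraically_independent_def by blast
    qed
    have "rational_in K t y" using rat y(1) B'(2) by blast
    then obtain P R where PR: "P \<in> polyfun K UNIV" "R \<in> polyfun K UNIV" "R t \<noteq> 0" "y = P t / R t"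
      unfolding rational_in_def by (elim bexE conjE)
    define t' :: "real^('v option)" where "t' = (\<chi> i. case i of None \<Rightarrow> y | Some v \<Rightarrow> t $ v)"
    have t': "(\<chi> v. t' $ Some v) = t" by (simp add: t'_def Finite_Cartesian_Product.vec_eq_iff)
    define g where "g x = R (\<chi> v. x $ Some v) * x $ None - P (\<chi> v. x $ Some v)" for x :: "real^('v option)"
    have g: "g \<in> polyfun K UNIV"
      unfolding g_def[abs_def]
      by (intro polyfun_diff[OF K] polyfun.mult polyfun_extend_option PR polyfun.coord) simp
    have "g t' = 0" unfolding g_def t' using PR(3,4) by (simp add: t'_def)
    \<comment> \<open>With the other coordinates fixed at \<open>t\<close>, \<open>g\<close> is
      affine in the new one with slope \<open>R t \<noteq> 0\<close>.\<close>
    moreover have "g \<noteq> (\<lambda>_. 0)"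
    proof
      assume "g = (\<lambda>_. 0)"
      define z :: "real \<Rightarrow> real^('v option)" where "z s = (\<chi> i. case i of None \<Rightarrow> s | Some v \<Rightarrow> t $ v)" for s
      have "(\<chi> v. z s $ Some v) = t" for s by (simp add: z_def Finite_Cartesian_Product.vec_eq_iff)
      then have "R t * s - P t = 0" for s
        using fun_cong[OF \<open>g = (\<lambda>_. 0)\<close>, of "z s"] by (simp add: g_def z_def)
      from this[of 0] this[of 1] PR(3) show False by simp
    qed
    ultimately have not_gen: "\<not> generic_point K t'" using g unfolding generic_point_def by blast
    have coord': "rational_in K t' (t' $ i)" for i
      by (rule rational_in_polyfun[OF K polyfun.coord]) simp
    have "card (insert y B) < CARD('v option)"
    proof (rule card_algebraically_independent_less[OF K not_gen _ ind'])
      show "finite (insert y B)" by (simp add: B_def)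
      fix b assume "b \<in> insert y B"
      then have "b = t' $ None \<or> (\<exists>v. b = t' $ Some v)" by (auto simp: B_def t'_def)
      then have "rational_in K t' b" using coord' by blast
      then show "\<exists>P\<in>polyfun K UNIV. \<exists>R\<in>polyfun K UNIV. R t' \<noteq> 0 \<and> b = P t' / R t'"
        unfolding rational_in_def .
    qed
    moreover have "card (insert y B) = Suc CARD('v)" using y(2) cardB by (simp add: B_def)
    ultimately show False by simp
  qed
  moreover have "B \<subseteq> F" "finite B" using coords by (auto simp: B_def)
  ultimately have "transcendence_basis K F B"
    unfolding transcendence_basis_def using ind by blast
  then show ?thesis
    unfolding has_transcendence_degree_def using \<open>finite B\<close> cardB by blast
qed

section \<open>Rational parametrizations of lines\<close>

lemma is_line_range:
  assumes "is_line S"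
  obtains a u where "u \<noteq> 0" "S = range (\<lambda>s. a + s *\<^sub>R u)"
proof -
  have S: "affine S" "aff_dim S = 1" using assms unfolding is_line_def by simp_all
  then have "S \<noteq> {}" by auto
  then obtain a where a: "a \<in> S" by blast
  define U where "U = (\<lambda>x. x - a) ` S"
  have U_eq: "U = (\<lambda>x. - a + x) ` S" unfolding U_def by (intro image_cong) simp_all
  have "subspace U" unfolding U_eq by (rule affine_diffs_subspace[OF S(1) a])
  have "dim U = 1" using aff_dim_dim_affine_diffs[OF S(1) a] S(2) unfolding U_def by simp
  obtain B where B: "B \<subseteq> U" "independent B" "span B = U" "card B = dim U"
    by (rule basis_subspace_exists[OF \<open>subspace U\<close>])
  then obtain u where u: "B = {u}" using \<open>dim U = 1\<close> by (metis card_1_singletonE)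
  have "u \<noteq> 0" using B(2) unfolding u by (metis dependent_zero insertI1)
  have "U = range (\<lambda>s. s *\<^sub>R u)" using B(3) unfolding u span_singleton by simp
  have "S = range (\<lambda>s. a + s *\<^sub>R u)"
  proof
    show "S \<subseteq> range (\<lambda>s. a + s *\<^sub>R u)"
    proof
      fix x assume "x \<in> S"
      then have "x - a \<in> range (\<lambda>s. s *\<^sub>R u)" using \<open>U = range _\<close> unfolding U_def by blast
      then obtain s where "x - a = s *\<^sub>R u" by blast
      then have "x = a + s *\<^sub>R u" by (simp add: algebra_simps)
      then show "x \<in> range (\<lambda>s. a + s *\<^sub>R u)" by blast
    qed
    show "range (\<lambda>s. a + s *\<^sub>R u) \<subseteq> S"
    proof
      fix x assume "x \<in> range (\<lambda>s. a + s *\<^sub>R u)"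
      then obtain s where s: "x = a + s *\<^sub>R u" by blast
      have "s *\<^sub>R u \<in> U" unfolding \<open>U = range _\<close> by blast
      then obtain y where "y \<in> S" "s *\<^sub>R u = y - a" unfolding U_def by blast
      then show "x \<in> S" unfolding s by simp
    qed
  qed
  with \<open>u \<noteq> 0\<close> show thesis by (rule that)
qed

text \<open>Orthogonal decomposition of \<open>x - a\<close> along \<open>u\<close>; it turns the
  parametric form into linear equations, one for each normal vector.\<close>

lemma mem_line_iff_orthogonal:
  fixes u :: "'a::euclidean_space"
  assumes "u \<noteq> 0"
  shows "x \<in> range (\<lambda>s. a + s *\<^sub>R u) \<longleftrightarrow> (\<forall>y. u \<bullet> y = 0 \<longrightarrow> y \<bullet> x = y \<bullet> a)"
proof
  assume "x \<in> range (\<lambda>s. a + s *\<^sub>R u)"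
  then show "\<forall>y. u \<bullet> y = 0 \<longrightarrow> y \<bullet> x = y \<bullet> a" by (auto simp: inner_add_right inner_commute)
next
  assume R: "\<forall>y. u \<bullet> y = 0 \<longrightarrow> y \<bullet> x = y \<bullet> a"
  define s where "s = ((x - a) \<bullet> u) / (u \<bullet> u)"
  define z where "z = x - a - s *\<^sub>R u"
  have uz: "u \<bullet> z = 0" using assms unfolding z_def s_def by (simp add: inner_diff_right inner_commute)
  then have "z \<bullet> x = z \<bullet> a" using R by blast
  then have "z \<bullet> z = 0" using uz
    unfolding arg_cong[OF z_def, of "(\<bullet>) z"] by (simp add: inner_diff_right inner_commute[of z u])
  then have "z = 0" by simp
  then have "x = a + s *\<^sub>R u" unfolding z_def by (simp add: algebra_simps)
  then show "x \<in> range (\<lambda>s. a + s *\<^sub>R u)" by blast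
qed

section \<open>Standard equations and parametrizations over the coefficient field\<close>

definition coord_index :: "nat \<Rightarrow> 'n::{finite,linorder}" where
  "coord_index j = sorted_list_of_set (UNIV :: 'n set) ! j"

lemma coord_eq: "coord x j = x $ coord_index j"
  by (simp add: coord_def coord_index_def)

lemma bij_betw_coord_index: "bij_betw coord_index {..<CARD('n)} (UNIV :: 'n::{finite,linorder} set)"
proof -
  let ?l = "sorted_list_of_set (UNIV :: 'n set)"
  have "bij_betw ((!) ?l) {..<length ?l} (set ?l)" by (rule bij_betw_nth) simp_all
  then show ?thesis by (simp add: coord_index_def[abs_def])
qed

lemma sum_coord:
  fixes x :: "real^('n::{finite,linorder})"
  shows "(\<Sum>j<CARD('n). f (coord_index j) * coord x j) = (\<Sum>i\<in>UNIV. f i * x $ i)"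
  unfolding coord_eq by (rule sum.reindex_bij_betw[OF bij_betw_coord_index, of "\<lambda>i. f i * x $ i"])

text \<open>A basis of the hyperplane orthogonal to the direction gives \<open>CARD('n) - 1\<close>
  equations for the line; Gauss-Jordan elimination keeps their solutions and reaches the reduced
  form.\<close>

lemma standard_equation_exists:
  fixes S :: "(real^('n::{finite,linorder})) set"
  assumes "is_line S"
  shows "is_standard_equation S (standard_equation S)"
proof -
  let ?n = "CARD('n)"
  obtain a u where u: "u \<noteq> 0" "S = range (\<lambda>s. a + s *\<^sub>R u)" by (rule is_line_range[OF assms])
  define U where "U = {y. u \<bullet> y = 0}"
  have "dim U = ?n - 1" unfolding U_def using dim_hyperplane[OF u(1)] by simp
  have "subspace U" unfolding U_def by (rule subspace_hyperplane)
  obtain B where B: "B \<subseteq> U" "independent B" "span B = U" "card B = dim U"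
    by (rule basis_subspace_exists[OF \<open>subspace U\<close>])
  have "finite B" using B(2) independent_bound by blast
  then obtain w where w: "bij_betw w {..<?n - 1} B"
    using B(4) \<open>dim U = ?n - 1\<close> by (metis bij_betw_from_nat_into_finite)
  have S: "x \<in> S \<longleftrightarrow> (\<forall>r<?n - 1. w r \<bullet> x = w r \<bullet> a)" for x
  proof -
    have "x \<in> S \<longleftrightarrow> (\<forall>y\<in>U. y \<bullet> x = y \<bullet> a)"
      unfolding u(2) mem_line_iff_orthogonal[OF u(1)] U_def by simp
    also have "\<dots> \<longleftrightarrow> (\<forall>y\<in>B. y \<bullet> x = y \<bullet> a)"
    proof
      assume *: "\<forall>y\<in>B. y \<bullet> x = y \<bullet> a"
      have "subspace {y. y \<bullet> x = y \<bullet> a}" by (simp add: subspace_def inner_add_left)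
      then have "span B \<subseteq> {y. y \<bullet> x = y \<bullet> a}" using * by (intro span_minimal) auto
      then show "\<forall>y\<in>U. y \<bullet> x = y \<bullet> a" using B(3) by auto
    qed (use B(1) in auto)
    also have "\<dots> \<longleftrightarrow> (\<forall>r<?n - 1. w r \<bullet> x = w r \<bullet> a)"
      unfolding bij_betw_imp_surj_on[OF w, symmetric] by auto
    finally show ?thesis .
  qed
  define M where "M = Matrix.mat (?n - 1) (?n + 1) (\<lambda>(r, j). if j < ?n then coord (w r) j else w r \<bullet> a)"
  define C where "C = gauss_jordan_single M"
  have M: "M \<in> carrier_mat (?n - 1) (?n + 1)" by (simp add: M_def)
  have C: "C \<in> carrier_mat (?n - 1) (?n + 1)" "row_echelon_form C"
    using gauss_jordan_single[OF M C_def[symmetric]] by simp_all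
  \<comment> \<open>The last entry \<open>-1\<close> makes the system of the augmented matrix
    homogeneous, so that invariance of the kernel under row operations applies.\<close>
  define v where "v x = Matrix.vec (?n + 1) (\<lambda>j. if j < ?n then coord x j else -1)" for x :: "(real, 'n) Finite_Cartesian_Product.vec"
  have v: "v x \<in> carrier_vec (?n + 1)" for x by (simp add: v_def)
  have iff: "N *\<^sub>v v x = 0\<^sub>v (?n - 1) \<longleftrightarrow>
      (\<forall>r<?n - 1. (\<Sum>j<?n. N $$ (r, j) * coord x j) = N $$ (r, ?n))"
    if "N \<in> carrier_mat (?n - 1) (?n + 1)" for N x
  proof -
    have "Matrix.vec_index (N *\<^sub>v v x) r = (\<Sum>j<?n. N $$ (r, j) * coord x j) - N $$ (r, ?n)"
      if "r < ?n - 1" for r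
      using that \<open>N \<in> _\<close> by (simp add: Matrix.scalar_prod_def v_def lessThan_atLeast0[symmetric])
    moreover have "N *\<^sub>v v x = 0\<^sub>v (?n - 1) \<longleftrightarrow> (\<forall>r<?n - 1. Matrix.vec_index (N *\<^sub>v v x) r = 0)"
      using that by (auto simp: Matrix.vec_eq_iff)
    ultimately show ?thesis by auto
  qed
  have "x \<in> S \<longleftrightarrow> (\<forall>r<?n - 1. (\<Sum>j<?n. C $$ (r, j) * coord x j) = C $$ (r, ?n))" for x
  proof -
    have "w r \<bullet> x = (\<Sum>j<?n. M $$ (r, j) * coord x j)" "w r \<bullet> a = M $$ (r, ?n)" if "r < ?n - 1" for r
    proof -
      have "(\<Sum>j<?n. M $$ (r, j) * coord x j) = (\<Sum>j<?n. w r $ coord_index j * coord x j)"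
        using that by (intro sum.cong refl) (simp add: M_def coord_eq)
      then show "w r \<bullet> x = (\<Sum>j<?n. M $$ (r, j) * coord x j)"
        unfolding sum_coord by (simp add: inner_vec_def)
      show "w r \<bullet> a = M $$ (r, ?n)" using that by (simp add: M_def)
    qed
    then have "x \<in> S \<longleftrightarrow> M *\<^sub>v v x = 0\<^sub>v (?n - 1)" unfolding S iff[OF M] by simp
    also have "\<dots> \<longleftrightarrow> C *\<^sub>v v x = 0\<^sub>v (?n - 1)"
      by (rule gauss_jordan_single(1)[OF M C_def[symmetric] v])
    finally show ?thesis unfolding iff[OF C(1)] .
  qed
  then have "is_standard_equation S C" unfolding is_standard_equation_def using C by blast
  then show ?thesis unfolding standard_equation_def by (rule someI)
qed

text \<open>The standard equation has coefficients in \<open>K\<close> and a real solution, hence a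
  solution in \<open>K\<close>. The same applies to the direction once one of its coordinates is
  normalised to \<open>1\<close>.\<close>

lemma line_rational_parametrization:
  fixes S :: "(real^('n::{finite,linorder})) set"
  assumes "is_line S" and K: "is_subfield K" and el: "elements_mat (standard_equation S) \<subseteq> K"
  obtains a u where "u \<noteq> 0" "\<And>i. a $ i \<in> K" "\<And>i. u $ i \<in> K"
    "S = range (\<lambda>s. a + s *\<^sub>R u)" "line_kernel S = range (\<lambda>s. s *\<^sub>R u)"
proof -
  let ?n = "CARD('n)"
  define M where "M = standard_equation S"
  have M: "M \<in> carrier_mat (?n - 1) (?n + 1)"
    and S: "S = {x. \<forall>r<?n - 1. (\<Sum>j<?n. M $$ (r, j) * coord x j) = M $$ (r, ?n)}"
    using standard_equation_exists[OF assms(1)] unfolding is_standard_equation_def M_def by simp_all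
  define pos where "pos = the_inv_into {..<?n} (coord_index :: nat \<Rightarrow> 'n)"
  have pos: "pos (coord_index j) = j" if "j < ?n" for j
    unfolding pos_def using that bij_betw_coord_index by (intro the_inv_into_f_f) (auto simp: bij_betw_def)
  have pos_less: "pos i < ?n" for i
  proof -
    have "i \<in> coord_index ` {..<?n}" using bij_betw_coord_index[where 'n = 'n] by (simp add: bij_betw_def)
    then obtain j where "j < ?n" "i = coord_index j" by auto
    then show ?thesis using pos by simp
  qed
  have sum: "(\<Sum>j<?n. M $$ (r, j) * coord x j) = (\<Sum>i\<in>UNIV. M $$ (r, pos i) * x $ i)" for r x
    unfolding sum_coord[of "\<lambda>i. M $$ (r, pos i)" x, symmetric]
    by (intro sum.cong refl) (simp add: pos)
  have entry: "M $$ (r, j) \<in> K" if "r < ?n - 1" "j < ?n + 1" for r j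
    using el elements_matI[OF M that refl] unfolding M_def[symmetric] by blast
  have entry': "M $$ (r, pos i) \<in> K" "M $$ (r, ?n) \<in> K" if "r < ?n - 1" for r i
    using entry[OF that, of "pos i"] entry[OF that, of ?n] pos_less[of i] by simp_all
  obtain a0 u0 where u0: "u0 \<noteq> 0" "S = range (\<lambda>s. a0 + s *\<^sub>R u0)" by (rule is_line_range[OF assms(1)])
  have "a0 \<in> S" unfolding u0(2) by (rule range_eqI[of _ _ 0]) simp
  have mem_S: "x \<in> S \<longleftrightarrow> (\<forall>r<?n - 1. (\<Sum>i\<in>UNIV. M $$ (r, pos i) * x $ i) = M $$ (r, ?n))" for x
    unfolding sum[symmetric] by (subst S) simp
  have mem_ker: "y \<in> line_kernel S \<longleftrightarrow> (\<forall>r<?n - 1. (\<Sum>i\<in>UNIV. M $$ (r, pos i) * y $ i) = 0)" for y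
    unfolding line_kernel_def M_def[symmetric] sum by simp
  have "\<exists>c. (\<forall>i\<in>UNIV. c i \<in> K) \<and> (\<forall>r\<in>{..<?n - 1}. (\<Sum>i\<in>UNIV. M $$ (r, pos i) * c i) = M $$ (r, ?n))"
  proof (rule linear_system_descends[OF K, of _ _ _ _ "\<lambda>i. a0 $ i"])
    show "(\<Sum>i\<in>UNIV. M $$ (r, pos i) * a0 $ i) = M $$ (r, ?n)" if "r \<in> {..<?n - 1}" for r
      using \<open>a0 \<in> S\<close> that unfolding mem_S by simp
  qed (use entry' in simp_all)
  then obtain c where c: "\<And>i. c i \<in> K" "\<And>r. r < ?n - 1 \<Longrightarrow> (\<Sum>i\<in>UNIV. M $$ (r, pos i) * c i) = M $$ (r, ?n)"
    by blast
  define a where "a = (\<chi> i. c i)"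
  have "a \<in> S" unfolding mem_S a_def using c(2) by simp
  have ker: "y \<in> line_kernel S \<longleftrightarrow> x + y \<in> S" if "x \<in> S" for x y
    using that unfolding mem_ker mem_S by (simp add: distrib_left sum.distrib)
  have ker0: "line_kernel S = range (\<lambda>s. s *\<^sub>R u0)"
    unfolding set_eq_iff ker[OF \<open>a0 \<in> S\<close>] unfolding u0(2) by auto
  obtain i0 where i0: "u0 $ i0 \<noteq> 0" using u0(1) by (metis Finite_Cartesian_Product.vec_eq_iff zero_index)
  define u1 where "u1 = (1 / u0 $ i0) *\<^sub>R u0"
  have "u1 \<in> line_kernel S" unfolding ker0 u1_def by blast
  \<comment> \<open>Row \<open>CARD('n) - 1\<close> is an extra equation that sets coordinate
    \<open>i0\<close> to \<open>1\<close>; it excludes the zero solution.\<close>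
  define eqn where "eqn r i = (if r < ?n - 1 then M $$ (r, pos i) else if i = i0 then 1 else 0)" for r i
  define rhs :: "nat \<Rightarrow> real" where "rhs r = (if r < ?n - 1 then 0 else 1)" for r
  have "\<exists>c. (\<forall>i\<in>UNIV. c i \<in> K) \<and> (\<forall>r\<in>{..?n - 1}. (\<Sum>i\<in>UNIV. eqn r i * c i) = rhs r)"
  proof (rule linear_system_descends[OF K, of _ _ _ _ "\<lambda>i. u1 $ i"])
    show "(\<Sum>i\<in>UNIV. eqn r i * u1 $ i) = rhs r" if "r \<in> {..?n - 1}" for r
    proof (cases "r < ?n - 1")
      case True
      then show ?thesis
        using \<open>u1 \<in> line_kernel S\<close> unfolding mem_ker by (simp add: eqn_def rhs_def)
    next
      case False
      then have "(\<Sum>i\<in>UNIV. eqn r i * u1 $ i) = u1 $ i0"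
        by (simp add: eqn_def if_distrib[of "\<lambda>x. x * _"] cong: if_cong)
      then show ?thesis using False i0 by (simp add: rhs_def u1_def)
    qed
  qed (use entry' is_subfieldD(1,2)[OF K] in \<open>simp_all add: eqn_def rhs_def\<close>)
  then obtain e where e: "\<And>i. e i \<in> K" "\<And>r. r \<le> ?n - 1 \<Longrightarrow> (\<Sum>i\<in>UNIV. eqn r i * e i) = rhs r" by blast
  define u where "u = (\<chi> i. e i)"
  have "e i0 = 1"
    using e(2)[of "?n - 1"] by (simp add: eqn_def rhs_def if_distrib[of "\<lambda>x. x * _"] cong: if_cong)
  then have "u \<noteq> 0" unfolding u_def by (metis vec_lambda_beta zero_index zero_neq_one)
  have "(\<Sum>i\<in>UNIV. M $$ (r, pos i) * u $ i) = 0" if "r < ?n - 1" for r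
    using e(2)[of r] that by (simp add: eqn_def rhs_def u_def)
  then have "u \<in> line_kernel S" unfolding mem_ker by simp
  then obtain s0 where s0: "u = s0 *\<^sub>R u0" unfolding ker0 by blast
  then have "s0 \<noteq> 0" using \<open>u \<noteq> 0\<close> by auto
  have ker1: "line_kernel S = range (\<lambda>s. s *\<^sub>R u)"
  proof -
    have "s *\<^sub>R u0 = (s / s0) *\<^sub>R u" for s unfolding s0 using \<open>s0 \<noteq> 0\<close> by simp
    then have "range (\<lambda>s. s *\<^sub>R u0) \<subseteq> range (\<lambda>s. s *\<^sub>R u)" by blast
    moreover have "s *\<^sub>R u = (s * s0) *\<^sub>R u0" for s unfolding s0 by simp
    then have "range (\<lambda>s. s *\<^sub>R u) \<subseteq> range (\<lambda>s. s *\<^sub>R u0)" by blast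
    ultimately show ?thesis unfolding ker0 by blast
  qed
  have "S = range (\<lambda>s. a + s *\<^sub>R u)"
  proof
    show "range (\<lambda>s. a + s *\<^sub>R u) \<subseteq> S" using ker[OF \<open>a \<in> S\<close>] ker1 by blast
    show "S \<subseteq> range (\<lambda>s. a + s *\<^sub>R u)"
    proof
      fix x assume "x \<in> S"
      then have "x - a \<in> line_kernel S" using ker[OF \<open>a \<in> S\<close>, of "x - a"] by simp
      then obtain s where "x - a = s *\<^sub>R u" unfolding ker1 by blast
      then have "x = a + s *\<^sub>R u" by (simp add: algebra_simps)
      then show "x \<in> range (\<lambda>s. a + s *\<^sub>R u)" by blast
    qed
  qed
  then show thesis
    by (intro that[OF \<open>u \<noteq> 0\<close> _ _ _ ker1]) (simp_all add: a_def u_def c(1) e(1))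
qed

section \<open>Pairs of lines and isometries\<close>

lemma real_isometry_affine:
  fixes f :: "real \<Rightarrow> real"
  assumes iso: "\<And>x y. \<bar>f x - f y\<bar> = \<bar>x - y\<bar>"
  obtains \<epsilon> where "\<epsilon> = 1 \<or> \<epsilon> = -1" "\<And>x. f x = f 0 + \<epsilon> * x"
proof -
  define \<epsilon> where "\<epsilon> = f 1 - f 0"
  have \<epsilon>: "\<epsilon> = 1 \<or> \<epsilon> = -1" using iso[of 1 0] unfolding \<epsilon>_def by linarith
  have "f x = f 0 + \<epsilon> * x" for x
  proof (cases "\<epsilon> = 1")
    case True
    then have "f 1 = f 0 + 1" by (simp add: \<epsilon>_def)
    then show ?thesis using iso[of x 0] iso[of x 1] unfolding True by arith
  next
    case False
    then have "\<epsilon> = -1" "f 1 = f 0 - 1" using \<epsilon> by (simp_all add: \<epsilon>_def)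
    then show ?thesis using iso[of x 0] iso[of x 1] by (simp only:)
  qed
  with \<epsilon> show ?thesis using that by blast
qed

text \<open>One parametrization over the coefficient field is fixed for all lines, so that whatever
  is computed from \<open>a\<close> and \<open>d\<close> by field operations lies in that
  field.\<close>

locale line_framework =
  fixes k :: nat and L :: "nat \<Rightarrow> ('n::{finite,linorder}) euclid set"
    and V :: "nat \<Rightarrow> 'v::finite set" and E :: "'v set set"
    and a d :: "nat \<Rightarrow> 'n euclid"
  assumes d_nz: "\<And>i. i \<in> {1..k} \<Longrightarrow> d i \<noteq> 0"
    and L_eq: "\<And>i. i \<in> {1..k} \<Longrightarrow> L i = range (\<lambda>s. a i + s *\<^sub>R d i)"
    and ker_eq: "\<And>i. i \<in> {1..k} \<Longrightarrow> line_kernel (L i) = range (\<lambda>s. s *\<^sub>R d i)"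
    and a_in: "\<And>i c. i \<in> {1..k} \<Longrightarrow> a i $ c \<in> lines_field (L ` {1..k})"
    and d_in: "\<And>i c. i \<in> {1..k} \<Longrightarrow> d i $ c \<in> lines_field (L ` {1..k})"
    and inj_L: "inj_on L {1..k}"
    and gen_pos: "general_position (L ` {1..k})"
    and simple: "simple_graph E"
    and partition: "partition_of_vertices k V"
    and cross: "crossing k V"
begin

abbreviation K where "K \<equiv> lines_field (L ` {1..k})"

lemma K_subfield: "is_subfield K"
  unfolding lines_field_def by (rule is_subfield_real_subfield)

lemma K_countable: "countable K"
  unfolding lines_field_def
proof (rule countable_real_subfield, rule countable_UN)
  show "countable (L ` {1..k})" by simp
  show "countable (elements_mat (standard_equation S))" for S :: "'n euclid set"
    unfolding elements_mat_def by simp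
qed

definition line_of :: "'v \<Rightarrow> nat" where
  "line_of v = (THE i. i \<in> {1..k} \<and> v \<in> V i)"

lemma line_of_unique: "i \<in> {1..k} \<Longrightarrow> v \<in> V i \<Longrightarrow> line_of v = i"
  unfolding line_of_def
proof (rule the_equality)
  fix j assume "j \<in> {1..k} \<and> v \<in> V j" and i: "i \<in> {1..k}" "v \<in> V i"
  then show "j = i" using partition unfolding partition_of_vertices_def disjoint_family_on_def by blast
qed simp

lemma line_of_in: "line_of v \<in> {1..k}" and line_of_mem: "v \<in> V (line_of v)"
proof -
  have "v \<in> (\<Union>i\<in>{1..k}. V i)" using partition unfolding partition_of_vertices_def by simp
  then obtain i where i: "i \<in> {1..k}" "v \<in> V i" by blast
  then show "line_of v \<in> {1..k}" "v \<in> V (line_of v)" using line_of_unique[OF i] by simp_all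
qed

lemma exists_other_line: "\<exists>w. line_of w \<noteq> i"
proof (rule ccontr)
  assume "\<nexists>w. line_of w \<noteq> i"
  then have all: "line_of w = i" for w by simp
  have "{j \<in> {1..k}. V j \<noteq> {}} \<subseteq> {i}"
  proof
    fix j assume "j \<in> {j \<in> {1..k}. V j \<noteq> {}}"
    then obtain w where "j \<in> {1..k}" "w \<in> V j" by blast
    then show "j \<in> {i}" using line_of_unique[of j w] all[of w] by simp
  qed
  then have "card {j \<in> {1..k}. V j \<noteq> {}} \<le> card {i}" by (intro card_mono) simp_all
  then show False using cross unfolding crossing_def by simp
qed

lemma lines_met_eq: "lines_met k L V W = L ` (line_of ` W)"
proof (rule subset_antisym; rule subsetI)
  fix S assume "S \<in> lines_met k L V W"
  then obtain i where S: "S = L i" "i \<in> {1..k}" "V i \<inter> W \<noteq> {}"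
    unfolding lines_met_def by (elim CollectE exE conjE)
  from S(3) obtain v where "v \<in> V i \<inter> W" unfolding ex_in_conv[symmetric] ..
  then have "v \<in> V i" "v \<in> W" by simp_all
  then show "S \<in> L ` (line_of ` W)" using line_of_unique[OF S(2)] S(1) by (intro image_eqI[of _ _ i]) auto
next
  fix S assume "S \<in> L ` (line_of ` W)"
  then obtain v where v: "S = L (line_of v)" "v \<in> W" unfolding image_image by (rule imageE)
  then have "V (line_of v) \<inter> W \<noteq> {}" using line_of_mem[of v] by (intro notI) (drule equals0D[of _ v], simp)
  then show "S \<in> lines_met k L V W"
    unfolding lines_met_def using v(1) line_of_in[of v] by (intro CollectI exI[of _ "line_of v"] conjI)
qed

lemma card_lines_met: "card (lines_met k L V W) = card (line_of ` W)"
  unfolding lines_met_eq by (intro card_image inj_on_subset[OF inj_L] image_subsetI line_of_in)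

lemma L_neq: "i \<in> {1..k} \<Longrightarrow> j \<in> {1..k} \<Longrightarrow> i \<noteq> j \<Longrightarrow> L i \<noteq> L j"
  using inj_onD[OF inj_L, of i j] by blast

lemma general_position_pair:
  assumes "i \<in> {1..k}" "j \<in> {1..k}" "i \<noteq> j"
  shows "\<not> affine_parallel (L i) (L j) \<and> \<not> perpendicular (L i) (L j)"
proof -
  have "L i \<noteq> L j" using inj_onD[OF inj_L _ assms(1,2)] assms(3) by blast
  moreover have "L i \<in> L ` {1..k}" "L j \<in> L ` {1..k}" using assms by blast+
  ultimately show ?thesis using gen_pos unfolding general_position_def by blast
qed

lemma not_parallel: "i \<in> {1..k} \<Longrightarrow> j \<in> {1..k} \<Longrightarrow> i \<noteq> j \<Longrightarrow> \<not> affine_parallel (L i) (L j)"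
  using general_position_pair by blast

lemma not_perpendicular: "i \<in> {1..k} \<Longrightarrow> j \<in> {1..k} \<Longrightarrow> i \<noteq> j \<Longrightarrow> \<not> perpendicular (L i) (L j)"
  using general_position_pair by blast

lemma inner_d_nz:
  assumes "i \<in> {1..k}" "j \<in> {1..k}"
  shows "d i \<bullet> d j \<noteq> 0"
proof (cases "i = j")
  case True
  then show ?thesis using d_nz[OF assms(1)] by simp
next
  case False
  show ?thesis
  proof
    assume "d i \<bullet> d j = 0"
    then have "perpendicular (L i) (L j)"
      unfolding perpendicular_def
    proof (intro ballI)
      fix x y z w assume "x \<in> L i" "y \<in> L i" "z \<in> L j" "w \<in> L j"
      then obtain s s' t t' where "x = a i + s *\<^sub>R d i" "y = a i + s' *\<^sub>R d i"
          "z = a j + t *\<^sub>R d j" "w = a j + t' *\<^sub>R d j"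
        unfolding L_eq[OF assms(1)] L_eq[OF assms(2)] by blast
      then have "x - y = (s - s') *\<^sub>R d i" "z - w = (t - t') *\<^sub>R d j" by (simp_all add: scaleR_diff_left)
      then show "(x - y) \<bullet> (z - w) = 0" using \<open>d i \<bullet> d j = 0\<close> by simp
    qed
    then show False using not_perpendicular[OF assms False] by simp
  qed
qed

text \<open>The Gram determinant of the two directions, positive exactly when they are linearly
  independent.\<close>

definition disc :: "nat \<Rightarrow> nat \<Rightarrow> real" where
  "disc i j = (d i \<bullet> d i) * (d j \<bullet> d j) - (d i \<bullet> d j)\<^sup>2"

text \<open>\<open>disc i j\<close> is \<open>d i \<bullet> d i\<close> times the squared length of
  the component \<open>z\<close> of \<open>d j\<close> orthogonal to \<open>d i\<close>. If
  \<open>z\<close> were zero, a translation would carry one line to the other.\<close>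

lemma disc_pos:
  assumes "i \<in> {1..k}" "j \<in> {1..k}" "i \<noteq> j"
  shows "disc i j > 0"
proof -
  define c where "c = (d i \<bullet> d j) / (d i \<bullet> d i)"
  define z where "z = d j - c *\<^sub>R d i"
  have ii: "d i \<bullet> d i > 0" using d_nz[OF assms(1)] by simp
  have "c \<noteq> 0" unfolding c_def using inner_d_nz[OF assms(1,2)] ii by simp
  have "z \<noteq> 0"
  proof
    assume "z = 0"
    then have dj: "d j = c *\<^sub>R d i" by (simp add: z_def)
    have "L j = (\<lambda>x. (a j - a i) + x) ` L i"
    proof
      show "L j \<subseteq> (\<lambda>x. (a j - a i) + x) ` L i"
      proof
        fix x assume "x \<in> L j"
        then obtain s where "x = a j + s *\<^sub>R d j" unfolding L_eq[OF assms(2)] by blast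
        then have "x = (a j - a i) + (a i + (s * c) *\<^sub>R d i)" by (simp add: dj)
        then show "x \<in> (\<lambda>x. (a j - a i) + x) ` L i" unfolding L_eq[OF assms(1)] by blast
      qed
      show "(\<lambda>x. (a j - a i) + x) ` L i \<subseteq> L j"
      proof
        fix x assume "x \<in> (\<lambda>x. (a j - a i) + x) ` L i"
        then obtain s where "x = (a j - a i) + (a i + s *\<^sub>R d i)" unfolding L_eq[OF assms(1)] by blast
        then have "x = a j + (s / c) *\<^sub>R d j" using \<open>c \<noteq> 0\<close> by (simp add: dj)
        then show "x \<in> L j" unfolding L_eq[OF assms(2)] by blast
      qed
    qed
    then have "affine_parallel (L i) (L j)" unfolding affine_parallel_def by blast
    then show False using not_parallel[OF assms] by simp
  qed
  then have "0 < z \<bullet> z" by simp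
  also have "z \<bullet> z = d j \<bullet> d j - c * (d i \<bullet> d j)"
  proof -
    have "z \<bullet> d i = 0" unfolding z_def c_def using ii by (simp add: inner_diff_left inner_commute[of "d j" "d i"])
    then have "z \<bullet> z = z \<bullet> d j" unfolding z_def by (simp add: inner_diff_right)
    then show ?thesis unfolding z_def by (simp add: inner_diff_left)
  qed
  finally have "0 < (d i \<bullet> d i) * (d j \<bullet> d j - c * (d i \<bullet> d j))" using ii by simp
  also have "\<dots> = disc i j" unfolding disc_def c_def using ii by (simp add: right_diff_distrib power2_eq_square)
  finally show ?thesis .
qed

lemma disc_commute: "disc i j = disc j i"
  by (simp add: disc_def inner_commute mult.commute)

text \<open>The parameter of the point of \<open>L i\<close> closest to \<open>L j\<close>, by Cramer's rule.\<close>

definition cen :: "nat \<Rightarrow> nat \<Rightarrow> real" where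
  "cen i j = ((d i \<bullet> d j) * ((a i - a j) \<bullet> d j) - (d j \<bullet> d j) * ((a i - a j) \<bullet> d i)) / disc i j"

text \<open>The squared norm of \<open>S *\<^sub>R d i - T *\<^sub>R d j\<close>.\<close>

definition qf :: "nat \<Rightarrow> nat \<Rightarrow> real \<Rightarrow> real \<Rightarrow> real" where
  "qf i j S T = (d i \<bullet> d i) * S\<^sup>2 - 2 * (d i \<bullet> d j) * S * T + (d j \<bullet> d j) * T\<^sup>2"

text \<open>The closest points are joined by the common perpendicular; multiplied by
  \<open>disc i j\<close>, this is the verification of Cramer's rule.\<close>

lemma cen_orthogonal:
  assumes "i \<in> {1..k}" "j \<in> {1..k}" "i \<noteq> j"
  defines "e \<equiv> (a i + cen i j *\<^sub>R d i) - (a j + cen j i *\<^sub>R d j)"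
  shows "e \<bullet> d i = 0" "e \<bullet> d j = 0"
proof -
  define p q where "p = (a i - a j) \<bullet> d i" and "q = (a i - a j) \<bullet> d j"
  have "disc i j \<noteq> 0" using disc_pos[OF assms(1-3)] by simp
  have ci: "cen i j * disc i j = (d i \<bullet> d j) * q - (d j \<bullet> d j) * p"
    unfolding cen_def p_def q_def using \<open>disc i j \<noteq> 0\<close> by simp
  have cj: "cen j i * disc i j = (d i \<bullet> d i) * q - (d i \<bullet> d j) * p"
    unfolding cen_def p_def q_def disc_commute[of j i] using \<open>disc i j \<noteq> 0\<close>
    by (simp add: inner_commute inner_diff_left algebra_simps)
  have e1: "e \<bullet> d i = p + cen i j * (d i \<bullet> d i) - cen j i * (d i \<bullet> d j)"
    unfolding e_def p_def by (simp add: inner_diff_left inner_add_left inner_commute[of "d j" "d i"])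
  have "(e \<bullet> d i) * disc i j = p * disc i j + (cen i j * disc i j) * (d i \<bullet> d i) - (cen j i * disc i j) * (d i \<bullet> d j)"
    unfolding e1 by (simp add: algebra_simps)
  also have "\<dots> = 0" unfolding ci cj unfolding disc_def by (simp add: algebra_simps power2_eq_square)
  finally show "e \<bullet> d i = 0" using \<open>disc i j \<noteq> 0\<close> by simp
  have e2: "e \<bullet> d j = q + cen i j * (d i \<bullet> d j) - cen j i * (d j \<bullet> d j)"
    unfolding e_def q_def by (simp add: inner_diff_left inner_add_left inner_commute[of "d j" "d i"])
  have "(e \<bullet> d j) * disc i j = q * disc i j + (cen i j * disc i j) * (d i \<bullet> d j) - (cen j i * disc i j) * (d j \<bullet> d j)"
    unfolding e2 by (simp add: algebra_simps)
  also have "\<dots> = 0" unfolding ci cj unfolding disc_def by (simp add: algebra_simps power2_eq_square)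
  finally show "e \<bullet> d j = 0" using \<open>disc i j \<noteq> 0\<close> by simp
qed

text \<open>As \<open>e\<close> is orthogonal to both directions, the squared distance has no linear
  terms when parameters are measured from the closest points. In particular it survives reflecting
  both parameters at once.\<close>

lemma cross_dist:
  assumes "i \<in> {1..k}" "j \<in> {1..k}" "i \<noteq> j"
  shows "(norm ((a i + s *\<^sub>R d i) - (a j + t *\<^sub>R d j)))\<^sup>2 =
    qf i j (s - cen i j) (t - cen j i) + (norm ((a i + cen i j *\<^sub>R d i) - (a j + cen j i *\<^sub>R d j)))\<^sup>2"
proof -
  define e where "e = (a i + cen i j *\<^sub>R d i) - (a j + cen j i *\<^sub>R d j)"
  have e: "e \<bullet> d i = 0" "e \<bullet> d j = 0" using cen_orthogonal[OF assms] unfolding e_def by simp_all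
  define S T where "S = s - cen i j" and "T = t - cen j i"
  have eq: "(a i + s *\<^sub>R d i) - (a j + t *\<^sub>R d j) = e + S *\<^sub>R d i - T *\<^sub>R d j"
    unfolding e_def S_def T_def by (simp add: algebra_simps)
  have "(norm (e + S *\<^sub>R d i - T *\<^sub>R d j))\<^sup>2 = qf i j S T + (norm e)\<^sup>2"
    unfolding power2_norm_eq_inner qf_def using e
    by (simp add: inner_diff_left inner_diff_right inner_add_left inner_add_right inner_commute[of "d i" e]
        inner_commute[of "d j" e] inner_commute[of "d j" "d i"] power2_eq_square algebra_simps)
  then show ?thesis unfolding eq unfolding e_def S_def T_def .
qed

lemma same_dist: "(norm ((a i + s *\<^sub>R d i) - (a i + t *\<^sub>R d i)))\<^sup>2 = (d i \<bullet> d i) * (s - t)\<^sup>2"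
proof -
  have "(a i + s *\<^sub>R d i) - (a i + t *\<^sub>R d i) = (s - t) *\<^sub>R d i" by (simp add: scaleR_diff_left)
  then show ?thesis by (simp add: power_mult_distrib dot_square_norm mult.commute)
qed

text \<open>Completing the square in \<open>T\<close>; it bounds a parameter in terms of the length
  of a single edge.\<close>

lemma qf_lower_bound:
  assumes "i \<in> {1..k}" "j \<in> {1..k}" "i \<noteq> j"
  shows "disc i j * S\<^sup>2 \<le> (d j \<bullet> d j) * qf i j S T"
proof -
  have "(d j \<bullet> d j) * qf i j S T = disc i j * S\<^sup>2 + ((d i \<bullet> d j) * S - (d j \<bullet> d j) * T)\<^sup>2"
    unfolding qf_def disc_def by (simp add: power2_eq_square algebra_simps)
  then show ?thesis by simp
qed

lemma qf_commute: "qf i j S T = qf j i T S"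
  by (simp add: qf_def inner_commute mult_ac)

lemma qf_minus: "qf i j (- S) (- T) = qf i j S T"
  by (simp add: qf_def)

lemma qf_nonneg:
  assumes "i \<in> {1..k}" "j \<in> {1..k}" "i \<noteq> j"
  shows "qf i j S T \<ge> 0"
proof -
  have "0 \<le> disc i j * S\<^sup>2" using disc_pos[OF assms] by simp
  also have "\<dots> \<le> (d j \<bullet> d j) * qf i j S T" by (rule qf_lower_bound[OF assms])
  finally have "0 \<le> (d j \<bullet> d j) * qf i j S T" .
  moreover have "0 < d j \<bullet> d j" using d_nz[OF assms(2)] by simp
  ultimately show ?thesis using mult_pos_neg[of "d j \<bullet> d j" "qf i j S T"] by linarith
qed

lemma qf_zero:
  assumes "i \<in> {1..k}" "j \<in> {1..k}" "i \<noteq> j" "qf i j S T = 0"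
  shows "S = 0"
  using qf_lower_bound[OF assms(1-3), of S T] assms(4) disc_pos[OF assms(1-3)]
  by (simp add: mult_le_0_iff)

lemma closest_in_cen:
  assumes "i \<in> {1..k}" "j \<in> {1..k}" "i \<noteq> j"
  shows "closest_in (L i) (L j) (a i + cen i j *\<^sub>R d i)"
proof -
  let ?x = "a i + cen i j *\<^sub>R d i" and ?z = "a j + cen j i *\<^sub>R d j"
  have x: "?x \<in> L i" and z: "?z \<in> L j" unfolding L_eq[OF assms(1)] L_eq[OF assms(2)] by blast+
  have "infdist ?x (L j) \<le> infdist y (L j)" if "y \<in> L i" for y
  proof -
    from that obtain s where y: "y = a i + s *\<^sub>R d i" unfolding L_eq[OF assms(1)] by blast
    have "dist ?x ?z \<le> dist y w" if "w \<in> L j" for w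
    proof -
      from that obtain t where w: "w = a j + t *\<^sub>R d j" unfolding L_eq[OF assms(2)] by blast
      have "(norm (?x - ?z))\<^sup>2 \<le> (norm (y - w))\<^sup>2"
        unfolding y w cross_dist[OF assms, of s t] using qf_nonneg[OF assms] by simp
      then show ?thesis unfolding dist_norm by (rule power2_le_imp_le) simp
    qed
    then have "dist ?x ?z \<le> infdist y (L j)"
      unfolding infdist_def using z by (auto intro!: cINF_greatest)
    moreover have "infdist ?x (L j) \<le> dist ?x ?z" using z by (rule infdist_le)
    ultimately show ?thesis by simp
  qed
  then show ?thesis unfolding closest_in_def is_arg_min_def using x by (auto simp: not_less)
qed

lemma cen_distinct:
  assumes "i \<in> {1..k}" "j \<in> {1..k}" "m \<in> {1..k}" "i \<noteq> j" "i \<noteq> m" "j \<noteq> m"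
  shows "cen i j \<noteq> cen i m"
proof
  assume eq: "cen i j = cen i m"
  have wc: "weakly_concurrent (L i) (L j) (L m)"
    unfolding weakly_concurrent_def
  proof (intro conjI exI)
    show "closest_in (L i) (L j) (a i + cen i j *\<^sub>R d i)" by (rule closest_in_cen[OF assms(1,2,4)])
    show "closest_in (L i) (L m) (a i + cen i j *\<^sub>R d i)" unfolding eq by (rule closest_in_cen[OF assms(1,3,5)])
    show "\<not> affine_parallel (L i) (L j)" by (rule not_parallel[OF assms(1,2,4)])
    show "\<not> affine_parallel (L i) (L m)" by (rule not_parallel[OF assms(1,3,5)])
    show "\<not> affine_parallel (L j) (L m)" by (rule not_parallel[OF assms(2,3,6)])
  qed
  have neq: "L i \<noteq> L j \<and> L i \<noteq> L m \<and> L j \<noteq> L m"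
    using L_neq[OF assms(1,2,4)] L_neq[OF assms(1,3,5)] L_neq[OF assms(2,3,6)] by simp
  have gp: "\<not> weakly_concurrent S T U" if "S \<in> L ` {1..k}" "T \<in> L ` {1..k}" "U \<in> L ` {1..k}"
      "S \<noteq> T \<and> S \<noteq> U \<and> T \<noteq> U" for S T U
    by (rule gen_pos[unfolded general_position_def, THEN conjunct2, rule_format, OF that])
  from gp[OF imageI[OF assms(1)] imageI[OF assms(2)] imageI[OF assms(3)] neq] wc show False ..
qed

section \<open>Configurations as parameter vectors, and the two forms of genericity\<close>

definition pos :: "real^'v \<Rightarrow> 'v \<Rightarrow> 'n euclid" where
  "pos t v = a (line_of v) + (t $ v) *\<^sub>R d (line_of v)"

lemma pos_in_line: "pos t v \<in> L (line_of v)"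
  unfolding pos_def L_eq[OF line_of_in] by (rule rangeI)

lemma pos_configuration: "pos t \<in> configurations k L V"
  unfolding configurations_def
proof (intro CollectI ballI subsetI)
  fix i x assume i: "i \<in> {1..k}" and "x \<in> pos t ` V i"
  then obtain v where "x = pos t v" "v \<in> V i" by (elim imageE)
  then show "x \<in> L i" using pos_in_line[of t v] line_of_unique[OF i] by simp
qed

lemma configuration_pos:
  assumes "p \<in> configurations k L V"
  obtains t where "p = pos t"
proof -
  have "\<exists>s. p v = a (line_of v) + s *\<^sub>R d (line_of v)" for v
  proof -
    have "p ` V (line_of v) \<subseteq> L (line_of v)"
      using assms line_of_in[of v] unfolding configurations_def by (elim CollectE) (rule bspec)
    then have "p v \<in> L (line_of v)" using line_of_mem[of v] by (rule subsetD[OF _ imageI])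
    then show ?thesis unfolding L_eq[OF line_of_in] by (elim rangeE) (rule exI)
  qed
  then obtain f where "\<And>v. p v = a (line_of v) + f v *\<^sub>R d (line_of v)" by metis
  then have "p = pos (\<chi> v. f v)" by (intro ext) (simp add: pos_def)
  then show thesis by (rule that)
qed

lemma rational_pos:
  assumes "x \<in> real_subfield (K \<union> {pos t v $ i | v i. True})"
  shows "rational_in K t x"
proof -
  have "K \<union> {pos t v $ i | v i. True} \<subseteq> {b. rational_in K t b}"
  proof (rule subsetI)
    fix x assume "x \<in> K \<union> {pos t v $ i | v i. True}"
    then consider "x \<in> K" | v i where "x = pos t v $ i" by blast
    then show "x \<in> {b. rational_in K t b}"
    proof cases
      case 1
      then show ?thesis using rational_in_polyfun[OF K_subfield polyfun.const] by simp
    next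
      case 2
      have "(\<lambda>t. a (line_of v) $ i + t $ v * d (line_of v) $ i) \<in> polyfun K UNIV"
        by (intro polyfun.add polyfun.mult polyfun.const polyfun.coord a_in d_in line_of_in UNIV_I)
      from rational_in_polyfun[OF K_subfield this, of t] show ?thesis by (simp add: 2 pos_def)
    qed
  qed
  from real_subfield_least[OF this is_subfield_rational_in[OF K_subfield]] assms show ?thesis by (rule_tac CollectD) (rule subsetD)
qed

lemma generic_if_line_generic:
  assumes "line_generic k L (pos t)"
  shows "generic_point K t"
proof (rule generic_point_if_transcendence_degree[OF K_subfield _ rational_pos])
  show "has_transcendence_degree K (real_subfield (K \<union> {pos t v $ i | v i. True})) CARD('v)"
    using assms unfolding line_generic_def Let_def .
qed

text \<open>The parameters lie in the field generated by the point coordinates: \<open>t $ v\<close>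
  is recovered by division from a coordinate in which the direction is nonzero.\<close>

lemma line_generic_if_generic:
  assumes "generic_point K t"
  shows "line_generic k L (pos t)"
  unfolding line_generic_def Let_def
proof (rule transcendence_degree_if_generic_point[OF K_subfield assms _ rational_pos])
  fix v
  let ?F = "real_subfield (K \<union> {pos t v $ i | v i. True})"
  have F: "is_subfield ?F" by (rule is_subfield_real_subfield)
  obtain i where i: "d (line_of v) $ i \<noteq> 0"
    using d_nz[OF line_of_in[of v]] by (metis Finite_Cartesian_Product.vec_eq_iff zero_index)
  have "K \<subseteq> ?F" by (rule order_trans[OF Un_upper1 real_subfield_incl])
  note KF = subsetD[OF this]
  have "a (line_of v) $ i \<in> ?F" "d (line_of v) $ i \<in> ?F"
    by (rule KF[OF a_in[OF line_of_in]], rule KF[OF d_in[OF line_of_in]])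
  moreover have "pos t v $ i \<in> ?F" by (rule subsetD[OF real_subfield_incl]) (rule UnI2, blast)
  ultimately have "(pos t v $ i - a (line_of v) $ i) / d (line_of v) $ i \<in> ?F"
    by (intro is_subfieldD[OF F])
  then show "t $ v \<in> ?F" using i by (simp add: pos_def)
qed

lemma inner_K:
  assumes "\<And>c. x $ c \<in> K" "\<And>c. y $ c \<in> K"
  shows "(x::'n euclid) \<bullet> y \<in> K"
  unfolding inner_vec_def inner_real_def by (intro is_subfield_sum[OF K_subfield] is_subfieldD(6)[OF K_subfield] assms)

lemma dd_in_K: "i \<in> {1..k} \<Longrightarrow> j \<in> {1..k} \<Longrightarrow> d i \<bullet> d j \<in> K"
  by (intro inner_K d_in)

lemma cen_in_K:
  assumes "i \<in> {1..k}" "j \<in> {1..k}"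
  shows "cen i j \<in> K"
proof -
  have "(a i - a j) $ c \<in> K" for c
    using is_subfieldD(7)[OF K_subfield a_in[OF assms(1)] a_in[OF assms(2)]] by simp
  note 1 = inner_K[OF this d_in[OF assms(1)]] inner_K[OF this d_in[OF assms(2)]]
  show ?thesis
    unfolding cen_def disc_def power2_eq_square
    by (intro is_subfieldD(6,7,8)[OF K_subfield] dd_in_K assms 1)
qed

lemma generic_affine_nz:
  fixes t :: "real^'v"
  assumes gen: "generic_point K t" and "m \<in> K" "b \<in> K" and "u \<noteq> v"
  shows "t $ u \<noteq> m * t $ v + b"
proof
  assume eq: "t $ u = m * t $ v + b"
  have "(\<lambda>x::real^'v. x $ u - (m * x $ v + b)) \<in> polyfun K UNIV"
    by (intro polyfun_diff[OF K_subfield] polyfun.add polyfun.mult polyfun.const polyfun.coord assms UNIV_I)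
  then have "(\<lambda>x::real^'v. x $ u - (m * x $ v + b)) = (\<lambda>_. 0)"
    using gen eq unfolding generic_point_def by simp
  from fun_cong[OF this, of "axis u 1"] fun_cong[OF this, of 0] show False
    using \<open>u \<noteq> v\<close> by (simp add: axis_def)
qed

lemma generic_notin_K:
  fixes t :: "real^'v"
  assumes gen: "generic_point K t" and "c \<in> K"
  shows "t $ v \<noteq> c"
proof -
  \<comment> \<open>The affine criterion compares two vertices; the second one, supplied by the
    crossing property, enters with slope \<open>0\<close>.\<close>
  obtain w where "line_of w \<noteq> line_of v" using exists_other_line by blast
  then have "v \<noteq> w" by auto
  from generic_affine_nz[OF gen is_subfieldD(1)[OF K_subfield] \<open>c \<in> K\<close> this] show ?thesis by simp
qed

lemma exists_generic:
  fixes U :: "(real^'v) set"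
  assumes "open U" "U \<noteq> {}"
  obtains t where "t \<in> U" "generic_point K t"
  by (rule exists_generic_point[OF K_countable K_subfield assms])

section \<open>Isometries of the union of the lines\<close>

lemma Isom_dist:
  assumes "\<theta> \<in> Isom \<M>" "S \<in> \<M>" "T \<in> \<M>" "x \<in> S" "y \<in> T"
  shows "dist (\<theta> x) (\<theta> y) = dist x y"
proof -
  have "\<forall>x\<in>\<Union>\<M>. \<forall>y\<in>\<Union>\<M>. dist (\<theta> x) (\<theta> y) = dist x y"
    using assms(1) unfolding Isom_def by simp
  from bspec[OF bspec[OF this UnionI[OF assms(2,4)]] UnionI[OF assms(3,5)]] show ?thesis .
qed

lemma line_met: "i \<in> range line_of \<Longrightarrow> L i \<in> lines_met k L V UNIV"
  unfolding lines_met_eq by (rule imageI)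

lemma Isom_affine:
  assumes \<theta>: "\<theta> \<in> Isom (lines_met k L V UNIV)" and i: "i \<in> range line_of"
  obtains \<epsilon> c where "\<epsilon> = 1 \<or> \<epsilon> = -1" "\<And>s. \<theta> (a i + s *\<^sub>R d i) = a i + (c + \<epsilon> * s) *\<^sub>R d i"
proof -
  have ik: "i \<in> {1..k}" using i line_of_in by blast
  note dist = Isom_dist[OF \<theta> line_met[OF i] line_met[OF i]]
  have "\<theta> ` L i = L i" using \<theta> line_met[OF i] unfolding Isom_def by simp
  then have "\<forall>s. \<exists>r. \<theta> (a i + s *\<^sub>R d i) = a i + r *\<^sub>R d i"
    unfolding L_eq[OF ik] by blast
  then obtain f where f: "\<And>s. \<theta> (a i + s *\<^sub>R d i) = a i + f s *\<^sub>R d i" by metis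
  have iso: "\<bar>f x - f y\<bar> = \<bar>x - y\<bar>" for x y
  proof -
    have "a i + x *\<^sub>R d i \<in> L i" "a i + y *\<^sub>R d i \<in> L i" unfolding L_eq[OF ik] by blast+
    from dist[OF this] have "norm ((f x - f y) *\<^sub>R d i) = norm ((x - y) *\<^sub>R d i)"
      unfolding f dist_norm by (simp add: scaleR_diff_left)
    then show ?thesis using d_nz[OF ik] by simp
  qed
  obtain \<epsilon> where \<epsilon>: "\<epsilon> = 1 \<or> \<epsilon> = -1" "\<And>x. f x = f 0 + \<epsilon> * x" by (rule real_isometry_affine[of f, OF iso], rule that; assumption)
  have "\<theta> (a i + s *\<^sub>R d i) = a i + (f 0 + \<epsilon> * s) *\<^sub>R d i" for s unfolding f using \<epsilon>(2)[of s] by simp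
  with \<epsilon>(1) show thesis by (rule that)
qed

text \<open>In parameters centred at the closest points an isometry preserves \<open>qf\<close>. The
  value at the origin shows that both closest points are fixed, and the mixed term, nonzero since
  the lines are not perpendicular, forces the same sign on both lines.\<close>

lemma Isom_pair:
  assumes \<theta>: "\<theta> \<in> Isom (lines_met k L V UNIV)"
    and i: "i \<in> range line_of" and j: "j \<in> range line_of" and "i \<noteq> j"
  obtains \<epsilon> where "\<epsilon> = 1 \<or> \<epsilon> = -1"
    "\<And>s. \<theta> (a i + s *\<^sub>R d i) = a i + (cen i j + \<epsilon> * (s - cen i j)) *\<^sub>R d i"
    "\<And>s. \<theta> (a j + s *\<^sub>R d j) = a j + (cen j i + \<epsilon> * (s - cen j i)) *\<^sub>R d j"
proof -
  have ik: "i \<in> {1..k}" and jk: "j \<in> {1..k}" using i j line_of_in by blast+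
  obtain \<epsilon> c where \<epsilon>: "\<epsilon> = 1 \<or> \<epsilon> = -1" "\<And>s. \<theta> (a i + s *\<^sub>R d i) = a i + (c + \<epsilon> * s) *\<^sub>R d i"
    by (rule Isom_affine[OF \<theta> i], rule that; assumption)
  obtain \<epsilon>' c' where \<epsilon>': "\<epsilon>' = 1 \<or> \<epsilon>' = -1" "\<And>s. \<theta> (a j + s *\<^sub>R d j) = a j + (c' + \<epsilon>' * s) *\<^sub>R d j"
    by (rule Isom_affine[OF \<theta> j], rule that; assumption)
  define S T where "S = c + \<epsilon> * cen i j - cen i j" and "T = c' + \<epsilon>' * cen j i - cen j i"
  have inv: "qf i j (S + \<epsilon> * x) (T + \<epsilon>' * y) = qf i j x y" for x y
  proof -
    let ?p = "a i + (cen i j + x) *\<^sub>R d i" and ?q = "a j + (cen j i + y) *\<^sub>R d j"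
    have "?p \<in> L i" "?q \<in> L j" unfolding L_eq[OF ik] L_eq[OF jk] by blast+
    from Isom_dist[OF \<theta> line_met[OF i] line_met[OF j] this]
    have "dist (\<theta> ?p) (\<theta> ?q) = dist ?p ?q" .
    then have "(norm (\<theta> ?p - \<theta> ?q))\<^sup>2 = (norm (?p - ?q))\<^sup>2" by (simp add: dist_norm)
    then have "qf i j (c + \<epsilon> * (cen i j + x) - cen i j) (c' + \<epsilon>' * (cen j i + y) - cen j i) = qf i j x y"
      unfolding \<epsilon>(2) \<epsilon>'(2)
        cross_dist[OF ik jk \<open>i \<noteq> j\<close>, of "c + \<epsilon> * (cen i j + x)" "c' + \<epsilon>' * (cen j i + y)"]
        cross_dist[OF ik jk \<open>i \<noteq> j\<close>, of "cen i j + x" "cen j i + y"] by simp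
    then show ?thesis unfolding S_def T_def by (simp add: algebra_simps)
  qed
  have "qf i j S T = 0" using inv[of 0 0] by (simp add: qf_def)
  then have "S = 0" by (rule qf_zero[OF ik jk \<open>i \<noteq> j\<close>])
  have "qf j i T S = 0" using \<open>qf i j S T = 0\<close> by (simp add: qf_commute)
  then have "T = 0" by (rule qf_zero[OF jk ik not_sym[OF \<open>i \<noteq> j\<close>]])
  have "\<epsilon> * \<epsilon>' = 1"
  proof -
    have "\<epsilon>\<^sup>2 = 1" "\<epsilon>'\<^sup>2 = 1" using \<epsilon>(1) \<epsilon>'(1) by auto
    then have "2 * (d i \<bullet> d j) * (\<epsilon> * \<epsilon>') = 2 * (d i \<bullet> d j) * 1"
      using inv[of 1 1] \<open>S = 0\<close> \<open>T = 0\<close> by (simp add: qf_def)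
    then show ?thesis using inner_d_nz[OF ik jk] by simp
  qed
  then have "\<epsilon>' = \<epsilon>" using \<epsilon>(1) \<epsilon>'(1) by auto
  show thesis
  proof (rule that[OF \<epsilon>(1)])
    show "\<theta> (a i + s *\<^sub>R d i) = a i + (cen i j + \<epsilon> * (s - cen i j)) *\<^sub>R d i" for s
    proof -
      have "c + \<epsilon> * s = cen i j + \<epsilon> * (s - cen i j)" using \<open>S = 0\<close> unfolding S_def by (simp add: right_diff_distrib)
      then show ?thesis using \<epsilon>(2)[of s] by simp
    qed
    show "\<theta> (a j + s *\<^sub>R d j) = a j + (cen j i + \<epsilon> * (s - cen j i)) *\<^sub>R d j" for s
    proof -
      have "c' + \<epsilon>' * s = cen j i + \<epsilon> * (s - cen j i)"
        using \<open>T = 0\<close> \<open>\<epsilon>' = \<epsilon>\<close> unfolding T_def by (simp add: right_diff_distrib)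
      then show ?thesis using \<epsilon>'(2)[of s] by simp
    qed
  qed
qed

definition same_lengths :: "real^'v \<Rightarrow> real^'v \<Rightarrow> bool" where
  "same_lengths t' t \<longleftrightarrow> (\<forall>u v. {u, v} \<in> E \<longrightarrow> norm (pos t' u - pos t' v) = norm (pos t u - pos t v))"

lemma globally_rigid_pos:
  assumes "globally_rigid k L V E (pos t)" "same_lengths t' t"
  obtains \<theta> where "\<theta> \<in> Isom (lines_met k L V UNIV)" "\<And>v. pos t' v = \<theta> (pos t v)"
proof -
  have "rigidity_map E (pos t') = rigidity_map E (pos t)"
    unfolding rigidity_map_def using assms(2) unfolding same_lengths_def by (intro restrict_ext) auto
  then obtain \<theta> where "\<theta> \<in> Isom (lines_met k L V UNIV)" "pos t' = \<theta> \<circ> pos t"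
    using assms(1) pos_configuration[of t'] unfolding globally_rigid_def by blast
  then show thesis by (intro that[of \<theta>]) simp_all
qed

lemma pos_reflect_eq:
  assumes "pos t' v = \<theta> (pos t v)"
    and "\<And>s. \<theta> (a (line_of v) + s *\<^sub>R d (line_of v)) = a (line_of v) + (c + \<epsilon> * (s - c)) *\<^sub>R d (line_of v)"
  shows "t' $ v = c + \<epsilon> * (t $ v - c)"
  using assms d_nz[OF line_of_in[of v]] by (simp add: pos_def)

text \<open>Away from the closest point to \<open>L j\<close> a vertex is fixed only by the sign
  \<open>+1\<close>, so the isometry is the identity on the line of \<open>z\<close>. Paired with
  that line, every other line has sign \<open>+1\<close> too.\<close>

lemma rigid_fixed_vertex:
  assumes rigid: "globally_rigid k L V E (pos t)" and len: "same_lengths t' t"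
    and z: "t' $ z = t $ z" and j: "j \<in> range line_of" "j \<noteq> line_of z" and nc: "t $ z \<noteq> cen (line_of z) j"
  shows "t' = t"
proof -
  obtain \<theta> where \<theta>: "\<theta> \<in> Isom (lines_met k L V UNIV)" "\<And>v. pos t' v = \<theta> (pos t v)"
    by (rule globally_rigid_pos[OF rigid len], rule that; assumption)
  let ?i = "line_of z"
  obtain \<epsilon> where \<epsilon>: "\<epsilon> = 1 \<or> \<epsilon> = -1"
    "\<And>s. \<theta> (a ?i + s *\<^sub>R d ?i) = a ?i + (cen ?i j + \<epsilon> * (s - cen ?i j)) *\<^sub>R d ?i"
    "\<And>s. \<theta> (a j + s *\<^sub>R d j) = a j + (cen j ?i + \<epsilon> * (s - cen j ?i)) *\<^sub>R d j"
    by (rule Isom_pair[OF \<theta>(1) rangeI j(1) not_sym[OF j(2)]], rule that; assumption)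
  have "t' $ z = cen ?i j + \<epsilon> * (t $ z - cen ?i j)" by (rule pos_reflect_eq[where \<theta> = \<theta>], rule \<theta>(2), rule \<epsilon>(2))
  then have "\<epsilon> = 1" using z nc \<epsilon>(1) by auto
  then have id_i: "\<theta> (a ?i + s *\<^sub>R d ?i) = a ?i + s *\<^sub>R d ?i" for s using \<epsilon>(2)[of s] by simp
  have "t' $ v = t $ v" for v
  proof (cases "line_of v = ?i")
    case True
    have "t' $ v = 0 + 1 * (t $ v - 0)"
      by (rule pos_reflect_eq[where \<theta> = \<theta>], rule \<theta>(2)) (simp add: True id_i)
    then show ?thesis by simp
  next
    case False
    let ?m = "line_of v"
    obtain \<delta> where \<delta>: "\<delta> = 1 \<or> \<delta> = -1"
      "\<And>s. \<theta> (a ?i + s *\<^sub>R d ?i) = a ?i + (cen ?i ?m + \<delta> * (s - cen ?i ?m)) *\<^sub>R d ?i"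
      "\<And>s. \<theta> (a ?m + s *\<^sub>R d ?m) = a ?m + (cen ?m ?i + \<delta> * (s - cen ?m ?i)) *\<^sub>R d ?m"
      by (rule Isom_pair[OF \<theta>(1) rangeI rangeI not_sym[OF False]], rule that; assumption)
    \<comment> \<open>At distance one in the parameter from the closest point the two signs have
      different images.\<close>
    have "cen ?i ?m + 1 = cen ?i ?m + \<delta>"
      using \<delta>(2)[of "cen ?i ?m + 1"] id_i[of "cen ?i ?m + 1"] d_nz[OF line_of_in[of z]] by simp
    then have "\<delta> = 1" by simp
    moreover have "t' $ v = cen ?m ?i + \<delta> * (t $ v - cen ?m ?i)"
      by (rule pos_reflect_eq[where \<theta> = \<theta>], rule \<theta>(2), rule \<delta>(3))
    ultimately show ?thesis by simp
  qed
  then show ?thesis by (simp add: Finite_Cartesian_Product.vec_eq_iff)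
qed

lemma rigid_reflection:
  assumes rigid: "globally_rigid k L V E (pos t)" and len: "same_lengths t' t"
    and "j \<in> range line_of" "line_of v \<noteq> j"
  shows "t' $ v = t $ v \<or> t' $ v = 2 * cen (line_of v) j - t $ v"
proof -
  obtain \<theta> where \<theta>: "\<theta> \<in> Isom (lines_met k L V UNIV)" "\<And>v. pos t' v = \<theta> (pos t v)"
    by (rule globally_rigid_pos[OF rigid len], rule that; assumption)
  obtain \<epsilon> where \<epsilon>: "\<epsilon> = 1 \<or> \<epsilon> = -1"
    "\<And>s. \<theta> (a (line_of v) + s *\<^sub>R d (line_of v)) =
       a (line_of v) + (cen (line_of v) j + \<epsilon> * (s - cen (line_of v) j)) *\<^sub>R d (line_of v)"
    by (rule Isom_pair[OF \<theta>(1) rangeI assms(3,4)], rule that; assumption)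
  have "t' $ v = cen (line_of v) j + \<epsilon> * (t $ v - cen (line_of v) j)"
    by (rule pos_reflect_eq[where \<theta> = \<theta>], rule \<theta>(2), rule \<epsilon>(2))
  with \<epsilon>(1) show ?thesis by auto
qed

text \<open>If \<open>v\<close> moved, it would be reflected in its closest points to two different
  lines at once, and \<open>cen_distinct\<close> separates these centres.\<close>

lemma rigid_three_lines:
  assumes rigid: "globally_rigid k L V E (pos t)" and len: "same_lengths t' t"
    and three: "card (range line_of) \<ge> 3"
  shows "t' = t"
proof -
  have "t' $ v = t $ v" for v
  proof -
    let ?i = "line_of v"
    have "card (range line_of - {?i}) \<ge> 2" using three by (simp add: card_Diff_singleton)
    then obtain j where j: "j \<in> range line_of - {?i}" by (metis card.empty ex_in_conv not_numeral_le_zero)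
    have "card (range line_of - {?i} - {j}) \<ge> 1"
      using \<open>card (range line_of - {?i}) \<ge> 2\<close> j by (subst card_Diff_singleton) simp_all
    then obtain m where m: "m \<in> range line_of - {?i} - {j}" by (metis card.empty ex_in_conv not_one_le_zero)
    have jk: "j \<in> {1..k}" and mk: "m \<in> {1..k}" using j m line_of_in by blast+
    have "cen ?i j \<noteq> cen ?i m" by (rule cen_distinct[OF line_of_in jk mk]) (use j m in auto)
    moreover have "t' $ v = t $ v \<or> t' $ v = 2 * cen ?i j - t $ v"
      by (rule rigid_reflection[OF rigid len]) (use j in auto)
    moreover have "t' $ v = t $ v \<or> t' $ v = 2 * cen ?i m - t $ v"
      by (rule rigid_reflection[OF rigid len]) (use m in auto)
    ultimately show ?thesis by linarith
  qed
  then show ?thesis by (simp add: Finite_Cartesian_Product.vec_eq_iff)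
qed

end

section \<open>Connectivity\<close>

text \<open>A nonempty set of this kind contains a whole component, and closedness can be checked
  edge by edge, so arguments with it avoid paths.\<close>

definition adj_closed :: "'v set \<Rightarrow> 'v set set \<Rightarrow> 'v set \<Rightarrow> bool" where
  "adj_closed W F U \<longleftrightarrow> U \<subseteq> W \<and> (\<forall>u w. u \<in> U \<longrightarrow> w \<in> W \<longrightarrow> {u, w} \<in> F \<longrightarrow> w \<in> U)"

lemma component_adj_closed:
  assumes "H \<in> components W F"
  shows "adj_closed W F H" "H \<noteq> {}"
proof -
  define S where "S = {(x, y). x \<in> W \<and> y \<in> W \<and> {x, y} \<in> F}"
  define R where "R = {(u, v) \<in> W \<times> W. (u, v) \<in> S\<^sup>*}"
  from assms have "H \<in> W // R" unfolding components_def R_def S_def .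
  then obtain x where x: "x \<in> W" "H = R `` {x}" by (rule quotientE)
  have H: "u \<in> H \<longleftrightarrow> u \<in> W \<and> (x, u) \<in> S\<^sup>*" for u unfolding x(2) R_def using x(1) by simp
  show "adj_closed W F H" unfolding adj_closed_def
  proof (intro conjI allI impI subsetI)
    show "u \<in> W" if "u \<in> H" for u using that H by simp
    fix u w assume "u \<in> H" "w \<in> W" "{u, w} \<in> F"
    then have "(x, u) \<in> S\<^sup>*" "(u, w) \<in> S" using H by (simp_all add: S_def)
    then have "(x, w) \<in> S\<^sup>*" by (rule rtrancl_into_rtrancl)
    then show "w \<in> H" using H \<open>w \<in> W\<close> by simp
  qed
  have "x \<in> H" using H x(1) by simp
  then show "H \<noteq> {}" by auto
qed

lemma adj_closed_contains_component:
  assumes "adj_closed W F U" "U \<noteq> {}"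
  obtains H where "H \<in> components W F" "H \<subseteq> U"
proof -
  define S where "S = {(x, y). x \<in> W \<and> y \<in> W \<and> {x, y} \<in> F}"
  define R where "R = {(u, v) \<in> W \<times> W. (u, v) \<in> S\<^sup>*}"
  obtain x where "x \<in> U" using assms(2) unfolding ex_in_conv[symmetric] ..
  have "U \<subseteq> W" using assms(1) unfolding adj_closed_def by (rule conjunct1)
  then have "x \<in> W" using \<open>x \<in> U\<close> by (rule subsetD)
  then have "R `` {x} \<in> components W F" unfolding components_def R_def S_def by (rule quotientI)
  moreover have "u \<in> U" if "(x, u) \<in> S\<^sup>*" for u
    using that
  proof induction
    case (step y z)
    then have "z \<in> W" "{y, z} \<in> F" by (simp_all add: S_def)
    then show ?case using assms(1) step.IH unfolding adj_closed_def by simp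
  qed (rule \<open>x \<in> U\<close>)
  then have "R `` {x} \<subseteq> U" unfolding R_def by (intro subsetI) simp
  ultimately show thesis by (rule that)
qed

context line_framework begin

text \<open>A component inside \<open>U\<close> either is proper and meets three lines or is the
  whole graph, which meets two because it is crossing.\<close>

lemma P_connected_closed:
  assumes P: "P_connected k L V E" and "adj_closed UNIV E U" "U \<noteq> {}"
  shows "\<exists>u\<in>U. line_of u \<noteq> i"
proof (rule ccontr)
  assume no: "\<not> (\<exists>u\<in>U. line_of u \<noteq> i)"
  obtain H where H: "H \<in> components UNIV E" "H \<subseteq> U" by (rule adj_closed_contains_component[OF assms(2,3)])
  have line: "line_of ` H \<subseteq> {i}" using no H(2) by (intro image_subsetI) (metis insertI1 subsetD)
  show False
  proof (cases "H = UNIV")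
    case True
    obtain w where "line_of w \<noteq> i" using exists_other_line[of i] by (rule exE)
    moreover have "line_of w \<in> {i}" using line True by (intro subsetD[OF line] imageI) simp
    ultimately show False by simp
  next
    case False
    then have "card (lines_met k L V H) \<ge> 3" using P H(1) unfolding P_connected_def by simp
    moreover have "card (line_of ` H) \<le> card {i}" by (rule card_mono[OF _ line]) simp
    ultimately show False unfolding card_lines_met by simp
  qed
qed

lemma P_connected_closed_delete_vertex:
  assumes P: "P_connected k L V E" and "adj_closed (UNIV - {v}) E U" "U \<noteq> {}"
  shows "\<exists>u\<in>U. line_of u \<noteq> i"
proof (rule ccontr)
  assume no: "\<not> (\<exists>u\<in>U. line_of u \<noteq> i)"
  obtain H where H: "H \<in> components (UNIV - {v}) E" "H \<subseteq> U"
    by (rule adj_closed_contains_component[OF assms(2,3)])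
  have line: "line_of ` H \<subseteq> {i}" using no H(2) by (intro image_subsetI) (metis insertI1 subsetD)
  have "card (lines_met k L V H) \<ge> 2" using P H(1) unfolding P_connected_def by simp
  moreover have "card (line_of ` H) \<le> card {i}" by (rule card_mono[OF _ line]) simp
  ultimately show False unfolding card_lines_met by simp
qed

text \<open>If \<open>U\<close> contains both ends of the deleted edge or neither, it is closed in
  the full graph. If it contains only one, deleting the other end as a vertex removes that edge as
  well.\<close>

lemma P_connected_closed_delete_edge:
  assumes P: "P_connected k L V E" and U: "adj_closed UNIV (E - {{x, y}}) U" "U \<noteq> {}"
  shows "\<exists>u\<in>U. line_of u \<noteq> i"
proof -
  have cl: "w \<in> U" if "u \<in> U" "{u, w} \<in> E" "{u, w} \<noteq> {x, y}" for u w
    using U(1) that unfolding adj_closed_def by simp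
  show ?thesis
  proof (cases "x \<in> U \<longleftrightarrow> y \<in> U")
    case True
    have "adj_closed UNIV E U" unfolding adj_closed_def
    proof (intro conjI allI impI)
      fix u w assume u: "u \<in> U" "{u, w} \<in> E"
      show "w \<in> U"
      proof (cases "{u, w} = {x, y}")
        case True
        then have "u = x \<and> w = y \<or> u = y \<and> w = x" by (simp add: doubleton_eq_iff)
        then show ?thesis using u(1) \<open>x \<in> U \<longleftrightarrow> y \<in> U\<close> by (elim disjE) simp_all
      qed (rule cl[OF u])
    qed simp
    from P_connected_closed[OF P this U(2)] show ?thesis .
  next
    case False
    then obtain z where z: "z \<notin> U" "z = x \<or> z = y" by blast
    have "adj_closed (UNIV - {z}) E U" unfolding adj_closed_def
    proof (intro conjI allI impI subsetI)
      show "u \<in> UNIV - {z}" if "u \<in> U" for u using that z(1) by (cases "u = z") simp_all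
      fix u w assume u: "u \<in> U" "w \<in> UNIV - {z}" "{u, w} \<in> E"
      have "{u, w} \<noteq> {x, y}"
      proof
        assume "{u, w} = {x, y}"
        then have "z = u \<or> z = w" using z(2) by (auto simp: doubleton_eq_iff)
        then show False using u z(1) by auto
      qed
      then show "w \<in> U" by (rule cl[OF u(1,3)])
    qed
    from P_connected_closed_delete_vertex[OF P this U(2)] show ?thesis .
  qed
qed

section \<open>Squared edge lengths, and moves of a single component\<close>

definition len2 :: "real^'v \<Rightarrow> 'v \<Rightarrow> 'v \<Rightarrow> real" where
  "len2 t u v = (norm (pos t u - pos t v))\<^sup>2"

definition offset :: "nat \<Rightarrow> nat \<Rightarrow> real" where
  "offset i j = (norm ((a i + cen i j *\<^sub>R d i) - (a j + cen j i *\<^sub>R d j)))\<^sup>2"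

lemma len2_commute: "len2 t u v = len2 t v u"
  by (simp add: len2_def norm_minus_commute)

lemma len2_same:
  assumes "line_of u = line_of v"
  shows "len2 t u v = (d (line_of v) \<bullet> d (line_of v)) * (t $ u - t $ v)\<^sup>2"
  unfolding len2_def pos_def assms by (rule same_dist)

lemma len2_cross:
  assumes "line_of u \<noteq> line_of v"
  shows "len2 t u v = qf (line_of u) (line_of v) (t $ u - cen (line_of u) (line_of v))
    (t $ v - cen (line_of v) (line_of u)) + offset (line_of u) (line_of v)"
  unfolding len2_def pos_def offset_def by (rule cross_dist[OF line_of_in line_of_in assms])

lemma len2_cong: "t' $ u = t $ u \<Longrightarrow> t' $ v = t $ v \<Longrightarrow> len2 t' u v = len2 t u v"
  by (simp add: len2_def pos_def)

lemma same_lengths_iff: "same_lengths t' t \<longleftrightarrow> (\<forall>u v. {u, v} \<in> E \<longrightarrow> len2 t' u v = len2 t u v)"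
  by (simp add: same_lengths_def len2_def)

text \<open>A generic vertex is never at a closest point, because those have parameters in
  \<open>K\<close>.\<close>

lemma rigid_move:
  assumes gen: "generic_point K t" and rigid: "globally_rigid k L V E (pos t)"
    and len: "same_lengths t' t" and z: "t' $ z = t $ z"
  shows "t' = t"
proof -
  obtain w where w: "line_of w \<noteq> line_of z" using exists_other_line by (rule exE)
  show ?thesis
    by (rule rigid_fixed_vertex[OF rigid len z rangeI w generic_notin_K[OF gen cen_in_K[OF line_of_in line_of_in]]])
qed

text \<open>\<open>m * t $ v + b\<close> is the parameter of the foot of the perpendicular from
  \<open>v\<close> to line \<open>i\<close>, and reflection in the foot keeps the distance to
  \<open>v\<close>. If \<open>v\<close> is on that line, the foot is \<open>v\<close>
  itself.\<close>

lemma reflection_coefficients: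
  assumes i: "i \<in> {1..k}"
  obtains m b where "m \<in> K" "b \<in> K"
    "\<And>t t' h. line_of h = i \<Longrightarrow> t' $ v = t $ v \<Longrightarrow> t' $ h = 2 * (m * t $ v + b) - t $ h \<Longrightarrow> len2 t' h v = len2 t h v"
proof (cases "line_of v = i")
  case True
  show thesis
  proof (rule that[of 1 0])
    show "1 \<in> K" "0 \<in> K" by (rule is_subfieldD[OF K_subfield])+
    fix t t' :: "real^'v" and h assume h: "line_of h = i" "t' $ v = t $ v" "t' $ h = 2 * (1 * t $ v + 0) - t $ h"
    have "t' $ h - t' $ v = - (t $ h - t $ v)" using h by simp
    then show "len2 t' h v = len2 t h v"
      using len2_same[of h v] h(1) True by (simp only: power2_minus)
  qed
next
  case False
  define j where "j = line_of v"
  have j: "j \<in> {1..k}" unfolding j_def by (rule line_of_in)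
  define m where "m = (d i \<bullet> d j) / (d i \<bullet> d i)"
  have m: "m * (d i \<bullet> d i) = d i \<bullet> d j" unfolding m_def using d_nz[OF i] by simp
  show thesis
  proof (rule that[of m "cen i j - m * cen j i"])
    show "m \<in> K" unfolding m_def by (intro is_subfieldD(8)[OF K_subfield] dd_in_K i j)
    then show "cen i j - m * cen j i \<in> K" by (intro is_subfieldD(6,7)[OF K_subfield] cen_in_K i j)
    fix t t' :: "real^'v" and h assume h: "line_of h = i" "t' $ v = t $ v"
      "t' $ h = 2 * (m * t $ v + (cen i j - m * cen j i)) - t $ h"
    define S T where "S = t $ h - cen i j" and "T = t $ v - cen j i"
    have e1: "t' $ h - cen i j = 2 * m * T - S" unfolding h(3) S_def T_def by (simp add: algebra_simps)
    have e2: "qf i j (2 * m * T - S) T = qf i j S T"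
    proof -
      have "qf i j (2 * m * T - S) T = qf i j S T + 4 * (m * T\<^sup>2 - S * T) * (m * (d i \<bullet> d i) - d i \<bullet> d j)"
        unfolding qf_def by (simp add: power2_eq_square algebra_simps)
      then show ?thesis unfolding m by simp
    qed
    have ne: "line_of h \<noteq> line_of v" using h(1) False by simp
    show "len2 t' h v = len2 t h v"
      unfolding len2_cross[OF ne] h(1) j_def[symmetric] h(2) e1 unfolding T_def[symmetric] S_def[symmetric] e2 ..
  qed
qed

text \<open>On one line a closed proper part can be translated, on two lines it can be reflected in
  the two closest points. Both moves keep all edge lengths and fix a vertex outside, so rigidity
  would make them trivial.\<close>

lemma component_three_lines:
  assumes gen: "generic_point K t" and rigid: "globally_rigid k L V E (pos t)"
    and H: "adj_closed UNIV E H" "H \<noteq> {}" "H \<noteq> UNIV"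
  shows "card (line_of ` H) \<ge> 3"
proof (rule ccontr)
  assume "\<not> card (line_of ` H) \<ge> 3"
  obtain z where z: "z \<notin> H" using H(3) by auto
  obtain h where h: "h \<in> H" using H(2) unfolding ex_in_conv[symmetric] ..
  have closed: "u \<in> H \<longleftrightarrow> v \<in> H" if "{u, v} \<in> E" for u v
  proof -
    have "{v, u} \<in> E" using that by (simp add: insert_commute)
    then show ?thesis using H(1) that unfolding adj_closed_def by auto
  qed
  have "card (line_of ` H) \<noteq> 0" using h by (simp add: card_eq_0_iff) auto
  then have "card (line_of ` H) = 1 \<or> card (line_of ` H) = 2"
    using \<open>\<not> card (line_of ` H) \<ge> 3\<close> by linarith
  then show False
  proof
    assume "card (line_of ` H) = 1"
    then obtain i where i: "line_of ` H = {i}" by (rule card_1_singletonE)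
    have on_i: "line_of u = i" if "u \<in> H" for u using imageI[OF that, of line_of] i by simp
    define t' where "t' = (\<chi> v. t $ v + (if v \<in> H then 1 else 0))"
    have "same_lengths t' t" unfolding same_lengths_iff
    proof (intro allI impI)
      fix u v assume uv: "{u, v} \<in> E"
      show "len2 t' u v = len2 t u v"
      proof (cases "u \<in> H")
        case True
        then have "v \<in> H" using closed[OF uv] by simp
        have "line_of u = line_of v" using on_i[OF True] on_i[OF \<open>v \<in> H\<close>] by simp
        from len2_same[OF this] show ?thesis using True \<open>v \<in> H\<close> by (simp add: t'_def)
      next
        case False
        then have "v \<notin> H" using closed[OF uv] by simp
        with False show ?thesis by (intro len2_cong) (simp_all add: t'_def)
      qed
    qed
    then have "t' = t" by (rule rigid_move[OF gen rigid, of _ z]) (simp add: t'_def z)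
    then have "t' $ h = t $ h" by simp
    then show False using h by (simp add: t'_def)
  next
    assume "card (line_of ` H) = 2"
    then obtain i j where ij: "line_of ` H = {i, j}" "i \<noteq> j" unfolding card_2_iff by (elim exE conjE)
    define opp where "opp v = (if line_of v = i then j else i)" for v
    have on: "line_of u = i \<or> line_of u = j" if "u \<in> H" for u using imageI[OF that, of line_of] ij(1) by simp
    have opp: "opp u = line_of v" if "u \<in> H" "v \<in> H" "line_of u \<noteq> line_of v" for u v
      using on[OF that(1)] on[OF that(2)] that(3) ij(2) unfolding opp_def by auto
    have opp_in: "opp v \<in> {1..k}" for v
    proof -
      have "i \<in> range line_of" "j \<in> range line_of" using ij(1) by blast+
      then show ?thesis unfolding opp_def using line_of_in by (auto split: if_split)
    qed
    define t' where "t' = (\<chi> v. if v \<in> H then 2 * cen (line_of v) (opp v) - t $ v else t $ v)"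
    have "same_lengths t' t" unfolding same_lengths_iff
    proof (intro allI impI)
      fix u v assume uv: "{u, v} \<in> E"
      show "len2 t' u v = len2 t u v"
      proof (cases "u \<in> H")
        case True
        then have "v \<in> H" using closed[OF uv] by simp
        show ?thesis
        proof (cases "line_of u = line_of v")
          case eq: True
          then have "opp u = opp v" by (simp add: opp_def)
          then have "t' $ u - t' $ v = - (t $ u - t $ v)" using True \<open>v \<in> H\<close> eq by (simp add: t'_def)
          then show ?thesis unfolding len2_same[OF eq] by (simp only: power2_minus)
        next
          case ne: False
          have "opp u = line_of v" by (rule opp[OF True \<open>v \<in> H\<close> ne])
          moreover have "opp v = line_of u" by (rule opp[OF \<open>v \<in> H\<close> True not_sym[OF ne]])
          ultimately have "t' $ u - cen (line_of u) (line_of v) = - (t $ u - cen (line_of u) (line_of v))"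
            "t' $ v - cen (line_of v) (line_of u) = - (t $ v - cen (line_of v) (line_of u))"
            using True \<open>v \<in> H\<close> by (simp_all add: t'_def)
          then show ?thesis unfolding len2_cross[OF ne] by (simp only: qf_minus)
        qed
      next
        case False
        then have "v \<notin> H" using closed[OF uv] by simp
        with False show ?thesis by (intro len2_cong) (simp_all add: t'_def)
      qed
    qed
    then have "t' = t" by (rule rigid_move[OF gen rigid, of _ z]) (simp add: t'_def z)
    then have "t' $ h = t $ h" by simp
    \<comment> \<open>A fixed point of the reflection has its parameter in \<open>K\<close>, which
      is impossible for the generic \<open>t\<close>.\<close>
    then have "t $ h = cen (line_of h) (opp h)" using h by (simp add: t'_def)
    then show False using generic_notin_K[OF gen cen_in_K[OF line_of_in opp_in]] by simp
  qed
qed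

text \<open>If \<open>H\<close> lay on one line, reflect it in the foot of the perpendicular from
  \<open>v\<close>: differences inside \<open>H\<close> change sign, and \<open>v\<close> is its
  only neighbour outside. A generic \<open>h\<close> is not at the foot, so it moves.\<close>

lemma delete_vertex_component_two_lines:
  assumes gen: "generic_point K t" and rigid: "globally_rigid k L V E (pos t)"
    and H: "adj_closed (UNIV - {v}) E H" "H \<noteq> {}"
  shows "card (line_of ` H) \<ge> 2"
proof (rule ccontr)
  assume "\<not> card (line_of ` H) \<ge> 2"
  obtain h where h: "h \<in> H" using H(2) unfolding ex_in_conv[symmetric] ..
  have "v \<notin> H" using H(1) unfolding adj_closed_def by auto
  have "card (line_of ` H) \<noteq> 0" using h by (simp add: card_eq_0_iff) auto
  then have "card (line_of ` H) = 1" using \<open>\<not> card (line_of ` H) \<ge> 2\<close> by linarith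
  then obtain i where i: "line_of ` H = {i}" by (rule card_1_singletonE)
  have on_i: "line_of u = i" if "u \<in> H" for u using imageI[OF that, of line_of] i by simp
  have "i \<in> {1..k}" using on_i[OF h] line_of_in by blast
  then have ik: "i \<in> {1..k}" .
  obtain m b where mb: "m \<in> K" "b \<in> K"
    "\<And>t t' h. line_of h = i \<Longrightarrow> t' $ v = t $ v \<Longrightarrow> t' $ h = 2 * (m * t $ v + b) - t $ h \<Longrightarrow> len2 t' h v = len2 t h v"
    by (rule reflection_coefficients[OF ik, of v], rule that; assumption)
  define t' where "t' = (\<chi> u. if u \<in> H then 2 * (m * t $ v + b) - t $ u else t $ u)"
  have out: "w = v" if "{u, w} \<in> E" "u \<in> H" "w \<notin> H" for u w
    using H(1) that unfolding adj_closed_def by (cases "w = v") simp_all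
  have reflect: "len2 t' u v = len2 t u v" if "u \<in> H" for u
    by (rule mb(3)[OF on_i[OF that]]) (simp_all add: t'_def that \<open>v \<notin> H\<close>)
  have "same_lengths t' t" unfolding same_lengths_iff
  proof (intro allI impI)
    fix u w assume uw: "{u, w} \<in> E"
    then have wu: "{w, u} \<in> E" by (simp add: insert_commute)
    consider "u \<in> H" "w \<in> H" | "u \<in> H" "w \<notin> H" | "u \<notin> H" "w \<in> H" | "u \<notin> H" "w \<notin> H" by blast
    then show "len2 t' u w = len2 t u w"
    proof cases
      case 1
      then have eq: "line_of u = line_of w" using on_i by simp
      have "t' $ u - t' $ w = - (t $ u - t $ w)" using 1 by (simp add: t'_def)
      then show ?thesis unfolding len2_same[OF eq] by (simp only: power2_minus)
    next
      case 2
      then show ?thesis using out[OF uw 2] reflect by simp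
    next
      case 3
      have "u = v" by (rule out[OF wu 3(2,1)])
      show ?thesis unfolding \<open>u = v\<close> len2_commute[of _ v w] by (rule reflect[OF 3(2)])
    next
      case 4
      then show ?thesis by (intro len2_cong) (simp_all add: t'_def)
    qed
  qed
  then have "t' = t" by (rule rigid_move[OF gen rigid, of _ v]) (simp add: t'_def \<open>v \<notin> H\<close>)
  then have "t' $ h = t $ h" by simp
  then have "t $ h = m * t $ v + b" using h by (simp add: t'_def)
  moreover have "h \<noteq> v" using h \<open>v \<notin> H\<close> by auto
  ultimately show False using generic_affine_nz[OF gen mb(1,2)] by simp
qed

lemma rigid_at_generic:
  assumes "generically_globally_rigid k L V E" "generic_point K t"
  shows "globally_rigid k L V E (pos t)"
  using assms(1) pos_configuration[of t] line_generic_if_generic[OF assms(2)]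
  unfolding generically_globally_rigid_def by simp

lemma P_connected_if_rigid:
  assumes "generically_globally_rigid k L V E"
  shows "P_connected k L V E"
proof -
  obtain t :: "real^'v" where t: "generic_point K t"
    by (rule exists_generic[of UNIV]) simp_all
  note rigid = rigid_at_generic[OF assms t]
  show ?thesis unfolding P_connected_def card_lines_met
  proof (intro conjI ballI impI allI)
    fix H assume "H \<in> components UNIV E" "H \<noteq> UNIV"
    then show "3 \<le> card (line_of ` H)"
      by (intro component_three_lines[OF t rigid] component_adj_closed)
  next
    fix v H assume "H \<in> components (UNIV - {v}) E"
    then show "2 \<le> card (line_of ` H)"
      by (intro delete_vertex_component_two_lines[OF t rigid] component_adj_closed)
  qed
qed

section \<open>Redundant rigidity\<close>

text \<open>
  The coordinates are included among the functions to which the fibre lemma is applied so that it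
  also covers the case where \<open>G\<close> itself is flexible.
\<close>

definition edge_vec :: "'v \<Rightarrow> 'v \<Rightarrow> 'v \<Rightarrow> 'n euclid" where
  "edge_vec u v w = (if w = u then d (line_of u) else 0) - (if w = v then d (line_of v) else 0)"

fun fn :: "('v \<times> 'v) + 'v \<Rightarrow> real^'v \<Rightarrow> real" where
  "fn (Inl (u, v)) t = len2 t u v"
| "fn (Inr w) t = t $ w"

text \<open>\<open>edge_vec u v w\<close> is the partial derivative of
  \<open>pos t u - pos t v\<close> in the parameter of \<open>w\<close>, and does not depend on
  \<open>t\<close>; the factor \<open>2\<close> comes from the square.\<close>

fun gr :: "('v \<times> 'v) + 'v \<Rightarrow> real^'v \<Rightarrow> real^'v" where
  "gr (Inl (u, v)) t = (\<chi> w. 2 * ((pos t u - pos t v) \<bullet> edge_vec u v w))"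
| "gr (Inr w) t = axis w 1"

text \<open>Twice a Gram matrix, constant because squared lengths are quadratic; this makes the
  gradients affine, as the fibre lemma demands.\<close>

fun hess :: "('v \<times> 'v) + 'v \<Rightarrow> real^'v^'v" where
  "hess (Inl (u, v)) = (\<chi> w w'. 2 * (edge_vec u v w \<bullet> edge_vec u v w'))"
| "hess (Inr w) = 0"

lemma sum_edge_vec:
  fixes h :: "real^'v"
  shows "(\<Sum>w\<in>UNIV. h $ w *\<^sub>R edge_vec u v w) = h $ u *\<^sub>R d (line_of u) - h $ v *\<^sub>R d (line_of v)"
  unfolding edge_vec_def scaleR_diff_right sum_subtractf
  by (simp add: if_distrib[of "scaleR _"] cong: if_cong)

lemma inner_gr:
  "gr (Inl (u, v)) t \<bullet> h = 2 * ((pos t u - pos t v) \<bullet> (h $ u *\<^sub>R d (line_of u) - h $ v *\<^sub>R d (line_of v)))"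
proof -
  have "gr (Inl (u, v)) t \<bullet> h = (\<Sum>w\<in>UNIV. 2 * ((pos t u - pos t v) \<bullet> (h $ w *\<^sub>R edge_vec u v w)))"
    unfolding inner_vec_def[of "gr (Inl (u, v)) t" h] by (intro sum.cong refl) simp
  also have "\<dots> = 2 * ((pos t u - pos t v) \<bullet> (\<Sum>w\<in>UNIV. h $ w *\<^sub>R edge_vec u v w))"
    unfolding inner_sum_right sum_distrib_left ..
  finally show ?thesis unfolding sum_edge_vec .
qed

lemma fn_derivative: "(fn i has_derivative (\<lambda>h. gr i t \<bullet> h)) (at t)"
proof (cases i)
  case (Inl p)
  obtain u v where p: "p = (u, v)" by (cases p)
  have pos': "((\<lambda>t. pos t u) has_derivative (\<lambda>h. h $ u *\<^sub>R d (line_of u))) (at t)" for u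
    unfolding pos_def by (auto intro!: derivative_eq_intros bounded_linear.has_derivative[OF bounded_linear_vec_nth])
  have "((\<lambda>t. (pos t u - pos t v) \<bullet> (pos t u - pos t v)) has_derivative
      (\<lambda>h. (pos t u - pos t v) \<bullet> (h $ u *\<^sub>R d (line_of u) - h $ v *\<^sub>R d (line_of v)) +
        (h $ u *\<^sub>R d (line_of u) - h $ v *\<^sub>R d (line_of v)) \<bullet> (pos t u - pos t v))) (at t)"
    by (intro has_derivative_inner has_derivative_diff pos')
  moreover have "fn i = (\<lambda>t. (pos t u - pos t v) \<bullet> (pos t u - pos t v))"
    by (rule ext) (simp add: Inl p len2_def power2_norm_eq_inner)
  moreover have "gr i t \<bullet> h = (pos t u - pos t v) \<bullet> (h $ u *\<^sub>R d (line_of u) - h $ v *\<^sub>R d (line_of v)) +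
        (h $ u *\<^sub>R d (line_of u) - h $ v *\<^sub>R d (line_of v)) \<bullet> (pos t u - pos t v)" for h
    unfolding Inl p inner_gr by (simp add: inner_commute)
  ultimately show ?thesis by simp
next
  case (Inr w)
  have "fn i = (\<lambda>t. t $ w)" by (rule ext) (simp add: Inr)
  moreover have "gr i t \<bullet> h = h $ w" for h by (simp add: Inr inner_axis')
  ultimately show ?thesis by (simp add: bounded_linear.has_derivative[OF bounded_linear_vec_nth])
qed

lemma gr_affine: "gr i t = hess i *v t + gr i 0"
proof (cases i)
  case (Inl p)
  obtain u v where p: "p = (u, v)" by (cases p)
  have P: "pos t u - pos t v = (pos 0 u - pos 0 v) + (\<Sum>w\<in>UNIV. t $ w *\<^sub>R edge_vec u v w)"
    unfolding sum_edge_vec by (simp add: pos_def)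
  have "gr i t $ w = (hess i *v t) $ w + gr i 0 $ w" for w
  proof -
    have "(hess i *v t) $ w = 2 * (edge_vec u v w \<bullet> (\<Sum>w'\<in>UNIV. t $ w' *\<^sub>R edge_vec u v w'))"
      unfolding matrix_vector_mult_def inner_sum_right sum_distrib_left by (simp add: Inl p mult_ac)
    moreover have "(pos t u - pos t v) \<bullet> edge_vec u v w = (pos 0 u - pos 0 v) \<bullet> edge_vec u v w +
        edge_vec u v w \<bullet> (\<Sum>w'\<in>UNIV. t $ w' *\<^sub>R edge_vec u v w')"
      unfolding P inner_add_left by (simp only: inner_commute)
    ultimately show ?thesis by (simp add: Inl p)
  qed
  then show ?thesis by (simp add: Finite_Cartesian_Product.vec_eq_iff)
next
  case (Inr w)
  then show ?thesis by (simp add: matrix_vector_mult_def Finite_Cartesian_Product.vec_eq_iff)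
qed

lemma hess_symmetric: "Finite_Cartesian_Product.transpose (hess i) = hess i"
proof (cases i)
  case (Inl p)
  obtain u v where p: "p = (u, v)" by (cases p)
  show ?thesis
    by (simp add: Inl p Finite_Cartesian_Product.transpose_def Finite_Cartesian_Product.vec_eq_iff inner_commute)
next
  case (Inr w)
  then show ?thesis by (simp add: Finite_Cartesian_Product.transpose_def Finite_Cartesian_Product.vec_eq_iff)
qed

lemma gr_polyfun: "(\<lambda>t. gr i t $ w) \<in> polyfun K UNIV"
proof (cases i)
  case (Inl p)
  obtain u v where p: "p = (u, v)" by (cases p)
  note K = is_subfieldD[OF K_subfield]
  let ?e = "edge_vec u v w"
  have e: "?e $ c \<in> K" for c
  proof -
    have "(if w = u then d (line_of u) else 0) $ c \<in> K" for u
      by (cases "w = u") (simp_all only: if_True if_False simp_thms zero_index d_in[OF line_of_in] K(1))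
    then show ?thesis unfolding edge_vec_def vector_minus_component by (intro K(7))
  qed
  have two: "2 \<in> K" using K(5)[OF K(2) K(2)] by simp
  have c: "a (line_of u) \<bullet> ?e \<in> K" "d (line_of u) \<bullet> ?e \<in> K" for u
    by (intro inner_K a_in d_in line_of_in e)+
  have "(\<lambda>t. 2 * (((a (line_of u) \<bullet> ?e + t $ u * (d (line_of u) \<bullet> ?e)) -
      (a (line_of v) \<bullet> ?e + t $ v * (d (line_of v) \<bullet> ?e))))) \<in> polyfun K UNIV"
    by (intro polyfun.mult polyfun_diff[OF K_subfield] polyfun.add polyfun.const polyfun.coord c two UNIV_I)
  then show ?thesis by (simp add: Inl p pos_def inner_diff_left inner_add_left)
next
  case (Inr u)
  then show ?thesis using is_subfieldD(1,2)[OF K_subfield] by (simp add: axis_def polyfun.const)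
qed

text \<open>The gradients fail to span. For edge functions, \<open>s\<close> is a nonzero
  infinitesimal flex written in the line parameters.\<close>

definition degenerate :: "(('v \<times> 'v) + 'v) set \<Rightarrow> real^'v \<Rightarrow> bool" where
  "degenerate I t \<longleftrightarrow> (\<exists>s. s \<noteq> 0 \<and> (\<forall>i\<in>I. gr i t \<bullet> s = 0))"

text \<open>A minor that is nonzero at \<open>x\<close> is a polynomial over \<open>K\<close>, but
  it vanishes at the generic \<open>t\<close> and hence identically.\<close>

lemma degenerate_everywhere:
  assumes gen: "generic_point K t" and "degenerate I t"
  shows "degenerate I x"
proof (rule ccontr)
  assume "\<not> degenerate I x"
  then obtain \<sigma> where \<sigma>: "range \<sigma> \<subseteq> I" "det (\<chi> k. gr (\<sigma> k) x) \<noteq> 0"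
    unfolding degenerate_def by (rule exists_nonzero_minor[where g = "\<lambda>i. gr i x"])
  obtain s where s: "s \<noteq> 0" "\<forall>i\<in>I. gr i t \<bullet> s = 0" using assms(2) unfolding degenerate_def by (elim exE conjE)
  have in_I: "\<sigma> k \<in> I" for k using \<sigma>(1) by (rule subsetD) simp
  have "det (\<chi> k. gr (\<sigma> k) t) = 0"
    by (rule det_eq_0_if_rows_orthogonal[OF s(1)]) (simp add: s(2) in_I)
  moreover have "(\<lambda>t. det (\<chi> k. gr (\<sigma> k) t)) \<in> polyfun K UNIV"
  proof -
    have "of_int (sign p) \<in> K" for p :: "'v \<Rightarrow> 'v"
      using is_subfieldD(2,3)[OF K_subfield] by (simp add: sign_def)
    then have "(\<lambda>t. \<Sum>p | p permutes (UNIV :: 'v set). of_int (sign p) * (\<Prod>k\<in>UNIV. gr (\<sigma> k) t $ p k)) \<in> polyfun K UNIV"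
      by (intro polyfun_sum[OF K_subfield] polyfun.mult polyfun.const polyfun_prod[OF K_subfield] gr_polyfun)
    then show ?thesis by (simp add: det_def)
  qed
  ultimately have "(\<lambda>t. det (\<chi> k. gr (\<sigma> k) t)) = (\<lambda>_. 0)"
    using gen unfolding generic_point_def by simp
  from fun_cong[OF this, of x] \<sigma>(2) show False by simp
qed

definition edge_indices :: "'v set set \<Rightarrow> (('v \<times> 'v) + 'v) set" where
  "edge_indices F = {Inl (u, v) | u v. {u, v} \<in> F}"

text \<open>Two of the lines met are not parallel, so rigidity asks for dimension \<open>0\<close>
  and its failure yields a nonzero flex, whose velocities are multiples of the directions.\<close>

lemma degenerate_if_flexible:
  assumes "\<not> infinitesimally_rigid k L V F (pos t)"
  shows "degenerate (edge_indices F) t"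
proof -
  obtain v w where vw: "line_of w \<noteq> line_of v" using exists_other_line by blast
  have not_all: "\<not> (\<forall>S\<in>lines_met k L V UNIV. \<forall>T\<in>lines_met k L V UNIV. affine_parallel S T)"
  proof
    assume "\<forall>S\<in>lines_met k L V UNIV. \<forall>T\<in>lines_met k L V UNIV. affine_parallel S T"
    from bspec[OF bspec[OF this line_met[OF rangeI]] line_met[OF rangeI]]
    have "affine_parallel (L (line_of w)) (L (line_of v))" .
    with not_parallel[OF line_of_in line_of_in vw] show False by simp
  qed
  have "dim (infinitesimal_flexes k L V F (pos t)) \<noteq> 0"
    using assms unfolding infinitesimally_rigid_def if_not_P[OF not_all] .
  then have "\<not> infinitesimal_flexes k L V F (pos t) \<subseteq> {0}" by (simp add: dim_eq_0)
  then obtain f where f: "f \<in> infinitesimal_flexes k L V F (pos t)" "f \<noteq> 0" by blast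
  have edge: "(pos t u - pos t v) \<bullet> (f $ u - f $ v) = 0" if "{u, v} \<in> F" for u v
    using f(1) that unfolding infinitesimal_flexes_def by simp
  have "f $ v \<in> line_kernel (L (line_of v))" for v
    using f(1) line_of_in[of v] line_of_mem[of v] unfolding infinitesimal_flexes_def by simp
  then have "\<forall>v. \<exists>s. f $ v = s *\<^sub>R d (line_of v)" unfolding ker_eq[OF line_of_in] by blast
  then obtain s0 where s0: "\<And>v. f $ v = s0 v *\<^sub>R d (line_of v)" by metis
  define s where "s = (\<chi> v. s0 v)"
  have "s \<noteq> 0"
  proof
    assume "s = 0"
    then have "s0 v = 0" for v by (simp add: s_def Finite_Cartesian_Product.vec_eq_iff)
    then have "f = 0" using s0 by (simp add: Finite_Cartesian_Product.vec_eq_iff)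
    with f(2) show False ..
  qed
  moreover have "gr i t \<bullet> s = 0" if "i \<in> edge_indices F" for i
  proof -
    from that obtain u v where i: "i = Inl (u, v)" "{u, v} \<in> F" unfolding edge_indices_def by blast
    show ?thesis unfolding i(1) inner_gr using edge[OF i(2)] s0 by (simp add: s_def)
  qed
  ultimately show ?thesis unfolding degenerate_def by blast
qed

text \<open>Both the frontier condition and the uniqueness of \<open>t\<close> persist when
  functions are added to the family, which is what lets the fibre lemma be applied
  repeatedly.\<close>

lemma degenerate_contradiction:
  assumes gen: "generic_point K t" and xy: "{x, y} \<in> E"
    and degen: "degenerate (edge_indices (E - {{x, y}})) t"
    and U: "open U" "bounded U" "t \<in> U"
    and front: "\<And>z. z \<in> frontier U \<Longrightarrow> \<exists>u v. {u, v} \<in> E - {{x, y}} \<and> len2 z u v \<noteq> len2 t u v"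
    and uniq: "\<And>z. z \<in> U \<Longrightarrow> same_lengths z t \<Longrightarrow> z = t"
  shows False
proof -
  define I0 where "I0 = insert (Inl (x, y)) (edge_indices (E - {{x, y}}))"
  have front': "\<exists>i\<in>I. fn i z \<noteq> fn i t" if "z \<in> frontier U" "edge_indices (E - {{x, y}}) \<subseteq> I" for z I
  proof -
    from front[OF that(1)] obtain u v where "{u, v} \<in> E - {{x, y}}" "len2 z u v \<noteq> len2 t u v"
      by (elim exE conjE)
    then show ?thesis using that(2) unfolding edge_indices_def by (intro bexI[of _ "Inl (u, v)"]) auto
  qed
  have uniq': "z = t" if "z \<in> U" "\<forall>i\<in>I. fn i z = fn i t" "I0 \<subseteq> I" for z I
  proof (rule uniq[OF that(1)], unfold same_lengths_iff, intro allI impI)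
    fix u v assume uv: "{u, v} \<in> E"
    have eq: "fn i z = fn i t" if "i \<in> I0" for i using that \<open>I0 \<subseteq> I\<close> \<open>\<forall>i\<in>I. fn i z = fn i t\<close> by blast
    have xy_eq: "len2 z x y = len2 t x y" using eq[of "Inl (x, y)"] by (simp add: I0_def)
    show "len2 z u v = len2 t u v"
    proof (cases "{u, v} = {x, y}")
      case True
      then have "u = x \<and> v = y \<or> u = y \<and> v = x" by (simp add: doubleton_eq_iff)
      then show ?thesis using xy_eq by (elim disjE) (simp_all add: len2_commute[of _ y x])
    next
      case False
      then have "Inl (u, v) \<in> I0" using uv by (simp add: I0_def edge_indices_def)
      from eq[OF this] show ?thesis by simp
    qed
  qed
  have key: "degenerate (insert j I) t"
    if "j \<notin> I" "degenerate I t" "edge_indices (E - {{x, y}}) \<subseteq> I" "I0 \<subseteq> insert j I" for I j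
  proof -
    have dI: "\<exists>s. s \<noteq> 0 \<and> (\<forall>i\<in>I. gr i z \<bullet> s = 0)" for z
      using degenerate_everywhere[OF gen that(2), of z] unfolding degenerate_def .
    show ?thesis unfolding degenerate_def
    proof (rule gradients_degenerate_at_isolated_fibre[where f = fn and A = hess and b = "\<lambda>i. gr i 0" and U = U,
          OF _ that(1) fn_derivative gr_affine hess_symmetric dI U])
      show "finite I" by (rule finite_class.finite)
      show "\<exists>i\<in>I. fn i z \<noteq> fn i t" if "z \<in> frontier U" for z
        by (rule front'[OF that \<open>edge_indices (E - {{x, y}}) \<subseteq> I\<close>])
      show "z = t" if "z \<in> U" "\<forall>i\<in>insert j I. fn i z = fn i t" for z
        by (rule uniq'[OF that \<open>I0 \<subseteq> insert j I\<close>])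
    qed
  qed
  have "Inl (x, y) \<notin> edge_indices (E - {{x, y}})" by (simp add: edge_indices_def)
  from key[OF this degen] have I0: "degenerate I0 t" unfolding I0_def by simp
  \<comment> \<open>Take a maximal set of coordinates compatible with degeneracy. It cannot contain
    all of them, yet the fibre lemma always admits one more.\<close>
  define \<C> where "\<C> = {C. degenerate (I0 \<union> Inr ` C) t}"
  have "{} \<in> \<C>" using I0 by (simp add: \<C>_def)
  then obtain C where C: "C \<in> \<C>" "\<And>D. D \<in> \<C> \<Longrightarrow> C \<subseteq> D \<Longrightarrow> C = D"
    using finite_has_maximal[of \<C>] by (metis empty_iff finite_class.finite)
  have "C \<noteq> UNIV"
  proof
    assume "C = UNIV"
    then obtain s where s: "s \<noteq> 0" "\<forall>i\<in>I0 \<union> Inr ` UNIV. gr i t \<bullet> s = 0"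
      using C(1) unfolding \<C>_def degenerate_def by blast
    have "s $ w = 0" for w using bspec[OF s(2), of "Inr w"] by (simp add: inner_axis')
    then show False using s(1) by (simp add: Finite_Cartesian_Product.vec_eq_iff)
  qed
  then obtain c where c: "c \<notin> C" by blast
  have "degenerate (insert (Inr c) (I0 \<union> Inr ` C)) t"
  proof (rule key)
    show "Inr c \<notin> I0 \<union> Inr ` C" using c by (auto simp: I0_def edge_indices_def)
    show "degenerate (I0 \<union> Inr ` C) t" using C(1) by (simp add: \<C>_def)
  qed (auto simp: I0_def)
  then have "insert c C \<in> \<C>" by (simp add: \<C>_def)
  from C(2)[OF this] c show False by blast
qed

text \<open>An edge between two lines bounds its ends, and along an edge inside a line boundedness
  passes from one end to the other. So the unbounded vertices of one line would be closed under
  adjacency in \<open>G - e\<close> without meeting a second line.\<close>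

lemma bounded_fibre:
  assumes P: "P_connected k L V E"
  shows "bounded {z. \<forall>u v. {u, v} \<in> E - {{x, y}} \<longrightarrow> len2 z u v = len2 t u v}"
proof -
  define Z where "Z = {z. \<forall>u v. {u, v} \<in> E - {{x, y}} \<longrightarrow> len2 z u v = len2 t u v}"
  have Z: "len2 z u v = len2 t u v" if "z \<in> Z" "{u, v} \<in> E - {{x, y}}" for z u v
    using that unfolding Z_def by simp
  define B where "B v \<longleftrightarrow> (\<exists>M. \<forall>z\<in>Z. \<bar>z $ v\<bar> \<le> M)" for v
  have cross_bd: "B u" if uv: "{u, v} \<in> E - {{x, y}}" and ne: "line_of u \<noteq> line_of v" for u v
  proof -
    let ?i = "line_of u" and ?j = "line_of v"
    define q where "q = len2 t u v - offset ?i ?j"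
    define M where "M = (d ?j \<bullet> d ?j) * q / disc ?i ?j"
    have "\<bar>z $ u\<bar> \<le> M + 1 + \<bar>cen ?i ?j\<bar>" if "z \<in> Z" for z
    proof -
      define S where "S = z $ u - cen ?i ?j"
      have "qf ?i ?j S (z $ v - cen ?j ?i) = q"
        using Z[OF that uv] len2_cross[OF ne, of z] unfolding q_def S_def by simp
      then have "disc ?i ?j * S\<^sup>2 \<le> (d ?j \<bullet> d ?j) * q"
        using qf_lower_bound[OF line_of_in line_of_in ne, of S "z $ v - cen ?j ?i"] by simp
      then have "S\<^sup>2 \<le> M" unfolding M_def
        using disc_pos[OF line_of_in line_of_in ne] by (simp add: pos_le_divide_eq mult.commute)
      moreover have "\<bar>S\<bar> \<le> S\<^sup>2 + 1"
      proof -
        have "0 \<le> (\<bar>S\<bar> - 1)\<^sup>2" by simp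
        then have "2 * \<bar>S\<bar> \<le> S\<^sup>2 + 1" by (simp add: power2_diff)
        then show ?thesis by linarith
      qed
      ultimately show ?thesis unfolding S_def by linarith
    qed
    then show ?thesis unfolding B_def by blast
  qed
  have same_bd: "B v" if uv: "{u, v} \<in> E - {{x, y}}" and eq: "line_of u = line_of v" and u: "B u" for u v
  proof -
    obtain M where M: "\<And>z. z \<in> Z \<Longrightarrow> \<bar>z $ u\<bar> \<le> M" using u unfolding B_def by blast
    have "\<bar>z $ v\<bar> \<le> M + \<bar>t $ u - t $ v\<bar>" if "z \<in> Z" for z
    proof -
      have "(z $ u - z $ v)\<^sup>2 = (t $ u - t $ v)\<^sup>2"
        using Z[OF that uv] d_nz[OF line_of_in[of v]] unfolding len2_same[OF eq] by simp
      then have "\<bar>z $ u - z $ v\<bar> = \<bar>t $ u - t $ v\<bar>" by (simp add: power2_eq_iff abs_eq_iff)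
      then show ?thesis using M[OF that] by linarith
    qed
    then show ?thesis unfolding B_def by blast
  qed
  have all: "B u" for u
  proof (rule ccontr)
    assume "\<not> B u"
    define U where "U = {w. line_of w = line_of u \<and> \<not> B w}"
    have "adj_closed UNIV (E - {{x, y}}) U" unfolding adj_closed_def
    proof (intro conjI allI impI)
      fix v w assume v: "v \<in> U" and vw: "{v, w} \<in> E - {{x, y}}"
      have wv: "{w, v} \<in> E - {{x, y}}" using vw by (simp add: insert_commute)
      have "\<not> B v" "line_of v = line_of u" using v by (simp_all add: U_def)
      have "line_of v = line_of w"
      proof (rule ccontr)
        assume "line_of v \<noteq> line_of w"
        from cross_bd[OF vw this] \<open>\<not> B v\<close> show False by contradiction
      qed
      moreover have "\<not> B w"
      proof
        assume "B w"
        from same_bd[OF wv _ this] \<open>line_of v = line_of w\<close> \<open>\<not> B v\<close> show False by simp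
      qed
      ultimately show "w \<in> U" using \<open>line_of v = line_of u\<close> by (simp add: U_def)
    qed simp
    moreover have "U \<noteq> {}" using \<open>\<not> B u\<close> unfolding U_def by auto
    ultimately obtain w where "w \<in> U" "line_of w \<noteq> line_of u"
      using P_connected_closed_delete_edge[OF P, of x y U "line_of u"] by blast
    then show False by (simp add: U_def)
  qed
  then obtain M where M: "\<And>v z. z \<in> Z \<Longrightarrow> \<bar>z $ v\<bar> \<le> M v" unfolding B_def by metis
  have "norm z \<le> (\<Sum>v\<in>UNIV. M v)" if "z \<in> Z" for z
    by (rule order_trans[OF norm_le_l1_cart]) (intro sum_mono M that)
  then have "bounded Z" unfolding bounded_iff by blast
  then show ?thesis unfolding Z_def .
qed

text \<open>With three lines \<open>t\<close> is alone in its fibre in the whole space, so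
  \<open>U\<close> can be any open ball around the bounded fibre of \<open>G - e\<close>.\<close>

lemma no_flex_three_lines:
  assumes rigid: "generically_globally_rigid k L V E" and gen: "generic_point K t"
    and xy: "{x, y} \<in> E" and degen: "degenerate (edge_indices (E - {{x, y}})) t"
    and three: "card (range line_of) \<ge> 3"
  shows False
proof -
  let ?F = "E - {{x, y}}"
  define Z where "Z = {z. \<forall>u v. {u, v} \<in> ?F \<longrightarrow> len2 z u v = len2 t u v}"
  have "bounded Z" unfolding Z_def by (rule bounded_fibre[OF P_connected_if_rigid[OF rigid]])
  then obtain r where r: "\<And>z. z \<in> Z \<Longrightarrow> norm z < r" unfolding bounded_pos_less by blast
  have "t \<in> Z" by (simp add: Z_def)
  show False
  proof (rule degenerate_contradiction[OF gen xy degen, of "ball 0 r"])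
    show "t \<in> ball 0 r" using r[OF \<open>t \<in> Z\<close>] by simp
    have "r > 0" using r[OF \<open>t \<in> Z\<close>] norm_ge_zero[of t] by linarith
    fix z :: "real^'v" assume "z \<in> frontier (ball 0 r)"
    then have "norm z = r" using \<open>r > 0\<close> by (simp add: frontier_ball)
    then have "z \<notin> Z" using r[of z] by auto
    then show "\<exists>u v. {u, v} \<in> ?F \<and> len2 z u v \<noteq> len2 t u v" unfolding Z_def by blast
  next
    show "z = t" if "same_lengths z t" for z
      by (rule rigid_three_lines[OF rigid_at_generic[OF rigid gen] that three])
  qed simp_all
qed

text \<open>
  With only two lines the reflection in the two closest points always gives a second point of the
  fibre, so the fibre lemma has to be localised. Put \<open>x\<close> at distance one from its closest point and
  all other vertices at the closest points: this configuration is isolated in its fibre, because the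
  components of \<open>G - x\<close> meet both lines.
\<close>

lemma no_flex_two_lines:
  assumes rigid: "generically_globally_rigid k L V E" and gen: "generic_point K t1"
    and xy: "{x, y} \<in> E" and degen: "degenerate (edge_indices (E - {{x, y}})) t1"
    and two: "range line_of = {i, j}" "i \<noteq> j"
  shows False
proof -
  let ?F = "E - {{x, y}}"
  note P = P_connected_if_rigid[OF rigid]
  define opp where "opp v = (if line_of v = i then j else i)" for v
  have on: "line_of u = i \<or> line_of u = j" for u using rangeI[of line_of u] two(1) by simp
  have opp_in: "opp v \<in> range line_of" for v using two(1) by (simp add: opp_def)
  have opp_ne: "line_of v \<noteq> opp v" for v using two(2) by (simp add: opp_def)
  have opp: "opp u = line_of v" if "line_of u \<noteq> line_of v" for u v
    using on[of u] on[of v] that two(2) unfolding opp_def by auto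
  define c where "c v = cen (line_of v) (opp v)" for v
  have c_same: "c u = c v" if "line_of u = line_of v" for u v using that by (simp add: c_def opp_def)
  have cross: "len2 z u v = qf (line_of u) (line_of v) (z $ u - c u) (z $ v - c v) + offset (line_of u) (line_of v)"
    if "line_of u \<noteq> line_of v" for z u v
    unfolding len2_cross[OF that] c_def opp[OF that] opp[OF not_sym[OF that]] ..
  define t0 where "t0 = (\<chi> v. c v + (if v = x then 1 else 0))"
  \<comment> \<open>The second solution is the reflection of \<open>t0\<close>, which fixes every
    vertex except \<open>x\<close> because they all sit at closest points.\<close>
  have fibre: "z = t0 \<or> z = t0 - 2 *\<^sub>R axis x 1" if z: "\<And>u v. {u, v} \<in> ?F \<Longrightarrow> len2 z u v = len2 t0 u v" for z
  proof -
    have others: "z $ w0 = c w0" if "w0 \<noteq> x" for w0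
    proof (rule ccontr)
      assume ne: "z $ w0 \<noteq> c w0"
      \<comment> \<open>An edge between the lines that avoids \<open>x\<close> has its minimal
        length, so its ends cannot leave the closest points. Displaced vertices are thus joined,
        away from \<open>x\<close>, only to displaced vertices of the same line.\<close>
      define U where "U = {w. w \<noteq> x \<and> line_of w = line_of w0 \<and> z $ w \<noteq> c w}"
      have "adj_closed (UNIV - {x}) E U" unfolding adj_closed_def
      proof (intro conjI allI impI subsetI)
        show "u \<in> UNIV - {x}" if "u \<in> U" for u using that by (simp add: U_def)
        fix u w assume u: "u \<in> U" and w: "w \<in> UNIV - {x}" and uw: "{u, w} \<in> E"
        have ux: "u \<noteq> x" "line_of u = line_of w0" "z $ u \<noteq> c u" using u by (simp_all add: U_def)
        have wx: "w \<noteq> x" using w by simp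
        have "{u, w} \<noteq> {x, y}" using ux(1) wx by (simp add: doubleton_eq_iff)
        then have F: "{u, w} \<in> ?F" using uw by simp
        have t0: "t0 $ u = c u" "t0 $ w = c w" using ux(1) wx by (simp_all add: t0_def)
        have eq: "line_of u = line_of w"
        proof (rule ccontr)
          assume cr: "line_of u \<noteq> line_of w"
          have "qf (line_of u) (line_of w) (z $ u - c u) (z $ w - c w) = qf (line_of u) (line_of w) 0 0"
            using z[OF F] unfolding cross[OF cr] t0 by simp
          then have "qf (line_of u) (line_of w) (z $ u - c u) (z $ w - c w) = 0" by (simp add: qf_def)
          from qf_zero[OF line_of_in line_of_in cr this] ux(3) show False by simp
        qed
        have "z $ u = z $ w"
          using z[OF F] d_nz[OF line_of_in[of w]] unfolding len2_same[OF eq] t0 c_same[OF eq] by simp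
        then show "w \<in> U" using ux wx eq c_same[OF eq] by (simp add: U_def)
      qed
      moreover have "U \<noteq> {}" using that ne unfolding U_def by auto
      ultimately obtain u where "u \<in> U" "line_of u \<noteq> line_of w0"
        using P_connected_closed_delete_vertex[OF P, of x U "line_of w0"] by blast
      then show False by (simp add: U_def)
    qed
    \<comment> \<open>An isolated \<open>x\<close> would be a closed set on a single line. The
      remaining edge at \<open>x\<close> determines how far \<open>x\<close> is from its closest
      point.\<close>
    have "\<exists>w. {x, w} \<in> ?F"
    proof (rule ccontr)
      assume no: "\<not> (\<exists>w. {x, w} \<in> ?F)"
      have "adj_closed UNIV ?F {x}" unfolding adj_closed_def
      proof (intro conjI allI impI)
        fix u w assume "u \<in> {x}" "{u, w} \<in> ?F"
        then have "{x, w} \<in> ?F" by simp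
        with no show "w \<in> {x}" by blast
      qed simp
      from P_connected_closed_delete_edge[OF P this, of "line_of x"] show False by simp
    qed
    then obtain w where w: "{x, w} \<in> ?F" by (rule exE)
    have wx: "w \<noteq> x"
    proof
      assume "w = x"
      then have "card {x} = 2" using w simple unfolding simple_graph_def by auto
      then show False by simp
    qed
    have t0: "t0 $ x = c x + 1" "t0 $ w = c w" using wx by (simp_all add: t0_def)
    have "(z $ x - c x)\<^sup>2 = 1"
    proof (cases "line_of x = line_of w")
      case True
      then show ?thesis
        using z[OF w] d_nz[OF line_of_in[of w]] unfolding len2_same[OF True] t0 others[OF wx] c_same[OF True] by simp
    next
      case False
      have "qf (line_of x) (line_of w) (z $ x - c x) 0 = qf (line_of x) (line_of w) 1 0"
        using z[OF w] unfolding cross[OF False] t0 others[OF wx] by simp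
      then show ?thesis using d_nz[OF line_of_in[of x]] by (simp add: qf_def)
    qed
    then have "z $ x - c x = 1 \<or> z $ x - c x = -1" by (simp add: power2_eq_1_iff)
    then show ?thesis
    proof
      assume zx: "z $ x - c x = 1"
      have "z $ v = t0 $ v" for v by (cases "v = x") (use zx others in \<open>simp_all add: t0_def\<close>)
      then show ?thesis by (simp add: Finite_Cartesian_Product.vec_eq_iff)
    next
      assume zx: "z $ x - c x = -1"
      have "z $ v = (t0 - 2 *\<^sub>R axis x 1) $ v" for v
        by (cases "v = x") (use zx others in \<open>simp_all add: t0_def axis_def\<close>)
      then have "z = t0 - 2 *\<^sub>R axis x 1"
        by (intro Finite_Cartesian_Product.vec_eq_iff[THEN iffD2] allI)
      then show ?thesis ..
    qed
  qed
  define Q where "Q = {(u, v). {u, v} \<in> ?F}"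
  \<comment> \<open>The total deviation of the lengths from those of \<open>t0\<close>. The two
    fibre points are at distance \<open>0\<close> and \<open>2\<close> from \<open>t0\<close>, so
    \<open>D\<close> is positive on the compact unit sphere and has a positive lower bound
    \<open>\<delta>\<close> there.\<close>
  define D where "D z = (\<Sum>(u, v)\<in>Q. \<bar>len2 z u v - len2 t0 u v\<bar>)" for z
  have D_cong: "D z = D z'" if eq: "\<And>u v. {u, v} \<in> ?F \<Longrightarrow> len2 z u v = len2 z' u v" for z z'
    unfolding D_def
  proof (intro sum.cong refl)
    fix p assume "p \<in> Q"
    then obtain u v where "p = (u, v)" "{u, v} \<in> ?F" unfolding Q_def by blast
    then show "(case p of (u, v) \<Rightarrow> \<bar>len2 z u v - len2 t0 u v\<bar>) =
        (case p of (u, v) \<Rightarrow> \<bar>len2 z' u v - len2 t0 u v\<bar>)"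
      using eq[of u v] by simp
  qed
  have D_cont: "continuous_on S D" for S
  proof -
    have "continuous_on S (\<lambda>z. len2 z u v)" for u v
      unfolding len2_def pos_def by (intro continuous_intros)
    then show ?thesis unfolding D_def case_prod_beta by (intro continuous_intros)
  qed
  have D_pos: "D z > 0" if z: "z \<in> sphere t0 1" for z
  proof (rule ccontr)
    assume "\<not> D z > 0"
    moreover have "D z \<ge> 0" unfolding D_def by (intro sum_nonneg) auto
    ultimately have "D z = 0" by simp
    then have "\<forall>p\<in>Q. (case p of (u, v) \<Rightarrow> \<bar>len2 z u v - len2 t0 u v\<bar>) = 0"
      unfolding D_def by (subst (asm) sum_nonneg_eq_0_iff) auto
    then have "len2 z u v = len2 t0 u v" if "{u, v} \<in> ?F" for u v
      using bspec[of Q _ "(u, v)"] that by (simp add: Q_def)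
    from fibre[OF this] show False
    proof
      assume "z = t0"
      with z show False by simp
    next
      assume "z = t0 - 2 *\<^sub>R axis x 1"
      with z show False by (simp add: dist_norm)
    qed
  qed
  obtain \<delta> where \<delta>: "\<delta> > 0" "\<And>z. z \<in> sphere t0 1 \<Longrightarrow> \<delta> \<le> D z"
  proof (cases "sphere t0 1 = {}")
    case True
    show thesis by (rule that[of 1]) (use True in auto)
  next
    case False
    obtain z0 where "z0 \<in> sphere t0 1" "\<forall>z\<in>sphere t0 1. D z0 \<le> D z"
      using continuous_attains_inf[OF compact_sphere False D_cont] by blast
    then show thesis by (intro that[of "D z0"] D_pos) simp_all
  qed
  \<comment> \<open>For a point of \<open>W\<close> the deviation is below \<open>\<delta>\<close>,
    so its fibre misses the sphere. Genericity of the chosen point makes global rigidity available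
    there.\<close>
  define W where "W = ball t0 1 \<inter> {z. D z < \<delta>}"
  have "open W" unfolding W_def
    by (intro open_Int open_ball open_Collect_less D_cont continuous_on_const)
  moreover have "t0 \<in> W" using \<delta>(1) by (simp add: W_def D_def)
  then have "W \<noteq> {}" by blast
  ultimately obtain t where t: "t \<in> W" "generic_point K t" by (rule exists_generic)
  have "D t < \<delta>" "t \<in> ball t0 1" using t(1) by (simp_all add: W_def)
  \<comment> \<open>Inside the ball \<open>x\<close> stays strictly on one side of its closest
    point, so the ball cannot contain a configuration together with its reflection.\<close>
  have near: "z $ x > c x" if "z \<in> ball t0 1" for z
  proof -
    have "\<bar>(z - t0) $ x\<bar> \<le> norm (z - t0)" by (rule component_le_norm_cart)
    also have "\<dots> < 1" using that by (simp add: dist_norm norm_minus_commute)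
    finally show ?thesis by (simp add: t0_def abs_less_iff)
  qed
  show False
  proof (rule degenerate_contradiction[OF t(2) xy degenerate_everywhere[OF gen degen], of "ball t0 1"])
    show "t \<in> ball t0 1" by fact
    fix z assume "z \<in> frontier (ball t0 1)"
    then have z: "z \<in> sphere t0 1" by (simp add: frontier_ball)
    show "\<exists>u v. {u, v} \<in> ?F \<and> len2 z u v \<noteq> len2 t u v"
    proof (rule ccontr)
      assume "\<not> ?thesis"
      then have "D z = D t" by (intro D_cong) blast
      then show False using \<delta>(2)[OF z] \<open>D t < \<delta>\<close> by simp
    qed
  next
    fix z assume z: "z \<in> ball t0 1" "same_lengths z t"
    note rt = rigid_at_generic[OF rigid t(2)]
    have "z $ x = t $ x \<or> z $ x = 2 * cen (line_of x) (opp x) - t $ x"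
      by (rule rigid_reflection[OF rt z(2) opp_in opp_ne])
    then have "z $ x = t $ x" using near[OF z(1)] near[OF \<open>t \<in> ball t0 1\<close>] unfolding c_def by linarith
    from rigid_move[OF t(2) rt z(2) this] show "z = t" .
  qed simp_all
qed

lemma redundantly_rigid_if_rigid:
  assumes rigid: "generically_globally_rigid k L V E"
  shows "redundantly_rigid k L V E"
  unfolding redundantly_rigid_def line_rigid_def
proof (intro ballI impI)
  fix e p assume e: "e \<in> E" and p: "p \<in> configurations k L V" "line_generic k L p"
  have "card e = 2" using e simple unfolding simple_graph_def by simp
  then obtain x y where xy: "e = {x, y}" "x \<noteq> y" unfolding card_2_iff by (elim exE conjE)
  obtain t where t: "p = pos t" by (rule configuration_pos[OF p(1)])
  have gen: "generic_point K t" using p(2) unfolding t by (rule generic_if_line_generic)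
  have E: "{x, y} \<in> E" using e unfolding xy(1) .
  show "infinitesimally_rigid k L V (E - {e}) p"
  proof (rule ccontr)
    assume "\<not> infinitesimally_rigid k L V (E - {e}) p"
    then have degen: "degenerate (edge_indices (E - {{x, y}})) t"
      unfolding t xy(1) by (rule degenerate_if_flexible)
    show False
    proof (cases "card (range line_of) \<ge> 3")
      case True
      show False by (rule no_flex_three_lines[OF rigid gen E degen True])
    next
      case False
      obtain w where "line_of w \<noteq> line_of x" using exists_other_line by (rule exE)
      then have "card {line_of w, line_of x} = 2" by simp
      moreover have "card {line_of w, line_of x} \<le> card (range line_of)" by (rule card_mono) simp_all
      ultimately have "card (range line_of) = 2" using False by linarith
      then obtain i j where "range line_of = {i, j}" "i \<noteq> j" unfolding card_2_iff by (elim exE conjE)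
      then show False by (rule no_flex_two_lines[OF rigid gen E degen])
    qed
  qed
qed

end

theorem theorem4p6:
  fixes k :: nat
    and L :: "nat \<Rightarrow> (real ^ 'n::{finite,linorder}) set"
    and V :: "nat \<Rightarrow> 'v::finite set"
    and E :: "'v set set"
  assumes "\<forall>i\<in>{1..k}. is_line (L i)"
    and "inj_on L {1..k}"
    and "general_position (L ` {1..k})"
    and "simple_graph E"
    and "partition_of_vertices k V"
    and "crossing k V"
    and "generically_globally_rigid k L V E"
  shows "P_connected k L V E \<and> redundantly_rigid k L V E"
proof -
  let ?K = "lines_field (L ` {1..k})"
  have K: "is_subfield ?K" unfolding lines_field_def by (rule is_subfield_real_subfield)
  \<comment> \<open>The base point and the direction have to be chosen simultaneously, hence a
    choice of pairs.\<close>
  have "\<forall>i\<in>{1..k}. \<exists>q. snd q \<noteq> 0 \<and> (\<forall>c. fst q $ c \<in> ?K) \<and> (\<forall>c. snd q $ c \<in> ?K) \<and>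
      L i = range (\<lambda>s. fst q + s *\<^sub>R snd q) \<and> line_kernel (L i) = range (\<lambda>s. s *\<^sub>R snd q)"
  proof
    fix i assume i: "i \<in> {1..k}"
    have "elements_mat (standard_equation (L i)) \<subseteq> (\<Union>S\<in>L ` {1..k}. elements_mat (standard_equation S))"
      using i by blast
    also have "\<dots> \<subseteq> ?K" unfolding lines_field_def by (rule real_subfield_incl)
    finally have el: "elements_mat (standard_equation (L i)) \<subseteq> ?K" .
    obtain a u where "u \<noteq> 0" "\<And>c. a $ c \<in> ?K" "\<And>c. u $ c \<in> ?K" "L i = range (\<lambda>s. a + s *\<^sub>R u)"
      "line_kernel (L i) = range (\<lambda>s. s *\<^sub>R u)"
      by (rule line_rational_parametrization[OF bspec[OF assms(1) i] K el], rule that; assumption)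
    then show "\<exists>q. snd q \<noteq> 0 \<and> (\<forall>c. fst q $ c \<in> ?K) \<and> (\<forall>c. snd q $ c \<in> ?K) \<and>
      L i = range (\<lambda>s. fst q + s *\<^sub>R snd q) \<and> line_kernel (L i) = range (\<lambda>s. s *\<^sub>R snd q)"
      by (intro exI[of _ "(a, u)"]) simp
  qed
  from bchoice[OF this] obtain q where q: "\<forall>i\<in>{1..k}. snd (q i) \<noteq> 0 \<and> (\<forall>c. fst (q i) $ c \<in> ?K) \<and>
      (\<forall>c. snd (q i) $ c \<in> ?K) \<and> L i = range (\<lambda>s. fst (q i) + s *\<^sub>R snd (q i)) \<and>
      line_kernel (L i) = range (\<lambda>s. s *\<^sub>R snd (q i))" ..
  interpret line_framework k L V E "\<lambda>i. fst (q i)" "\<lambda>i. snd (q i)"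
  proof
    fix i assume "i \<in> {1..k}"
    note qi = bspec[OF q this]
    show "snd (q i) \<noteq> 0" using qi by (elim conjE)
    show "L i = range (\<lambda>s. fst (q i) + s *\<^sub>R snd (q i))" using qi by (elim conjE)
    show "line_kernel (L i) = range (\<lambda>s. s *\<^sub>R snd (q i))" using qi by (elim conjE)
    show "fst (q i) $ c \<in> ?K" for c using qi by (elim conjE) (rule spec)
    show "snd (q i) $ c \<in> ?K" for c using qi by (elim conjE) (rule spec)
  qed (fact assms)+
  show ?thesis using P_connected_if_rigid redundantly_rigid_if_rigid assms(7) by simp
qed

end
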